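(* Let $\Lambda$ be a finitely aligned $k$-graph and let $R$ be a commutative ring with $1$. Then $\operatorname{KP}_R(\Lambda)$ is basically simple if and only if $\Lambda$ is aperiodic and cofinal.
   Context: $\mathbb{N}$ contains $0$; for $m,n\in\mathbb{N}^k$ ($k\ge 1$), $m\le n$ and $m\vee n$ (maximum) are taken coordinatewise. A $k$-graph $\Lambda$ is a countable small category with a functor $d:\Lambda\to\mathbb{N}^k$ ($\mathbb{N}^k$ viewed as a category with one object) satisfying the factorisation property: if $d(\lambda)=m+n$ there are unique $\mu,\nu\in\Lambda$ with $\lambda=\mu\nu$, $d(\mu)=m$, $d(\nu)=n$; write $\lambda(0,m)=\mu$, $\lambda(m,m+n)=\nu$. $\Lambda^0$ denotes the objects (vertices), identified with the identity morphisms, i.e. the morphisms of degree $0$. $r(\lambda), s(\lambda)$ are the range (codomain) and source (domain); $\lambda\mu$ is defined when $s(\lambda)=r(\mu)$. $v\Lambda=\{\lambda\in\Lambda: r(\lambda)=v\}$; $\Lambda v=\{\lambda\in\Lambda:s(\lambda)=v\}$; $v\Lambda w=v\Lambda\cap\Lambda w$. For $\lambda,\mu\in\Lambda$, $\operatorname{MCE}(\lambda,\mu)$ is the set of $\tau\in\Lambda$ with $d(\tau)=d(\lambda)\vee d(\mu)$, $\tau(0,d(\lambda))=\lambda$, $\tau(0,d(\mu))=\mu$, and $\Lambda^{\min}(\lambda,\mu)=\{(\rho,\tau)\in\Lambda\times\Lambda:\lambda\rho=\mu\tau\in\operatorname{MCE}(\lambda,\mu)\}$. $\Lambda$ is finitely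 aligned if every $\Lambda^{\min}(\lambda,\mu)$ is finite (possibly empty). A set $E\subseteq v\Lambda$ is exhaustive if for every $\lambda\in v\Lambda$ there is $\mu\in E$ with $\Lambda^{\min}(\lambda,\mu)\ne\emptyset$. $\operatorname{FE}(\Lambda)$ is the collection of all finite exhaustive sets $E\subseteq v\Lambda\setminus\{v\}$, $v\in\Lambda^0$; for such $E$, $r(E):=v$. Ghost paths: for each $\lambda\in\Lambda$ there is a formal symbol $\lambda^*$, with $v^*:=v$ for $v\in\Lambda^0$; $G(\Lambda^{\ne0})$ is the set of $\lambda^*$ with $\lambda\notin\Lambda^0$. $R$-algebras are associative and not assumed unital. A Kumjian-Pask $\Lambda$-family $\{S_\lambda,S_{\mu^*}:\lambda,\mu\in\Lambda\}$ in an $R$-algebra $A$ is a map $S:\Lambda\cup G(\Lambda^{\neq0})\to A$ such that: (KP1) $\{S_v:v\in\Lambda^0\}$ are mutually orthogonal idempotents; (KP2) if $s(\lambda)=r(\mu)$ then $S_\lambda S_\mu=S_{\lambda\mu}$ and $S_{\mu^*}S_{\lambda^*}=S_{(\lambda\mu)^*}$; (KP3) $S_{\lambda^*}S_\mu=\sum_{(\rho,\tau)\in\Lambda^{\min}(\lambda,\mu)}S_\rho S_{\tau^*}$ for all $\lambda,\mu\in\Lambda$ (empty sum is $0$); (KP4) $\prod_{\lambda\in E}(S_{r(E)}-S_\lambda S_{\lambda^*})=0$ for all $E\in\operatorname{FE}(\Lambda)$ (the factors commute as a consequence of (KP1)-(KP3)). $\operatorname{KP}_R(\Lambda)$ is the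 universal $R$-algebra generated by a Kumjian-Pask $\Lambda$-family $\{s_\lambda,s_{\mu^*}\}$: every Kumjian-Pask $\Lambda$-family $S$ in an $R$-algebra $A$ induces a unique $R$-algebra homomorphism $\operatorname{KP}_R(\Lambda)\to A$ with $s_\lambda\mapsto S_\lambda$, $s_{\mu^*}\mapsto S_{\mu^*}$. An ideal $I$ of $\operatorname{KP}_R(\Lambda)$ is basic if whenever $r\in R\setminus\{0\}$ and $v\in\Lambda^0$, $rs_v\in I$ implies $s_v\in I$. $\operatorname{KP}_R(\Lambda)$ is basically simple if its only basic ideals are $\{0\}$ and $\operatorname{KP}_R(\Lambda)$. Boundary paths: for $m\in(\mathbb{N}\cup\{\infty\})^k$, $\Omega_{k,m}=\{(p,q)\in\mathbb{N}^k\times\mathbb{N}^k:p\le q\le m\}$ is the $k$-graph with objects $\{p\in\mathbb{N}^k:p\le m\}$, $r(p,q)=p$, $s(p,q)=q$, $d(p,q)=q-p$. A boundary path of $\Lambda$ is a degree-preserving functor $x:\Omega_{k,m}\to\Lambda$ such that for every $n\in\mathbb{N}^k$ with $n\le m$ and every $E\in\operatorname{FE}(\Lambda)$ with $r(E)=x(n,n)$ there is $\lambda\in E$ with $n+d(\lambda)\le m$ and $x(n,n+d(\lambda))=\lambda$. Put $d(x)=m$, $x(n)=x(n,n)$, $r(x)=x(0)$; $\partial\Lambda$ is the set of boundary paths. For $\lambda\in\Lambda$ with $s(\lambda)=r(x)$, $\lambda x$ is the boundary path of degree $d(\lambda)+d(x)$ with $(\lambda x)(0,d(\lambda))=\lambda$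 and $(\lambda x)(d(\lambda)+p,d(\lambda)+q)=x(p,q)$. A boundary path $x$ is aperiodic if for all $\lambda,\mu\in\Lambda r(x)$, $\lambda\ne\mu$ implies $\lambda x\neq\mu x$. $\Lambda$ is aperiodic if for each $v\in\Lambda^0$ there is an aperiodic boundary path $x$ with $r(x)=v$. $\Lambda$ is cofinal if for all $v\in\Lambda^0$ and $x\in\partial\Lambda$ there is $n\in\mathbb{N}^k$ with $n\le d(x)$ and $v\Lambda x(n)\neq\emptyset$. *)

theory Defs
  imports
    "HOL-Library.Countable_Set"
    "HOL-Library.Extended_Nat"
    "HOL-Library.FuncSet"
    "HOL-Library.Function_Algebras"
    "HOL-Library.Poly_Mapping"
    "HOL-Algebra.QuotRing"
    "HOL-Algebra.Module"
begin

section \<open>Higher-rank graphs\<close>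

text \<open>
  The monoid of degrees is the type \<open>'k \<Rightarrow> nat\<close> with \<open>'k\<close> a finite (hence nonempty) type, the
  rank being \<open>CARD('k)\<close>; its order, addition and \<open>sup\<close> are pointwise.  A small category is given
  by its set of morphisms alone, each object being identified with its identity morphism.
\<close>

record ('a, 'k) kgraph =
  Mor :: "'a set"
  rg :: "'a \<Rightarrow> 'a"
  sr :: "'a \<Rightarrow> 'a"
  cmp :: "'a \<Rightarrow> 'a \<Rightarrow> 'a"
  dg :: "'a \<Rightarrow> 'k \<Rightarrow> nat"

locale k_graph =
  fixes \<Lambda> :: "('a, 'k::finite) kgraph"
  assumes countable_Mor: "countable (Mor \<Lambda>)"
    and rg_closed: "\<alpha> \<in> Mor \<Lambda> \<Longrightarrow> rg \<Lambda> \<alpha> \<in> Mor \<Lambda>"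
    and sr_closed: "\<alpha> \<in> Mor \<Lambda> \<Longrightarrow> sr \<Lambda> \<alpha> \<in> Mor \<Lambda>"
    and sr_rg: "\<alpha> \<in> Mor \<Lambda> \<Longrightarrow> sr \<Lambda> (rg \<Lambda> \<alpha>) = rg \<Lambda> \<alpha>"
    and rg_sr: "\<alpha> \<in> Mor \<Lambda> \<Longrightarrow> rg \<Lambda> (sr \<Lambda> \<alpha>) = sr \<Lambda> \<alpha>"
    and cmp_closed: "\<lbrakk>\<alpha> \<in> Mor \<Lambda>; \<mu> \<in> Mor \<Lambda>; sr \<Lambda> \<alpha> = rg \<Lambda> \<mu>\<rbrakk> \<Longrightarrow> cmp \<Lambda> \<alpha> \<mu> \<in> Mor \<Lambda>"
    and rg_cmp: "\<lbrakk>\<alpha> \<in> Mor \<Lambda>; \<mu> \<in> Mor \<Lambda>; sr \<Lambda> \<alpha> = rg \<Lambda> \<mu>\<rbrakk> \<Longrightarrow> rg \<Lambda> (cmp \<Lambda> \<alpha> \<mu>) = rg \<Lambda> \<alpha>"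
    and sr_cmp: "\<lbrakk>\<alpha> \<in> Mor \<Lambda>; \<mu> \<in> Mor \<Lambda>; sr \<Lambda> \<alpha> = rg \<Lambda> \<mu>\<rbrakk> \<Longrightarrow> sr \<Lambda> (cmp \<Lambda> \<alpha> \<mu>) = sr \<Lambda> \<mu>"
    and cmp_assoc: "\<lbrakk>\<alpha> \<in> Mor \<Lambda>; \<mu> \<in> Mor \<Lambda>; \<nu> \<in> Mor \<Lambda>; sr \<Lambda> \<alpha> = rg \<Lambda> \<mu>; sr \<Lambda> \<mu> = rg \<Lambda> \<nu>\<rbrakk> \<Longrightarrow>
        cmp \<Lambda> (cmp \<Lambda> \<alpha> \<mu>) \<nu> = cmp \<Lambda> \<alpha> (cmp \<Lambda> \<mu> \<nu>)"
    and cmp_rg: "\<alpha> \<in> Mor \<Lambda> \<Longrightarrow> cmp \<Lambda> (rg \<Lambda> \<alpha>) \<alpha> = \<alpha>"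
    and cmp_sr: "\<alpha> \<in> Mor \<Lambda> \<Longrightarrow> cmp \<Lambda> \<alpha> (sr \<Lambda> \<alpha>) = \<alpha>"
    and dg_rg: "\<alpha> \<in> Mor \<Lambda> \<Longrightarrow> dg \<Lambda> (rg \<Lambda> \<alpha>) = 0"
    and dg_cmp: "\<lbrakk>\<alpha> \<in> Mor \<Lambda>; \<mu> \<in> Mor \<Lambda>; sr \<Lambda> \<alpha> = rg \<Lambda> \<mu>\<rbrakk> \<Longrightarrow>
        dg \<Lambda> (cmp \<Lambda> \<alpha> \<mu>) = dg \<Lambda> \<alpha> + dg \<Lambda> \<mu>"
    and factorisation: "\<lbrakk>\<alpha> \<in> Mor \<Lambda>; dg \<Lambda> \<alpha> = m + n\<rbrakk> \<Longrightarrow>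
        \<exists>!(\<mu>, \<nu>). \<mu> \<in> Mor \<Lambda> \<and> \<nu> \<in> Mor \<Lambda> \<and> sr \<Lambda> \<mu> = rg \<Lambda> \<nu> \<and>
          \<alpha> = cmp \<Lambda> \<mu> \<nu> \<and> dg \<Lambda> \<mu> = m \<and> dg \<Lambda> \<nu> = n"

definition vertices :: "('a, 'k) kgraph \<Rightarrow> 'a set" where
  "vertices \<Lambda> = {v \<in> Mor \<Lambda>. dg \<Lambda> v = 0}"

definition paths_to :: "('a, 'k) kgraph \<Rightarrow> 'a \<Rightarrow> 'a set" where
  "paths_to \<Lambda> v = {\<alpha> \<in> Mor \<Lambda>. rg \<Lambda> \<alpha> = v}"

definition paths_from :: "('a, 'k) kgraph \<Rightarrow> 'a \<Rightarrow> 'a set" where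
  "paths_from \<Lambda> v = {\<alpha> \<in> Mor \<Lambda>. sr \<Lambda> \<alpha> = v}"

text \<open>The initial segment \<open>\<lambda>(0,m)\<close>, meaningful for \<open>m \<le> d(\<lambda>)\<close>.\<close>

definition init_seg :: "('a, 'k) kgraph \<Rightarrow> 'a \<Rightarrow> ('k \<Rightarrow> nat) \<Rightarrow> 'a" where
  "init_seg \<Lambda> \<alpha> m = (THE \<mu>. \<mu> \<in> Mor \<Lambda> \<and> dg \<Lambda> \<mu> = m \<and>
     (\<exists>\<nu>\<in>Mor \<Lambda>. sr \<Lambda> \<mu> = rg \<Lambda> \<nu> \<and> \<alpha> = cmp \<Lambda> \<mu> \<nu>))"

definition MCE :: "('a, 'k) kgraph \<Rightarrow> 'a \<Rightarrow> 'a \<Rightarrow> 'a set" where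
  "MCE \<Lambda> \<alpha> \<mu> = {\<tau> \<in> Mor \<Lambda>. dg \<Lambda> \<tau> = sup (dg \<Lambda> \<alpha>) (dg \<Lambda> \<mu>) \<and>
     init_seg \<Lambda> \<tau> (dg \<Lambda> \<alpha>) = \<alpha> \<and> init_seg \<Lambda> \<tau> (dg \<Lambda> \<mu>) = \<mu>}"

definition Lmin :: "('a, 'k) kgraph \<Rightarrow> 'a \<Rightarrow> 'a \<Rightarrow> ('a \<times> 'a) set" where
  "Lmin \<Lambda> \<alpha> \<mu> = {(\<rho>, \<tau>). \<rho> \<in> Mor \<Lambda> \<and> \<tau> \<in> Mor \<Lambda> \<and> sr \<Lambda> \<alpha> = rg \<Lambda> \<rho> \<and> sr \<Lambda> \<mu> = rg \<Lambda> \<tau> \<and>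
     cmp \<Lambda> \<alpha> \<rho> = cmp \<Lambda> \<mu> \<tau> \<and> cmp \<Lambda> \<alpha> \<rho> \<in> MCE \<Lambda> \<alpha> \<mu>}"

definition finitely_aligned :: "('a, 'k) kgraph \<Rightarrow> bool" where
  "finitely_aligned \<Lambda> \<longleftrightarrow> (\<forall>\<alpha>\<in>Mor \<Lambda>. \<forall>\<mu>\<in>Mor \<Lambda>. finite (Lmin \<Lambda> \<alpha> \<mu>))"

definition exhaustive :: "('a, 'k) kgraph \<Rightarrow> 'a \<Rightarrow> 'a set \<Rightarrow> bool" where
  "exhaustive \<Lambda> v E \<longleftrightarrow> E \<subseteq> paths_to \<Lambda> v \<and> (\<forall>\<alpha>\<in>paths_to \<Lambda> v. \<exists>\<mu>\<in>E. Lmin \<Lambda> \<alpha> \<mu> \<noteq> {})"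

text \<open>\<open>FE \<Lambda> v\<close> consists of the sets \<open>E \<in> FE(\<Lambda>)\<close> with \<open>r(E) = v\<close>.\<close>

definition FE :: "('a, 'k) kgraph \<Rightarrow> 'a \<Rightarrow> 'a set set" where
  "FE \<Lambda> v = {E. finite E \<and> E \<subseteq> paths_to \<Lambda> v - {v} \<and> exhaustive \<Lambda> v E}"


section \<open>Boundary paths\<close>

definition enats :: "('k \<Rightarrow> nat) \<Rightarrow> 'k \<Rightarrow> enat" where
  "enats n = (\<lambda>i. enat (n i))"

definition Omega :: "('k \<Rightarrow> enat) \<Rightarrow> (('k \<Rightarrow> nat) \<times> ('k \<Rightarrow> nat), 'k) kgraph" where
  "Omega m = \<lparr>Mor = {(p, q). p \<le> q \<and> enats q \<le> m},
     rg = (\<lambda>(p, q). (p, p)), sr = (\<lambda>(p, q). (q, q)),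
     cmp = (\<lambda>(p, q) (p', q'). (p, q')), dg = (\<lambda>(p, q). q - p)\<rparr>"

definition deg_functor :: "('a, 'k) kgraph \<Rightarrow> ('b, 'k) kgraph \<Rightarrow> ('a \<Rightarrow> 'b) \<Rightarrow> bool" where
  "deg_functor \<Gamma> \<Lambda> x \<longleftrightarrow>
     (\<forall>\<alpha>\<in>Mor \<Gamma>. x \<alpha> \<in> Mor \<Lambda> \<and> rg \<Lambda> (x \<alpha>) = x (rg \<Gamma> \<alpha>) \<and> sr \<Lambda> (x \<alpha>) = x (sr \<Gamma> \<alpha>) \<and>
        dg \<Lambda> (x \<alpha>) = dg \<Gamma> \<alpha>) \<and>
     (\<forall>\<alpha>\<in>Mor \<Gamma>. \<forall>\<beta>\<in>Mor \<Gamma>. sr \<Gamma> \<alpha> = rg \<Gamma> \<beta> \<longrightarrow> x (cmp \<Gamma> \<alpha> \<beta>) = cmp \<Lambda> (x \<alpha>) (x \<beta>))"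

text \<open>
  A boundary path is the pair of its degree \<open>m\<close> and its functor on \<open>\<Omega>\<^bsub>k,m\<^esub>\<close>.  The functor is
  required to be \<^const>\<open>undefined\<close> off the morphisms of \<open>\<Omega>\<^bsub>k,m\<^esub>\<close>, so that equality in HOL is
  equality of boundary paths.
\<close>

type_synonym ('a, 'k) bpath = "('k \<Rightarrow> enat) \<times> (('k \<Rightarrow> nat) \<times> ('k \<Rightarrow> nat) \<Rightarrow> 'a)"

abbreviation bdeg :: "('a, 'k) bpath \<Rightarrow> 'k \<Rightarrow> enat" where
  "bdeg x \<equiv> fst x"

abbreviation bseg :: "('a, 'k) bpath \<Rightarrow> ('k \<Rightarrow> nat) \<Rightarrow> ('k \<Rightarrow> nat) \<Rightarrow> 'a" where
  "bseg x p q \<equiv> snd x (p, q)"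

abbreviation bvert :: "('a, 'k) bpath \<Rightarrow> ('k \<Rightarrow> nat) \<Rightarrow> 'a" where
  "bvert x n \<equiv> bseg x n n"

definition boundary :: "('a, 'k) kgraph \<Rightarrow> ('a, 'k) bpath set" where
  "boundary \<Lambda> = {x. deg_functor (Omega (bdeg x)) \<Lambda> (snd x) \<and>
     snd x \<in> extensional (Mor (Omega (bdeg x))) \<and>
     (\<forall>n E. enats n \<le> bdeg x \<and> E \<in> FE \<Lambda> (bvert x n) \<longrightarrow>
        (\<exists>\<alpha>\<in>E. enats (n + dg \<Lambda> \<alpha>) \<le> bdeg x \<and> bseg x n (n + dg \<Lambda> \<alpha>) = \<alpha>))}"

text \<open>
  The boundary path \<open>\<lambda>x\<close>; see \<open>bcons_ex1\<close> below for its existence and uniqueness.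
\<close>

definition is_bcons :: "('a, 'k) kgraph \<Rightarrow> 'a \<Rightarrow> ('a, 'k) bpath \<Rightarrow> ('a, 'k) bpath \<Rightarrow> bool" where
  "is_bcons \<Lambda> \<alpha> x y \<longleftrightarrow> y \<in> boundary \<Lambda> \<and> bdeg y = enats (dg \<Lambda> \<alpha>) + bdeg x \<and>
     bseg y 0 (dg \<Lambda> \<alpha>) = \<alpha> \<and>
     (\<forall>p q. p \<le> q \<and> enats q \<le> bdeg x \<longrightarrow> bseg y (dg \<Lambda> \<alpha> + p) (dg \<Lambda> \<alpha> + q) = bseg x p q)"

definition bcons :: "('a, 'k) kgraph \<Rightarrow> 'a \<Rightarrow> ('a, 'k) bpath \<Rightarrow> ('a, 'k) bpath" where
  "bcons \<Lambda> \<alpha> x = (THE y. is_bcons \<Lambda> \<alpha> x y)"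

definition aperiodic_path :: "('a, 'k) kgraph \<Rightarrow> ('a, 'k) bpath \<Rightarrow> bool" where
  "aperiodic_path \<Lambda> x \<longleftrightarrow> x \<in> boundary \<Lambda> \<and>
     (\<forall>\<alpha>\<in>paths_from \<Lambda> (bvert x 0). \<forall>\<mu>\<in>paths_from \<Lambda> (bvert x 0).
        \<alpha> \<noteq> \<mu> \<longrightarrow> bcons \<Lambda> \<alpha> x \<noteq> bcons \<Lambda> \<mu> x)"

definition aperiodic_kgraph :: "('a, 'k) kgraph \<Rightarrow> bool" where
  "aperiodic_kgraph \<Lambda> \<longleftrightarrow> (\<forall>v\<in>vertices \<Lambda>. \<exists>x. aperiodic_path \<Lambda> x \<and> bvert x 0 = v)"

definition cofinal_kgraph :: "('a, 'k) kgraph \<Rightarrow> bool" where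
  "cofinal_kgraph \<Lambda> \<longleftrightarrow> (\<forall>v\<in>vertices \<Lambda>. \<forall>x\<in>boundary \<Lambda>.
     \<exists>n. enats n \<le> bdeg x \<and> paths_to \<Lambda> v \<inter> paths_from \<Lambda> (bvert x n) \<noteq> {})"


section \<open>Algebras that need not be unital\<close>

text \<open>
  Algebras are carried by the record \<^type>\<open>module\<close> of HOL-Algebra, whose field \<open>one\<close> is never used.
\<close>

locale r_algebra = abelian_group A
  for A :: "('r::comm_ring_1, 'b, 'm) module_scheme" (structure) +
  assumes mult_closed: "\<lbrakk>x \<in> carrier A; y \<in> carrier A\<rbrakk> \<Longrightarrow> x \<otimes> y \<in> carrier A"
    and mult_assoc: "\<lbrakk>x \<in> carrier A; y \<in> carrier A; z \<in> carrier A\<rbrakk> \<Longrightarrow>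
        (x \<otimes> y) \<otimes> z = x \<otimes> (y \<otimes> z)"
    and l_distrib: "\<lbrakk>x \<in> carrier A; y \<in> carrier A; z \<in> carrier A\<rbrakk> \<Longrightarrow>
        (x \<oplus> y) \<otimes> z = x \<otimes> z \<oplus> y \<otimes> z"
    and r_distrib: "\<lbrakk>x \<in> carrier A; y \<in> carrier A; z \<in> carrier A\<rbrakk> \<Longrightarrow>
        z \<otimes> (x \<oplus> y) = z \<otimes> x \<oplus> z \<otimes> y"
    and smult_closed: "x \<in> carrier A \<Longrightarrow> a \<odot> x \<in> carrier A"
    and smult_l_distrib: "x \<in> carrier A \<Longrightarrow> (a + b) \<odot> x = a \<odot> x \<oplus> b \<odot> x"
    and smult_r_distrib: "\<lbrakk>x \<in> carrier A; y \<in> carrier A\<rbrakk> \<Longrightarrow> a \<odot> (x \<oplus> y) = a \<odot> x \<oplus> a \<odot> y"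
    and smult_smult: "x \<in> carrier A \<Longrightarrow> (a * b) \<odot> x = a \<odot> (b \<odot> x)"
    and smult_1: "x \<in> carrier A \<Longrightarrow> 1 \<odot> x = x"
    and smult_mult_l: "\<lbrakk>x \<in> carrier A; y \<in> carrier A\<rbrakk> \<Longrightarrow> (a \<odot> x) \<otimes> y = a \<odot> (x \<otimes> y)"
    and smult_mult_r: "\<lbrakk>x \<in> carrier A; y \<in> carrier A\<rbrakk> \<Longrightarrow> x \<otimes> (a \<odot> y) = a \<odot> (x \<otimes> y)"

definition algebra_hom ::
  "('r, 'b, 'm) module_scheme \<Rightarrow> ('r, 'c, 'n) module_scheme \<Rightarrow> ('b \<Rightarrow> 'c) \<Rightarrow> bool" where
  "algebra_hom A B h \<longleftrightarrow> h \<in> carrier A \<rightarrow> carrier B \<and>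
     (\<forall>x\<in>carrier A. \<forall>y\<in>carrier A. h (x \<oplus>\<^bsub>A\<^esub> y) = h x \<oplus>\<^bsub>B\<^esub> h y) \<and>
     (\<forall>x\<in>carrier A. \<forall>y\<in>carrier A. h (x \<otimes>\<^bsub>A\<^esub> y) = h x \<otimes>\<^bsub>B\<^esub> h y) \<and>
     (\<forall>a. \<forall>x\<in>carrier A. h (a \<odot>\<^bsub>A\<^esub> x) = a \<odot>\<^bsub>B\<^esub> h x)"

definition algebra_ideal :: "'b set \<Rightarrow> ('r, 'b, 'm) module_scheme \<Rightarrow> bool" where
  "algebra_ideal I A \<longleftrightarrow> additive_subgroup I A \<and>
     (\<forall>x\<in>I. \<forall>y\<in>carrier A. x \<otimes>\<^bsub>A\<^esub> y \<in> I \<and> y \<otimes>\<^bsub>A\<^esub> x \<in> I) \<and>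
     (\<forall>a. \<forall>x\<in>I. a \<odot>\<^bsub>A\<^esub> x \<in> I)"

definition quotient_algebra ::
  "('r, 'b, 'm) module_scheme \<Rightarrow> 'b set \<Rightarrow> ('r, 'b set) module" where
  "quotient_algebra A I = \<lparr>carrier = a_rcosets\<^bsub>A\<^esub> I, mult = rcoset_mult A I, one = undefined,
     zero = I, add = set_add A, smult = (\<lambda>a X. \<Union>x\<in>X. I +>\<^bsub>A\<^esub> (a \<odot>\<^bsub>A\<^esub> x))\<rparr>"

text \<open>The product, in the given order, of a nonempty list of factors.\<close>

definition list_prod :: "('b \<Rightarrow> 'b \<Rightarrow> 'b) \<Rightarrow> 'b list \<Rightarrow> 'b" where
  "list_prod f xs = foldr f (butlast xs) (last xs)"


section \<open>Kumjian-Pask families\<close>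

datatype 'a gen = Path 'a | Ghost 'a

definition star :: "('a, 'k) kgraph \<Rightarrow> 'a \<Rightarrow> 'a gen" where
  "star \<Lambda> \<alpha> = (if dg \<Lambda> \<alpha> = 0 then Path \<alpha> else Ghost \<alpha>)"

definition generators :: "('a, 'k) kgraph \<Rightarrow> 'a gen set" where
  "generators \<Lambda> = Path ` Mor \<Lambda> \<union> Ghost ` (Mor \<Lambda> - vertices \<Lambda>)"

text \<open>
  The factors in the last relation commute by the other relations, so it is immaterial that the
  relation is imposed for every order of the factors.  A set in \<open>FE \<Lambda> v\<close> is never empty.
\<close>

definition kp_family ::
  "('a, 'k) kgraph \<Rightarrow> ('r::comm_ring_1, 'b, 'm) module_scheme \<Rightarrow> ('a gen \<Rightarrow> 'b) \<Rightarrow> bool" where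
  "kp_family \<Lambda> A S \<longleftrightarrow>
     S \<in> generators \<Lambda> \<rightarrow> carrier A \<and>
     (\<forall>v\<in>vertices \<Lambda>. S (Path v) \<otimes>\<^bsub>A\<^esub> S (Path v) = S (Path v)) \<and>
     (\<forall>v\<in>vertices \<Lambda>. \<forall>w\<in>vertices \<Lambda>. v \<noteq> w \<longrightarrow> S (Path v) \<otimes>\<^bsub>A\<^esub> S (Path w) = \<zero>\<^bsub>A\<^esub>) \<and>
     (\<forall>\<alpha>\<in>Mor \<Lambda>. \<forall>\<mu>\<in>Mor \<Lambda>. sr \<Lambda> \<alpha> = rg \<Lambda> \<mu> \<longrightarrow>
        S (Path \<alpha>) \<otimes>\<^bsub>A\<^esub> S (Path \<mu>) = S (Path (cmp \<Lambda> \<alpha> \<mu>)) \<and>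
        S (star \<Lambda> \<mu>) \<otimes>\<^bsub>A\<^esub> S (star \<Lambda> \<alpha>) = S (star \<Lambda> (cmp \<Lambda> \<alpha> \<mu>))) \<and>
     (\<forall>\<alpha>\<in>Mor \<Lambda>. \<forall>\<mu>\<in>Mor \<Lambda>. S (star \<Lambda> \<alpha>) \<otimes>\<^bsub>A\<^esub> S (Path \<mu>) =
        finsum A (\<lambda>(\<rho>, \<tau>). S (Path \<rho>) \<otimes>\<^bsub>A\<^esub> S (star \<Lambda> \<tau>)) (Lmin \<Lambda> \<alpha> \<mu>)) \<and>
     (\<forall>v\<in>vertices \<Lambda>. \<forall>E\<in>FE \<Lambda> v. \<forall>xs. distinct xs \<and> set xs = E \<longrightarrow>
        list_prod (mult A)
          (map (\<lambda>\<alpha>. S (Path v) \<ominus>\<^bsub>A\<^esub> S (Path \<alpha>) \<otimes>\<^bsub>A\<^esub> S (star \<Lambda> \<alpha>)) xs) = \<zero>\<^bsub>A\<^esub>)"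


section \<open>The Kumjian-Pask algebra\<close>

text \<open>
  \<open>'g word \<Rightarrow>\<^sub>0 'r\<close> is the unital free algebra on \<open>'g\<close>.  The free algebra on a set \<open>X\<close> of
  generators is the non-unital subalgebra spanned by the nonempty words in the letters \<open>X\<close>.
\<close>

datatype 'g word = Word (letters: "'g list")

instantiation word :: (type) monoid_add
begin

definition zero_word :: "'g word" where
  "zero_word = Word []"

definition plus_word :: "'g word \<Rightarrow> 'g word \<Rightarrow> 'g word" where
  "plus_word u v = Word (letters u @ letters v)"

instance
  by standard (simp_all add: zero_word_def plus_word_def)

end

definition free_algebra :: "'g set \<Rightarrow> ('r::comm_ring_1, 'g word \<Rightarrow>\<^sub>0 'r) module" where
  "free_algebra X =
     \<lparr>carrier = {f. \<forall>w\<in>Poly_Mapping.keys f. letters w \<noteq> [] \<and> set (letters w) \<subseteq> X},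
      mult = (*), one = undefined, zero = 0, add = (+),
      smult = (\<lambda>a. Poly_Mapping.map ((*) a))\<rparr>"

definition gen :: "'g \<Rightarrow> 'g word \<Rightarrow>\<^sub>0 'r::comm_ring_1" where
  "gen g = Poly_Mapping.single (Word [g]) 1"

inductive_set kp_relators :: "('a, 'k) kgraph \<Rightarrow> ('a gen word \<Rightarrow>\<^sub>0 'r::comm_ring_1) set"
  for \<Lambda> :: "('a, 'k) kgraph"
  where
    KP1_idem: "v \<in> vertices \<Lambda> \<Longrightarrow> gen (Path v) * gen (Path v) - gen (Path v) \<in> kp_relators \<Lambda>"
  | KP1_orth: "\<lbrakk>v \<in> vertices \<Lambda>; w \<in> vertices \<Lambda>; v \<noteq> w\<rbrakk> \<Longrightarrow>
      gen (Path v) * gen (Path w) \<in> kp_relators \<Lambda>"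
  | KP2: "\<lbrakk>\<alpha> \<in> Mor \<Lambda>; \<mu> \<in> Mor \<Lambda>; sr \<Lambda> \<alpha> = rg \<Lambda> \<mu>\<rbrakk> \<Longrightarrow>
      gen (Path \<alpha>) * gen (Path \<mu>) - gen (Path (cmp \<Lambda> \<alpha> \<mu>)) \<in> kp_relators \<Lambda>"
  | KP2_star: "\<lbrakk>\<alpha> \<in> Mor \<Lambda>; \<mu> \<in> Mor \<Lambda>; sr \<Lambda> \<alpha> = rg \<Lambda> \<mu>\<rbrakk> \<Longrightarrow>
      gen (star \<Lambda> \<mu>) * gen (star \<Lambda> \<alpha>) - gen (star \<Lambda> (cmp \<Lambda> \<alpha> \<mu>)) \<in> kp_relators \<Lambda>"
  | KP3: "\<lbrakk>\<alpha> \<in> Mor \<Lambda>; \<mu> \<in> Mor \<Lambda>\<rbrakk> \<Longrightarrow>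
      gen (star \<Lambda> \<alpha>) * gen (Path \<mu>) -
        (\<Sum>(\<rho>, \<tau>)\<in>Lmin \<Lambda> \<alpha> \<mu>. gen (Path \<rho>) * gen (star \<Lambda> \<tau>)) \<in> kp_relators \<Lambda>"
  | KP4: "\<lbrakk>v \<in> vertices \<Lambda>; E \<in> FE \<Lambda> v; distinct xs; set xs = E\<rbrakk> \<Longrightarrow>
      list_prod (*) (map (\<lambda>\<alpha>. gen (Path v) - gen (Path \<alpha>) * gen (star \<Lambda> \<alpha>)) xs)
        \<in> kp_relators \<Lambda>"

definition kp_free :: "('a, 'k) kgraph \<Rightarrow> ('r::comm_ring_1, 'a gen word \<Rightarrow>\<^sub>0 'r) module" where
  "kp_free \<Lambda> = free_algebra (generators \<Lambda>)"

definition kp_ideal :: "('a, 'k) kgraph \<Rightarrow> ('a gen word \<Rightarrow>\<^sub>0 'r::comm_ring_1) set" where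
  "kp_ideal \<Lambda> = \<Inter>{I. algebra_ideal I (kp_free \<Lambda>) \<and> kp_relators \<Lambda> \<subseteq> I}"

text \<open>
  The Kumjian-Pask algebra and its generating family \<open>s\<close>; see \<open>kp_universal\<close> below for the
  universal property.
\<close>

definition kp_algebra ::
  "('a, 'k) kgraph \<Rightarrow> ('r::comm_ring_1, ('a gen word \<Rightarrow>\<^sub>0 'r) set) module" where
  "kp_algebra \<Lambda> = quotient_algebra (kp_free \<Lambda>) (kp_ideal \<Lambda>)"

definition kp_gen :: "('a, 'k) kgraph \<Rightarrow> 'a gen \<Rightarrow> ('a gen word \<Rightarrow>\<^sub>0 'r::comm_ring_1) set" where
  "kp_gen \<Lambda> g = kp_ideal \<Lambda> +>\<^bsub>kp_free \<Lambda>\<^esub> gen g"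

definition basic_ideal ::
  "('a, 'k) kgraph \<Rightarrow> ('a gen word \<Rightarrow>\<^sub>0 'r::comm_ring_1) set set \<Rightarrow> bool" where
  "basic_ideal \<Lambda> I \<longleftrightarrow> algebra_ideal I (kp_algebra \<Lambda>) \<and>
     (\<forall>r. \<forall>v\<in>vertices \<Lambda>. r \<noteq> 0 \<and> r \<odot>\<^bsub>kp_algebra \<Lambda>\<^esub> kp_gen \<Lambda> (Path v) \<in> I \<longrightarrow>
        kp_gen \<Lambda> (Path v) \<in> I)"

text \<open>\<open>basically_simple R \<Lambda>\<close>: the algebra over the ring \<open>'r\<close> is basically simple.\<close>

definition basically_simple :: "'r::comm_ring_1 itself \<Rightarrow> ('a, 'k) kgraph \<Rightarrow> bool" where
  "basically_simple R \<Lambda> \<longleftrightarrow> (\<forall>I :: ('a gen word \<Rightarrow>\<^sub>0 'r) set set. basic_ideal \<Lambda> I \<longrightarrow>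
     I = {\<zero>\<^bsub>kp_algebra \<Lambda>\<^esub>} \<or> I = carrier (kp_algebra \<Lambda>))"

end

theory Submission
  imports Defs
begin

text \<open>
  A boundary path is encoded by the filter of its initial segments.  Aperiodicity then amounts to:
  distinct paths \<open>\<xi>\<close>, \<open>\<mu>\<close> with the same source have extensions \<open>\<xi>\<nu>\<close>, \<open>\<mu>\<nu>\<close> without common
  extension.

  If this holds, let \<open>a\<close> be a nonzero element of a basic ideal.  By (KP4) some product \<open>a s\<^sub>\<tau>\<close> is a
  nonzero linear combination of paths \<open>s\<^sub>\<xi>\<close>; extending the paths by a suitable \<open>\<nu>\<close> makes them
  orthogonal and isolates one coefficient, so the ideal contains a vertex.  The vertices outside of
  the ideal, if any, would carry a boundary path avoiding it, against cofinality.

  Conversely, the algebra acts on the functions on any invariant set of boundary paths, and the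
  kernel is a basic ideal.  If \<open>v\<close> does not reach some boundary path, the boundary paths that \<open>v\<close>
  does not reach give a proper nonzero kernel.  If \<open>\<xi> \<noteq> \<mu>\<close> cannot be separated, then
  \<open>s\<^sub>\<xi> - s\<^sub>\<mu>\<close> acts as zero on all boundary paths, but not on the version of this action that keeps
  track of degrees.
\<close>

section \<open>Paths of a higher-rank graph\<close>

text \<open>Finite exhaustive sets have to be moved along paths, and the device for this is
  \<open>ext\<close>: the tails by which \<beta> reaches a finite set that no extension of \<beta>
  avoids form a finite exhaustive set, unless \<beta> already passes through the given one.
  Tightness of \<open>prepend\<close>, the generic filters and the use of (KP4) rest on it. The
  combination of paths is nonzero formally, in the free algebra, so no linear independence in the
  quotient is needed: what is shown is that an element all of whose path combinations have zero
  coefficients lies in the ideal of relations. Coefficients need not be invertible and R may have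
  zero divisors, which is why basic ideals are the right notion. The kernels of the actions are
  basic because the functions take values in R itself: c times a vertex sends the constant 1 to a
  function with the value c. The integer vectors are a trace of the Z^k-grading. Distinct paths that
  cannot be separated lie in a common filter, so their degrees differ and the vectors tell them
  apart.\<close>

context k_graph
begin

abbreviation M :: "'a set" where "M \<equiv> Mor \<Lambda>"
abbreviation rng :: "'a \<Rightarrow> 'a" where "rng \<equiv> rg \<Lambda>"
abbreviation src :: "'a \<Rightarrow> 'a" where "src \<equiv> sr \<Lambda>"
abbreviation deg :: "'a \<Rightarrow> 'k \<Rightarrow> nat" where "deg \<equiv> dg \<Lambda>"
abbreviation comp_path :: "'a \<Rightarrow> 'a \<Rightarrow> 'a" (infixl "\<cdot>" 70) where "\<alpha> \<cdot> \<beta> \<equiv> cmp \<Lambda> \<alpha> \<beta>"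

lemmas kg_simps [simp] = rg_closed sr_closed sr_rg rg_sr cmp_closed rg_cmp sr_cmp cmp_rg cmp_sr dg_rg
  dg_cmp

lemma rg_rg [simp]: "\<alpha> \<in> M \<Longrightarrow> rng (rng \<alpha>) = rng \<alpha>"
  by (metis rg_closed rg_sr sr_rg)

lemma sr_sr [simp]: "\<alpha> \<in> M \<Longrightarrow> src (src \<alpha>) = src \<alpha>"
  by (metis sr_closed rg_sr sr_rg)

lemma dg_sr [simp]: "\<alpha> \<in> M \<Longrightarrow> deg (src \<alpha>) = 0"
  by (metis dg_rg rg_sr sr_closed)

text \<open>Only the degrees of the first factors are compared; those of the second factors then
  agree by cancellation in N^k.\<close>

lemma factor_unique:
  assumes "\<alpha> \<in> M" "\<beta> \<in> M" "\<alpha>' \<in> M" "\<beta>' \<in> M" "src \<alpha> = rng \<beta>" "src \<alpha>' = rng \<beta>'"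
    and "\<alpha> \<cdot> \<beta> = \<alpha>' \<cdot> \<beta>'" "deg \<alpha> = deg \<alpha>'"
  shows "\<alpha> = \<alpha>'" "\<beta> = \<beta>'"
proof -
  have "deg \<alpha> + deg \<beta> = deg \<alpha>' + deg \<beta>'"
    using assms by (metis dg_cmp)
  with assms(8) have *: "deg \<beta>' = deg \<beta>"
    by simp
  define P where "P = (\<lambda>(\<mu>, \<nu>). \<mu> \<in> M \<and> \<nu> \<in> M \<and> src \<mu> = rng \<nu> \<and>
      \<alpha> \<cdot> \<beta> = \<mu> \<cdot> \<nu> \<and> deg \<mu> = deg \<alpha> \<and> deg \<nu> = deg \<beta>)"
  have "\<exists>!p. P p"
    unfolding P_def using assms(1-6) by (intro factorisation) auto
  moreover have "P (\<alpha>, \<beta>)" "P (\<alpha>', \<beta>')"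
    using assms * by (simp_all add: P_def)
  ultimately have "(\<alpha>, \<beta>) = (\<alpha>', \<beta>')"
    by blast
  then show "\<alpha> = \<alpha>'" "\<beta> = \<beta>'"
    by auto
qed

lemma factor_exists:
  assumes "\<alpha> \<in> M" "m \<le> deg \<alpha>"
  obtains \<mu> \<nu> where "\<mu> \<in> M" "\<nu> \<in> M" "src \<mu> = rng \<nu>" "\<alpha> = \<mu> \<cdot> \<nu>" "deg \<mu> = m"
proof -
  have "deg \<alpha> = m + (deg \<alpha> - m)"
    using assms(2) by (auto simp: fun_eq_iff le_fun_def)
  from ex1_implies_ex[OF factorisation[OF assms(1) this]] show ?thesis
    using that by auto
qed

lemma cancel_left:
  "\<lbrakk>\<alpha> \<in> M; \<beta> \<in> M; \<beta>' \<in> M; src \<alpha> = rng \<beta>; src \<alpha> = rng \<beta>'\<rbrakk> \<Longrightarrow> \<alpha> \<cdot> \<beta> = \<alpha> \<cdot> \<beta>' \<longleftrightarrow> \<beta> = \<beta>'"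
  using factor_unique(2) by blast

lemma cancel_right:
  assumes "\<alpha> \<in> M" "\<alpha>' \<in> M" "\<beta> \<in> M" "src \<alpha> = rng \<beta>" "src \<alpha>' = rng \<beta>"
  shows "\<alpha> \<cdot> \<beta> = \<alpha>' \<cdot> \<beta> \<longleftrightarrow> \<alpha> = \<alpha>'"
proof
  assume eq: "\<alpha> \<cdot> \<beta> = \<alpha>' \<cdot> \<beta>"
  then have "deg \<alpha> + deg \<beta> = deg \<alpha>' + deg \<beta>"
    using assms by (metis dg_cmp)
  then have "deg \<alpha> = deg \<alpha>'"
    by simp
  then show "\<alpha> = \<alpha>'"
    using factor_unique(1) eq assms by blast
qed simp

text \<open>The factorisations \<open>rng v \<cdot> v\<close> and \<open>v \<cdot> src v\<close> of
  \<open>v\<close> have first factors of degree 0, so these coincide. This identifies the morphisms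
  of degree 0 with the objects.\<close>

lemma rng_vertex: "v \<in> vertices \<Lambda> \<Longrightarrow> rng v = v"
  using factor_unique(1)[of "rng v" v v "src v"] by (auto simp: vertices_def)

lemma src_vertex: "v \<in> vertices \<Lambda> \<Longrightarrow> src v = v"
  using rng_vertex sr_rg by (fastforce simp: vertices_def)

lemma rng_in_vertices [simp]: "\<alpha> \<in> M \<Longrightarrow> rng \<alpha> \<in> vertices \<Lambda>"
  by (simp add: vertices_def)

lemma src_in_vertices [simp]: "\<alpha> \<in> M \<Longrightarrow> src \<alpha> \<in> vertices \<Lambda>"
  by (simp add: vertices_def)

lemma vertices_M: "v \<in> vertices \<Lambda> \<Longrightarrow> v \<in> M"
  by (simp add: vertices_def)

section \<open>Initial segments, common extensions and exhaustive sets\<close>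

definition prefix :: "'a \<Rightarrow> 'a \<Rightarrow> bool" (infix "\<preceq>" 50) where
  "\<alpha> \<preceq> \<beta> \<longleftrightarrow> \<alpha> \<in> M \<and> (\<exists>\<gamma>\<in>M. src \<alpha> = rng \<gamma> \<and> \<beta> = \<alpha> \<cdot> \<gamma>)"

lemma prefixI: "\<lbrakk>\<alpha> \<in> M; \<gamma> \<in> M; src \<alpha> = rng \<gamma>\<rbrakk> \<Longrightarrow> \<alpha> \<preceq> \<alpha> \<cdot> \<gamma>"
  by (auto simp: prefix_def)

lemma prefixE:
  assumes "\<alpha> \<preceq> \<beta>"
  obtains \<gamma> where "\<alpha> \<in> M" "\<gamma> \<in> M" "src \<alpha> = rng \<gamma>" "\<beta> = \<alpha> \<cdot> \<gamma>"
  using assms by (auto simp: prefix_def)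

lemma prefix_M: "\<alpha> \<preceq> \<beta> \<Longrightarrow> \<alpha> \<in> M" "\<alpha> \<preceq> \<beta> \<Longrightarrow> \<beta> \<in> M"
  by (auto simp: prefix_def)

lemma prefix_refl [simp]: "\<alpha> \<in> M \<Longrightarrow> \<alpha> \<preceq> \<alpha>"
  using prefixI[of \<alpha> "src \<alpha>"] by simp

lemma prefix_trans [trans]: "\<alpha> \<preceq> \<beta> \<Longrightarrow> \<beta> \<preceq> \<gamma> \<Longrightarrow> \<alpha> \<preceq> \<gamma>"
  by (elim prefixE) (auto simp: cmp_assoc intro!: prefixI)

lemma prefix_rng: "\<alpha> \<preceq> \<beta> \<Longrightarrow> rng \<alpha> = rng \<beta>"
  by (auto simp: prefix_def)

lemma rng_prefix: "\<alpha> \<in> M \<Longrightarrow> rng \<alpha> \<preceq> \<alpha>"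
  using prefixI[of "rng \<alpha>" \<alpha>] by simp

lemma prefix_deg: "\<alpha> \<preceq> \<beta> \<Longrightarrow> deg \<alpha> \<le> deg \<beta>"
  by (auto simp: prefix_def le_fun_def)

lemma prefix_of_degree:
  assumes "\<alpha> \<in> M" "m \<le> deg \<alpha>"
  obtains \<mu> where "\<mu> \<preceq> \<alpha>" "deg \<mu> = m"
  using factor_exists[OF assms] prefixI by metis

text \<open>The segment of \<beta> of degree \<open>deg \<alpha>\<close> is also a segment of
  \<kappa>, so it is \<alpha> by unique factorisation.\<close>

lemma prefix_linear:
  assumes "\<alpha> \<preceq> \<kappa>" "\<beta> \<preceq> \<kappa>" "deg \<alpha> \<le> deg \<beta>"
  shows "\<alpha> \<preceq> \<beta>"
proof -
  obtain \<mu> \<nu> where \<mu>: "\<mu> \<in> M" "\<nu> \<in> M" "src \<mu> = rng \<nu>" "\<beta> = \<mu> \<cdot> \<nu>" "deg \<mu> = deg \<alpha>"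
    using factor_exists assms prefix_M by metis
  obtain \<gamma> \<delta> where "\<alpha> \<in> M" "\<gamma> \<in> M" "src \<alpha> = rng \<gamma>" "\<kappa> = \<alpha> \<cdot> \<gamma>"
    "\<delta> \<in> M" "src \<beta> = rng \<delta>" "\<kappa> = \<beta> \<cdot> \<delta>"
    using assms by (elim prefixE) auto
  with \<mu> have "\<alpha> = \<mu>"
    using factor_unique(1)[of \<alpha> \<gamma> \<mu> "\<nu> \<cdot> \<delta>"] by (simp add: cmp_assoc)
  then show ?thesis
    using \<mu> prefixI by simp
qed

lemma prefix_eq:
  assumes "\<alpha> \<preceq> \<kappa>" "\<beta> \<preceq> \<kappa>" "deg \<alpha> = deg \<beta>"
  shows "\<alpha> = \<beta>"
  using assms by (elim prefixE) (metis factor_unique(1))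

lemma prefix_cmp_iff:
  assumes "\<xi> \<in> M" "\<alpha> \<in> M" "\<beta> \<in> M" "src \<xi> = rng \<alpha>" "src \<xi> = rng \<beta>"
  shows "\<xi> \<cdot> \<alpha> \<preceq> \<xi> \<cdot> \<beta> \<longleftrightarrow> \<alpha> \<preceq> \<beta>"
proof
  assume "\<xi> \<cdot> \<alpha> \<preceq> \<xi> \<cdot> \<beta>"
  then obtain \<gamma> where "\<gamma> \<in> M" "src (\<xi> \<cdot> \<alpha>) = rng \<gamma>" "\<xi> \<cdot> \<beta> = \<xi> \<cdot> \<alpha> \<cdot> \<gamma>"
    by (elim prefixE)
  then show "\<alpha> \<preceq> \<beta>"
    using assms cancel_left[of \<xi> \<beta> "\<alpha> \<cdot> \<gamma>"] prefixI[of \<alpha> \<gamma>] by (simp add: cmp_assoc)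
next
  assume "\<alpha> \<preceq> \<beta>"
  then obtain \<gamma> where \<gamma>: "\<gamma> \<in> M" "src \<alpha> = rng \<gamma>" "\<beta> = \<alpha> \<cdot> \<gamma>"
    by (elim prefixE)
  then show "\<xi> \<cdot> \<alpha> \<preceq> \<xi> \<cdot> \<beta>"
    using assms prefixI[of "\<xi> \<cdot> \<alpha>" \<gamma>] by (simp add: cmp_assoc)
qed

lemma prefix_cmpE:
  assumes "\<xi> \<cdot> \<alpha> \<preceq> \<kappa>" "\<xi> \<in> M" "\<alpha> \<in> M" "src \<xi> = rng \<alpha>"
  obtains \<kappa>' where "\<kappa>' \<in> M" "src \<xi> = rng \<kappa>'" "\<kappa> = \<xi> \<cdot> \<kappa>'" "\<alpha> \<preceq> \<kappa>'"
proof -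
  obtain \<gamma> where "\<gamma> \<in> M" "src (\<xi> \<cdot> \<alpha>) = rng \<gamma>" "\<kappa> = \<xi> \<cdot> \<alpha> \<cdot> \<gamma>"
    using assms(1) by (elim prefixE)
  then show ?thesis
    using assms that[of "\<alpha> \<cdot> \<gamma>"] prefixI[of \<alpha> \<gamma>] by (simp add: cmp_assoc)
qed

definition compat :: "'a \<Rightarrow> 'a \<Rightarrow> bool" where
  "compat \<alpha> \<beta> \<longleftrightarrow> (\<exists>\<kappa>. \<alpha> \<preceq> \<kappa> \<and> \<beta> \<preceq> \<kappa>)"

lemma compat_sym: "compat \<alpha> \<beta> \<longleftrightarrow> compat \<beta> \<alpha>"
  by (auto simp: compat_def)

lemma compatI: "\<alpha> \<preceq> \<kappa> \<Longrightarrow> \<beta> \<preceq> \<kappa> \<Longrightarrow> compat \<alpha> \<beta>"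
  by (auto simp: compat_def)

lemma compat_prefix: "compat \<alpha> \<beta> \<Longrightarrow> \<alpha>' \<preceq> \<alpha> \<Longrightarrow> \<beta>' \<preceq> \<beta> \<Longrightarrow> compat \<alpha>' \<beta>'"
  by (meson compat_def prefix_trans)

lemma init_seg_eq_iff:
  assumes "\<alpha> \<in> M" "\<tau> \<in> M" "deg \<alpha> \<le> deg \<tau>"
  shows "init_seg \<Lambda> \<tau> (deg \<alpha>) = \<alpha> \<longleftrightarrow> \<alpha> \<preceq> \<tau>"
proof -
  obtain \<mu> where \<mu>: "\<mu> \<preceq> \<tau>" "deg \<mu> = deg \<alpha>"
    using prefix_of_degree assms by metis
  have "init_seg \<Lambda> \<tau> (deg \<alpha>) = (THE \<mu>. \<mu> \<preceq> \<tau> \<and> deg \<mu> = deg \<alpha>)"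
    unfolding init_seg_def prefix_def by (rule arg_cong[where f = The]) auto
  also have "\<dots> = \<mu>"
    using \<mu> prefix_eq by (intro the_equality) auto
  finally show ?thesis
    using \<mu> prefix_eq by auto
qed

lemma MCE_iff:
  assumes "\<alpha> \<in> M" "\<mu> \<in> M"
  shows "\<tau> \<in> MCE \<Lambda> \<alpha> \<mu> \<longleftrightarrow> deg \<tau> = sup (deg \<alpha>) (deg \<mu>) \<and> \<alpha> \<preceq> \<tau> \<and> \<mu> \<preceq> \<tau>"
  using assms init_seg_eq_iff by (auto simp: MCE_def dest: prefix_M(2))

lemma Lmin_iff:
  assumes "\<alpha> \<in> M" "\<mu> \<in> M"
  shows "(\<rho>, \<tau>) \<in> Lmin \<Lambda> \<alpha> \<mu> \<longleftrightarrow> \<rho> \<in> M \<and> \<tau> \<in> M \<and> src \<alpha> = rng \<rho> \<and> src \<mu> = rng \<tau> \<and>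
    \<alpha> \<cdot> \<rho> = \<mu> \<cdot> \<tau> \<and> deg (\<alpha> \<cdot> \<rho>) = sup (deg \<alpha>) (deg \<mu>)"
  using assms by (auto simp: Lmin_def MCE_iff prefix_def)

lemma Lmin_swap: "\<alpha> \<in> M \<Longrightarrow> \<mu> \<in> M \<Longrightarrow> (\<rho>, \<tau>) \<in> Lmin \<Lambda> \<alpha> \<mu> \<longleftrightarrow> (\<tau>, \<rho>) \<in> Lmin \<Lambda> \<mu> \<alpha>"
  by (auto simp: Lmin_iff sup_commute)

text \<open>Cutting \<kappa> at the join of the two degrees leaves a path that still extends both,
  by \<open>prefix_linear\<close>. Every common extension thus contains a minimal one, and
  \<open>compat\<close> can replace \<open>Lmin\<close> in statements about exhaustive sets.\<close>

lemma Lmin_below: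
  assumes "\<alpha> \<preceq> \<kappa>" "\<mu> \<preceq> \<kappa>"
  obtains \<rho> \<tau> where "(\<rho>, \<tau>) \<in> Lmin \<Lambda> \<alpha> \<mu>" "\<alpha> \<cdot> \<rho> \<preceq> \<kappa>"
proof -
  obtain \<sigma> where \<sigma>: "\<sigma> \<preceq> \<kappa>" "deg \<sigma> = sup (deg \<alpha>) (deg \<mu>)"
    using prefix_of_degree[of \<kappa> "sup (deg \<alpha>) (deg \<mu>)"] assms prefix_M prefix_deg le_sup_iff by metis
  then have "\<alpha> \<preceq> \<sigma>" "\<mu> \<preceq> \<sigma>"
    using prefix_linear[OF assms(1) \<sigma>(1)] prefix_linear[OF assms(2) \<sigma>(1)] by simp_all
  then obtain \<rho> \<tau> where "\<rho> \<in> M" "src \<alpha> = rng \<rho>" "\<sigma> = \<alpha> \<cdot> \<rho>" "\<tau> \<in> M" "src \<mu> = rng \<tau>" "\<sigma> = \<mu> \<cdot> \<tau>"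
    by (elim prefixE)
  then show ?thesis
    using that[of \<rho> \<tau>] \<sigma> assms prefix_M by (simp add: Lmin_iff)
qed

lemma Lmin_nonempty_iff:
  assumes "\<alpha> \<in> M" "\<mu> \<in> M"
  shows "Lmin \<Lambda> \<alpha> \<mu> \<noteq> {} \<longleftrightarrow> compat \<alpha> \<mu>"
proof
  assume "Lmin \<Lambda> \<alpha> \<mu> \<noteq> {}"
  then obtain \<rho> \<tau> where "(\<rho>, \<tau>) \<in> Lmin \<Lambda> \<alpha> \<mu>"
    by auto
  then show "compat \<alpha> \<mu>"
    using assms compatI[of \<alpha> "\<alpha> \<cdot> \<rho>" \<mu>] prefixI[of \<alpha> \<rho>] prefixI[of \<mu> \<tau>] by (simp add: Lmin_iff)
next
  assume "compat \<alpha> \<mu>"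
  then show "Lmin \<Lambda> \<alpha> \<mu> \<noteq> {}"
    by (metis compat_def Lmin_below empty_iff)
qed

text \<open>The join of the degrees is the degree of the longer path, so the second tail has degree
  0 and is a vertex.\<close>

lemma Lmin_prefix:
  assumes "\<alpha> \<in> M" "\<gamma> \<in> M" "src \<alpha> = rng \<gamma>"
  shows "Lmin \<Lambda> \<alpha> (\<alpha> \<cdot> \<gamma>) = {(\<gamma>, src \<gamma>)}"
proof -
  have sup: "sup (deg \<alpha>) (deg (\<alpha> \<cdot> \<gamma>)) = deg (\<alpha> \<cdot> \<gamma>)"
    using assms by (auto simp: fun_eq_iff sup_nat_def)
  have 1: "\<tau> = src \<gamma>" "\<rho> = \<gamma>"
    if "(\<rho>, \<tau>) \<in> Lmin \<Lambda> \<alpha> (\<alpha> \<cdot> \<gamma>)" for \<rho> \<tau>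
  proof -
    from that have L: "\<rho> \<in> M" "\<tau> \<in> M" "src \<alpha> = rng \<rho>" "src \<gamma> = rng \<tau>"
      "\<alpha> \<cdot> \<rho> = \<alpha> \<cdot> \<gamma> \<cdot> \<tau>" "deg (\<alpha> \<cdot> \<rho>) = deg (\<alpha> \<cdot> \<gamma>)"
      using assms sup by (auto simp: Lmin_iff)
    then have "deg (\<alpha> \<cdot> \<gamma>) + deg \<tau> = deg (\<alpha> \<cdot> \<gamma>)"
      using assms by simp
    then have "deg \<tau> = 0"
      by simp
    then show "\<tau> = src \<gamma>"
      using L rng_vertex[of \<tau>] by (simp add: vertices_def)
    then show "\<rho> = \<gamma>"
      using L assms cancel_left[of \<alpha> \<rho> \<gamma>] cmp_sr[of "\<alpha> \<cdot> \<gamma>"] by simp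
  qed
  have 2: "(\<gamma>, src \<gamma>) \<in> Lmin \<Lambda> \<alpha> (\<alpha> \<cdot> \<gamma>)"
    using assms sup cmp_sr[of "\<alpha> \<cdot> \<gamma>"] by (simp add: Lmin_iff)
  show ?thesis
  proof (rule equalityI)
    show "Lmin \<Lambda> \<alpha> (\<alpha> \<cdot> \<gamma>) \<subseteq> {(\<gamma>, src \<gamma>)}"
      by (rule subrelI) (simp add: 1)
  qed (simp add: 2)
qed

lemma FE_iff:
  assumes "v \<in> vertices \<Lambda>"
  shows "E \<in> FE \<Lambda> v \<longleftrightarrow> finite E \<and> E \<subseteq> M \<and> rng ` E \<subseteq> {v} \<and> v \<notin> E \<and>
    (\<forall>\<nu>\<in>M. rng \<nu> = v \<longrightarrow> (\<exists>e\<in>E. compat \<nu> e))"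
proof -
  have "E \<in> FE \<Lambda> v \<longleftrightarrow> finite E \<and> E \<subseteq> M \<and> rng ` E \<subseteq> {v} \<and> v \<notin> E \<and>
    (\<forall>\<nu>\<in>M. rng \<nu> = v \<longrightarrow> (\<exists>e\<in>E. Lmin \<Lambda> \<nu> e \<noteq> {}))"
    by (auto simp: FE_def exhaustive_def paths_to_def)
  also have "\<dots> \<longleftrightarrow> finite E \<and> E \<subseteq> M \<and> rng ` E \<subseteq> {v} \<and> v \<notin> E \<and>
    (\<forall>\<nu>\<in>M. rng \<nu> = v \<longrightarrow> (\<exists>e\<in>E. compat \<nu> e))"
    by (intro conj_cong refl ball_cong imp_cong bex_cong Lmin_nonempty_iff) auto
  finally show ?thesis .
qed

text \<open>The set usually written Ext(\<beta>; N): the tails leading from \<beta> to its minimal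
  common extensions with the members of \<open>N\<close>.\<close>

definition ext :: "'a \<Rightarrow> 'a set \<Rightarrow> 'a set" where
  "ext \<beta> N = (\<Union>n\<in>N. fst ` Lmin \<Lambda> \<beta> n)"

lemma ext_iff:
  assumes "\<beta> \<in> M" "N \<subseteq> M"
  shows "\<rho> \<in> ext \<beta> N \<longleftrightarrow> (\<exists>n\<in>N. \<exists>\<tau>. (\<rho>, \<tau>) \<in> Lmin \<Lambda> \<beta> n)"
  by (force simp: ext_def)

lemma extD:
  assumes "\<rho> \<in> ext \<beta> N" "\<beta> \<in> M" "N \<subseteq> M"
  shows "\<rho> \<in> M" "rng \<rho> = src \<beta>" "\<exists>n\<in>N. n \<preceq> \<beta> \<cdot> \<rho>"
  using assms by (auto simp: ext_iff Lmin_iff subset_iff) (metis Lmin_iff prefixI)+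

end

locale fa_kgraph = k_graph \<Lambda> for \<Lambda> :: "('a, 'k::finite) kgraph" +
  assumes fa: "finitely_aligned \<Lambda>"
begin

lemma finite_Lmin: "\<alpha> \<in> M \<Longrightarrow> \<mu> \<in> M \<Longrightarrow> finite (Lmin \<Lambda> \<alpha> \<mu>)"
  using fa by (simp add: finitely_aligned_def)

text \<open>A common extension of \<beta>\<nu> and \<open>n\<close> contains a minimal common
  extension \<beta>\<rho> of \<beta> and \<open>n\<close>; removing \<beta> leaves a common
  extension of \<nu> and \<rho>. Finite alignment gives finiteness, and the last hypothesis excludes
  the trivial tail.\<close>

lemma ext_FE:
  assumes "\<beta> \<in> M" "N \<subseteq> M" "finite N"
    and ex: "\<And>\<nu>. \<nu> \<in> M \<Longrightarrow> src \<beta> = rng \<nu> \<Longrightarrow> \<exists>n\<in>N. compat (\<beta> \<cdot> \<nu>) n"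
    and not: "\<And>n. n \<in> N \<Longrightarrow> \<not> n \<preceq> \<beta>"
  shows "ext \<beta> N \<in> FE \<Lambda> (src \<beta>)"
proof -
  have "src \<beta> \<notin> ext \<beta> N"
    using extD(3)[of "src \<beta>" \<beta> N] assms(1,2) not by auto
  moreover have "\<exists>e\<in>ext \<beta> N. compat \<nu> e" if \<nu>: "\<nu> \<in> M" "rng \<nu> = src \<beta>" for \<nu>
  proof -
    obtain n where "n \<in> N" "compat (\<beta> \<cdot> \<nu>) n"
      using \<nu> ex by metis
    then obtain \<kappa> where \<kappa>: "\<beta> \<cdot> \<nu> \<preceq> \<kappa>" "n \<preceq> \<kappa>"
      by (auto simp: compat_def)
    then obtain \<kappa>' where \<kappa>': "\<kappa>' \<in> M" "src \<beta> = rng \<kappa>'" "\<kappa> = \<beta> \<cdot> \<kappa>'" "\<nu> \<preceq> \<kappa>'"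
      using \<nu> assms(1) prefix_cmpE by metis
    obtain \<rho> \<tau> where \<rho>: "(\<rho>, \<tau>) \<in> Lmin \<Lambda> \<beta> n" "\<beta> \<cdot> \<rho> \<preceq> \<kappa>"
      using Lmin_below \<kappa>(2) \<kappa>' assms(1) prefixI by metis
    then have "\<rho> \<in> ext \<beta> N"
      using \<open>n \<in> N\<close> assms ext_iff by auto
    moreover have "\<rho> \<preceq> \<kappa>'"
      using \<rho>(2) \<kappa>' prefix_cmp_iff assms extD[OF \<open>\<rho> \<in> ext \<beta> N\<close>] by metis
    ultimately show ?thesis
      using \<kappa>'(4) compatI by blast
  qed
  moreover have "finite (ext \<beta> N)"
    using assms finite_Lmin by (auto simp: ext_def)
  moreover have "ext \<beta> N \<subseteq> M" "rng ` ext \<beta> N \<subseteq> {src \<beta>}"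
    using extD assms(1,2) by auto
  ultimately show ?thesis
    using assms(1) by (simp add: FE_iff)
qed

lemma ext_FE':
  assumes "\<beta> \<in> M" "E \<in> FE \<Lambda> (rng \<beta>)" "\<And>e. e \<in> E \<Longrightarrow> \<not> e \<preceq> \<beta>"
  shows "ext \<beta> E \<in> FE \<Lambda> (src \<beta>)"
  using assms by (intro ext_FE) (auto simp: FE_iff)

end

section \<open>Tight filters of paths\<close>

context k_graph
begin

text \<open>A boundary path is determined by the set of its initial segments, and the sets arising in
  this way are the tight filters.\<close>

definition tight :: "'a set \<Rightarrow> bool" where
  "tight X \<longleftrightarrow> X \<noteq> {} \<and> (\<forall>\<alpha>\<in>X. \<forall>\<beta>. \<beta> \<preceq> \<alpha> \<longrightarrow> \<beta> \<in> X) \<and>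
     (\<forall>\<alpha>\<in>X. \<forall>\<beta>\<in>X. \<exists>\<kappa>\<in>X. \<alpha> \<preceq> \<kappa> \<and> \<beta> \<preceq> \<kappa>) \<and>
     (\<forall>\<alpha>\<in>X. \<forall>E\<in>FE \<Lambda> (src \<alpha>). \<exists>e\<in>E. \<alpha> \<cdot> e \<in> X)"

lemma tightI:
  assumes "X \<noteq> {}" "\<And>\<alpha> \<beta>. \<alpha> \<in> X \<Longrightarrow> \<beta> \<preceq> \<alpha> \<Longrightarrow> \<beta> \<in> X"
    and "\<And>\<alpha> \<beta>. \<alpha> \<in> X \<Longrightarrow> \<beta> \<in> X \<Longrightarrow> \<exists>\<kappa>\<in>X. \<alpha> \<preceq> \<kappa> \<and> \<beta> \<preceq> \<kappa>"
    and "\<And>\<alpha> E. \<alpha> \<in> X \<Longrightarrow> E \<in> FE \<Lambda> (src \<alpha>) \<Longrightarrow> \<exists>e\<in>E. \<alpha> \<cdot> e \<in> X"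
  shows "tight X"
  using assms unfolding tight_def by blast

lemma tight_nonempty: "tight X \<Longrightarrow> X \<noteq> {}"
  by (simp add: tight_def)

lemma tight_prefix: "tight X \<Longrightarrow> \<alpha> \<in> X \<Longrightarrow> \<beta> \<preceq> \<alpha> \<Longrightarrow> \<beta> \<in> X"
  by (simp add: tight_def)

lemma tight_directed:
  assumes "tight X" "\<alpha> \<in> X" "\<beta> \<in> X"
  obtains \<kappa> where "\<kappa> \<in> X" "\<alpha> \<preceq> \<kappa>" "\<beta> \<preceq> \<kappa>"
  using assms unfolding tight_def by meson

lemma tight_FE: "tight X \<Longrightarrow> \<alpha> \<in> X \<Longrightarrow> E \<in> FE \<Lambda> (src \<alpha>) \<Longrightarrow> \<exists>e\<in>E. \<alpha> \<cdot> e \<in> X"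
  by (simp add: tight_def)

lemma tight_M: "tight X \<Longrightarrow> \<alpha> \<in> X \<Longrightarrow> \<alpha> \<in> M"
  by (meson tight_directed prefix_M)

lemma tight_rng: "tight X \<Longrightarrow> \<alpha> \<in> X \<Longrightarrow> \<beta> \<in> X \<Longrightarrow> rng \<alpha> = rng \<beta>"
  by (metis tight_directed prefix_rng)

lemma tight_rng_in: "tight X \<Longrightarrow> \<alpha> \<in> X \<Longrightarrow> rng \<alpha> \<in> X"
  by (meson tight_prefix rng_prefix tight_M)

lemma tight_vertex: "tight X \<Longrightarrow> v \<in> vertices \<Lambda> \<Longrightarrow> v \<in> X \<Longrightarrow> \<alpha> \<in> X \<Longrightarrow> rng \<alpha> = v"
  by (metis tight_rng rng_vertex)

lemma tight_deg_eq: "tight X \<Longrightarrow> \<alpha> \<in> X \<Longrightarrow> \<beta> \<in> X \<Longrightarrow> deg \<alpha> = deg \<beta> \<Longrightarrow> \<alpha> = \<beta>"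
  by (meson tight_directed prefix_eq)

lemma tight_of_degree:
  assumes "tight X" "\<kappa> \<in> X" "m \<le> deg \<kappa>"
  obtains \<alpha> where "\<alpha> \<in> X" "deg \<alpha> = m"
  using assms prefix_of_degree tight_M tight_prefix by metis

section \<open>Removing and prepending a path\<close>

definition shift :: "'a \<Rightarrow> 'a set \<Rightarrow> 'a set" where
  "shift \<xi> X = {\<alpha> \<in> M. rng \<alpha> = src \<xi> \<and> \<xi> \<cdot> \<alpha> \<in> X}"

text \<open>The closure under initial segments matters: a segment of \<xi>\<alpha> whose degree is
  not above \<open>deg \<xi>\<close> is not of the form \<xi>\<beta>.\<close>

definition prepend :: "'a \<Rightarrow> 'a set \<Rightarrow> 'a set" where
  "prepend \<xi> X = {\<beta>. \<exists>\<alpha>\<in>X. \<beta> \<preceq> \<xi> \<cdot> \<alpha>}"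

lemma prependI: "\<lbrakk>\<xi> \<in> M; tight X; src \<xi> \<in> X; \<alpha> \<in> X\<rbrakk> \<Longrightarrow> \<xi> \<cdot> \<alpha> \<in> prepend \<xi> X"
  unfolding prepend_def using tight_M[of X \<alpha>] tight_vertex[of X "src \<xi>" \<alpha>]
  by (auto intro!: bexI[of _ \<alpha>])

lemma prepend_self: "\<lbrakk>\<xi> \<in> M; tight X; src \<xi> \<in> X\<rbrakk> \<Longrightarrow> \<xi> \<in> prepend \<xi> X"
  using prependI[of \<xi> X "src \<xi>"] by simp

lemma tight_shift:
  assumes "tight X" "\<xi> \<in> X"
  shows "tight (shift \<xi> X)"
proof (rule tightI)
  have \<xi>: "\<xi> \<in> M"
    using assms tight_M by blast
  show "shift \<xi> X \<noteq> {}"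
    using \<xi> assms by (auto simp: shift_def intro!: exI[of _ "src \<xi>"])
  show "\<beta> \<in> shift \<xi> X" if "\<alpha> \<in> shift \<xi> X" "\<beta> \<preceq> \<alpha>" for \<alpha> \<beta>
  proof -
    have "\<alpha> \<in> M" "rng \<alpha> = src \<xi>" "\<xi> \<cdot> \<alpha> \<in> X" "\<beta> \<in> M" "rng \<beta> = src \<xi>"
      using that prefix_M prefix_rng[of \<beta> \<alpha>] by (simp_all add: shift_def)
    moreover from this have "\<xi> \<cdot> \<beta> \<preceq> \<xi> \<cdot> \<alpha>"
      using that \<xi> prefix_cmp_iff by simp
    ultimately show ?thesis
      using tight_prefix[OF assms(1)] by (simp add: shift_def)
  qed
  show "\<exists>\<kappa>\<in>shift \<xi> X. \<alpha> \<preceq> \<kappa> \<and> \<beta> \<preceq> \<kappa>" if "\<alpha> \<in> shift \<xi> X" "\<beta> \<in> shift \<xi> X" for \<alpha> \<beta>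
  proof -
    have \<alpha>\<beta>: "\<alpha> \<in> M" "\<beta> \<in> M" "rng \<alpha> = src \<xi>" "rng \<beta> = src \<xi>" "\<xi> \<cdot> \<alpha> \<in> X" "\<xi> \<cdot> \<beta> \<in> X"
      using that by (auto simp: shift_def)
    then obtain \<kappa> where \<kappa>: "\<kappa> \<in> X" "\<xi> \<cdot> \<alpha> \<preceq> \<kappa>" "\<xi> \<cdot> \<beta> \<preceq> \<kappa>"
      using assms(1) tight_directed by metis
    then obtain \<kappa>' where "\<kappa>' \<in> M" "src \<xi> = rng \<kappa>'" "\<kappa> = \<xi> \<cdot> \<kappa>'" "\<alpha> \<preceq> \<kappa>'"
      using prefix_cmpE \<xi> \<alpha>\<beta> by metis
    then show ?thesis
      using \<kappa> \<xi> \<alpha>\<beta> prefix_cmp_iff[of \<xi> \<beta> \<kappa>'] by (auto simp: shift_def)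
  qed
  show "\<exists>e\<in>E. \<alpha> \<cdot> e \<in> shift \<xi> X" if h: "\<alpha> \<in> shift \<xi> X" "E \<in> FE \<Lambda> (src \<alpha>)" for \<alpha> E
  proof -
    have \<alpha>: "\<alpha> \<in> M" "rng \<alpha> = src \<xi>" "\<xi> \<cdot> \<alpha> \<in> X"
      using h by (auto simp: shift_def)
    then obtain e where "e \<in> E" "\<xi> \<cdot> \<alpha> \<cdot> e \<in> X"
      using h(2) \<xi> tight_FE[OF assms(1) \<alpha>(3), of E] by auto
    moreover have "e \<in> M" "rng e = src \<alpha>"
      using h(2) \<open>e \<in> E\<close> \<alpha> by (auto simp: FE_iff)
    ultimately show ?thesis
      using \<alpha> \<xi> by (intro bexI[of _ e]) (auto simp: shift_def cmp_assoc)
  qed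
qed

text \<open>The point is that \<xi> cancels in the order, by \<open>prefix_cmp_iff\<close>. With
  \<open>prepend_shift\<close> it makes the two operations inverse to each other, which is why the
  generators can act by partial bijections.\<close>

lemma shift_prepend:
  assumes "\<xi> \<in> M" "tight X" "src \<xi> \<in> X"
  shows "shift \<xi> (prepend \<xi> X) = X"
proof (intro equalityI subsetI)
  fix \<alpha> assume "\<alpha> \<in> shift \<xi> (prepend \<xi> X)"
  then obtain \<beta> where \<beta>: "\<beta> \<in> X" "\<xi> \<cdot> \<alpha> \<preceq> \<xi> \<cdot> \<beta>" "\<alpha> \<in> M" "rng \<alpha> = src \<xi>"
    by (auto simp: shift_def prepend_def)
  moreover have "\<beta> \<in> M" "rng \<beta> = src \<xi>"
    using \<beta> assms tight_M[of X \<beta>] tight_vertex[of X "src \<xi>" \<beta>] by simp_all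
  ultimately have "\<alpha> \<preceq> \<beta>"
    using assms(1) prefix_cmp_iff by metis
  then show "\<alpha> \<in> X"
    using tight_prefix assms(2) \<beta>(1) by blast
next
  fix \<alpha> assume "\<alpha> \<in> X"
  then show "\<alpha> \<in> shift \<xi> (prepend \<xi> X)"
    using assms prependI tight_M tight_vertex[of X "src \<xi>" \<alpha>] by (simp add: shift_def)
qed

lemma prepend_shift:
  assumes "tight X" "\<xi> \<in> X"
  shows "prepend \<xi> (shift \<xi> X) = X"
proof (intro equalityI subsetI)
  fix \<alpha> assume "\<alpha> \<in> prepend \<xi> (shift \<xi> X)"
  then show "\<alpha> \<in> X"
    using assms tight_prefix by (auto simp: shift_def prepend_def)
next
  fix \<alpha> assume "\<alpha> \<in> X"
  then obtain \<kappa> where \<kappa>: "\<kappa> \<in> X" "\<alpha> \<preceq> \<kappa>" "\<xi> \<preceq> \<kappa>"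
    using assms tight_directed by metis
  then obtain \<gamma> where "\<gamma> \<in> M" "src \<xi> = rng \<gamma>" "\<kappa> = \<xi> \<cdot> \<gamma>"
    by (elim prefixE)
  then show "\<alpha> \<in> prepend \<xi> (shift \<xi> X)"
    using \<kappa> by (auto simp: shift_def prepend_def)
qed

lemma shift_cmp:
  assumes "tight X" "\<alpha> \<in> M" "\<beta> \<in> M" "src \<alpha> = rng \<beta>"
  shows "\<alpha> \<cdot> \<beta> \<in> X \<longleftrightarrow> \<alpha> \<in> X \<and> \<beta> \<in> shift \<alpha> X"
    and "\<alpha> \<cdot> \<beta> \<in> X \<Longrightarrow> shift \<beta> (shift \<alpha> X) = shift (\<alpha> \<cdot> \<beta>) X"
proof -
  show "\<alpha> \<cdot> \<beta> \<in> X \<longleftrightarrow> \<alpha> \<in> X \<and> \<beta> \<in> shift \<alpha> X"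
    using assms tight_prefix prefixI by (auto simp: shift_def)
  show "shift \<beta> (shift \<alpha> X) = shift (\<alpha> \<cdot> \<beta>) X"
    using assms by (auto simp: shift_def cmp_assoc)
qed

lemma shift_vertex: "tight X \<Longrightarrow> v \<in> vertices \<Lambda> \<Longrightarrow> v \<in> X \<Longrightarrow> shift v X = X"
  using tight_vertex tight_M src_vertex by (auto simp: shift_def) (metis cmp_rg)+

lemma prepend_vertex: "tight X \<Longrightarrow> v \<in> vertices \<Lambda> \<Longrightarrow> v \<in> X \<Longrightarrow> prepend v X = X"
  by (metis prepend_shift shift_vertex)

lemma prepend_cmp:
  assumes "tight X" "\<alpha> \<in> M" "\<beta> \<in> M" "src \<alpha> = rng \<beta>" "src \<beta> \<in> X"
  shows "prepend (\<alpha> \<cdot> \<beta>) X = prepend \<alpha> (prepend \<beta> X)"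
proof (intro equalityI subsetI)
  have X: "\<delta> \<in> M" "rng \<delta> = src \<beta>" if "\<delta> \<in> X" for \<delta>
    using that assms tight_M tight_vertex[of X "src \<beta>" \<delta>] by auto
  fix \<gamma>
  { assume "\<gamma> \<in> prepend (\<alpha> \<cdot> \<beta>) X"
    then obtain \<delta> where "\<delta> \<in> X" "\<gamma> \<preceq> \<alpha> \<cdot> \<beta> \<cdot> \<delta>"
      by (auto simp: prepend_def)
    then show "\<gamma> \<in> prepend \<alpha> (prepend \<beta> X)"
      using X[of \<delta>] assms prependI[of \<beta> X \<delta>]
      by (auto simp: cmp_assoc prepend_def[of \<alpha>]) }
  { assume "\<gamma> \<in> prepend \<alpha> (prepend \<beta> X)"
    then obtain \<epsilon> \<delta> where *: "\<delta> \<in> X" "\<epsilon> \<preceq> \<beta> \<cdot> \<delta>" "\<gamma> \<preceq> \<alpha> \<cdot> \<epsilon>"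
      by (auto simp: prepend_def)
    then have "\<alpha> \<cdot> \<epsilon> \<preceq> \<alpha> \<cdot> (\<beta> \<cdot> \<delta>)"
      using assms X[of \<delta>] prefix_cmp_iff[of \<alpha> \<epsilon> "\<beta> \<cdot> \<delta>"] prefix_M(1)[OF *(2)] prefix_rng[OF *(2)]
      by simp
    then have "\<gamma> \<preceq> \<alpha> \<cdot> \<beta> \<cdot> \<delta>"
      using * assms X[of \<delta>] prefix_trans[OF *(3)] by (simp add: cmp_assoc)
    then show "\<gamma> \<in> prepend (\<alpha> \<cdot> \<beta>) X"
      using * by (auto simp: prepend_def) }
qed

section \<open>Aperiodicity as a condition on finite paths\<close>

definition separable :: bool where
  "separable \<longleftrightarrow> (\<forall>\<xi>\<in>M. \<forall>\<mu>\<in>M. src \<xi> = src \<mu> \<and> \<xi> \<noteq> \<mu> \<longrightarrow>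
     (\<exists>\<nu>\<in>M. rng \<nu> = src \<xi> \<and> \<not> compat (\<xi> \<cdot> \<nu>) (\<mu> \<cdot> \<nu>)))"

text \<open>The paths of \<open>L\<close> are treated one at a time. Incompatible paths stay
  incompatible when extended, and \<xi>\<nu> and \<mu>\<nu> stay distinct by right cancellation, so
  each new tail can be appended to the previous one.\<close>

lemma separable_finite:
  assumes separable "finite L" "\<xi> \<in> M" "L \<subseteq> M" "\<xi> \<notin> L" "src ` L \<subseteq> {src \<xi>}"
  shows "\<exists>\<nu>\<in>M. rng \<nu> = src \<xi> \<and> (\<forall>\<mu>\<in>L. \<not> compat (\<xi> \<cdot> \<nu>) (\<mu> \<cdot> \<nu>))"
  using assms(2-)
proof (induction L rule: finite_induct)
  case empty
  then show ?case
    by (auto intro: bexI[of _ "src \<xi>"])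
next
  case (insert \<mu> L)
  then obtain \<nu> where \<nu>: "\<nu> \<in> M" "rng \<nu> = src \<xi>" "\<And>\<mu>. \<mu> \<in> L \<Longrightarrow> \<not> compat (\<xi> \<cdot> \<nu>) (\<mu> \<cdot> \<nu>)"
    by auto
  have \<mu>: "\<mu> \<in> M" "src \<mu> = src \<xi>" "\<xi> \<noteq> \<mu>"
    using insert.prems by auto
  then have "\<xi> \<cdot> \<nu> \<noteq> \<mu> \<cdot> \<nu>" "src (\<xi> \<cdot> \<nu>) = src (\<mu> \<cdot> \<nu>)" "\<xi> \<cdot> \<nu> \<in> M" "\<mu> \<cdot> \<nu> \<in> M"
    using \<nu> insert.prems(1) cancel_right[of \<xi> \<mu> \<nu>] by simp_all
  then obtain \<nu>' where \<nu>': "\<nu>' \<in> M" "rng \<nu>' = src (\<xi> \<cdot> \<nu>)" "\<not> compat (\<xi> \<cdot> \<nu> \<cdot> \<nu>') (\<mu> \<cdot> \<nu> \<cdot> \<nu>')"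
    using assms(1) unfolding separable_def by metis
  have "\<not> compat (\<xi> \<cdot> (\<nu> \<cdot> \<nu>')) (\<mu>' \<cdot> (\<nu> \<cdot> \<nu>'))" if "\<mu>' \<in> insert \<mu> L" for \<mu>'
  proof -
    have "\<mu>' \<in> M" "src \<mu>' = src \<xi>"
      using that insert.prems by auto
    then have eq: "\<xi> \<cdot> (\<nu> \<cdot> \<nu>') = \<xi> \<cdot> \<nu> \<cdot> \<nu>'" "\<mu>' \<cdot> (\<nu> \<cdot> \<nu>') = \<mu>' \<cdot> \<nu> \<cdot> \<nu>'"
      and "\<xi> \<cdot> \<nu> \<preceq> \<xi> \<cdot> \<nu> \<cdot> \<nu>'" "\<mu>' \<cdot> \<nu> \<preceq> \<mu>' \<cdot> \<nu> \<cdot> \<nu>'"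
      using \<nu> \<nu>' insert.prems(1) by (auto simp: cmp_assoc[symmetric] intro!: prefixI)
    then show ?thesis
      using \<nu>(3) \<nu>'(3) that compat_prefix unfolding eq by blast
  qed
  then show ?case
    using \<nu> \<nu>' insert.prems(1) by (intro bexI[of _ "\<nu> \<cdot> \<nu>'"]) auto
qed

end

context fa_kgraph
begin

text \<open>The tails that carry \<beta> through \<open>E\<close> are exhaustive at the common
  source of \<alpha> and \<beta>, so \<open>X\<close> must follow one of them after \<alpha>. In
  this way a filter reacts to exhaustive sets placed along another path with the same
  source.\<close>

lemma tight_FE_ext:
  assumes "tight X" "\<alpha> \<in> X" "\<beta> \<in> M" "rng \<beta> = v" "src \<beta> = src \<alpha>" "E \<in> FE \<Lambda> v"
  shows "\<exists>\<gamma>\<in>X. \<exists>\<rho>\<in>M. src \<alpha> = rng \<rho> \<and> \<gamma> = \<alpha> \<cdot> \<rho> \<and> (\<exists>e\<in>E. e \<preceq> \<beta> \<cdot> \<rho>)"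
proof (cases "\<exists>e\<in>E. e \<preceq> \<beta>")
  case True
  moreover have "\<alpha> \<in> M"
    using assms tight_M by blast
  moreover have "\<beta> \<cdot> src \<alpha> = \<beta>" "\<alpha> \<cdot> src \<alpha> = \<alpha>"
    using cmp_sr[of \<beta>] assms(3,5) \<open>\<alpha> \<in> M\<close> by simp_all
  ultimately show ?thesis
    using assms(2) by (intro bexI[of _ \<alpha>] bexI[of _ "src \<alpha>"]) auto
next
  case False
  then have "ext \<beta> E \<in> FE \<Lambda> (src \<alpha>)"
    using ext_FE' assms by metis
  then obtain \<rho> where "\<rho> \<in> ext \<beta> E" "\<alpha> \<cdot> \<rho> \<in> X"
    using tight_FE assms by metis
  moreover have "E \<subseteq> M"
    using assms by (auto simp: FE_iff)
  ultimately show ?thesis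
    using extD[of \<rho> \<beta> E] assms by metis
qed

text \<open>Only the last condition takes work. If \<beta> is a segment of \<xi>\<alpha> =
  \<beta>\<gamma> and \<open>E\<close> is exhaustive at the source of \<beta>, then \<alpha> is
  lengthened inside \<open>X\<close> by some \<rho> until \<gamma>\<rho> passes through a member
  \<open>e\<close> of \<open>E\<close>; now \<beta>e is a segment of \<xi>\<alpha>\<rho>.\<close>

lemma tight_prepend:
  assumes "\<xi> \<in> M" "tight X" "src \<xi> \<in> X"
  shows "tight (prepend \<xi> X)"
proof (rule tightI)
  have X: "\<alpha> \<in> M" "rng \<alpha> = src \<xi>" if "\<alpha> \<in> X" for \<alpha>
    using that assms tight_M tight_vertex[of X "src \<xi>" \<alpha>] by auto
  show "prepend \<xi> X \<noteq> {}"
    using assms prepend_self by blast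
  show "\<beta> \<in> prepend \<xi> X" if "\<alpha> \<in> prepend \<xi> X" "\<beta> \<preceq> \<alpha>" for \<alpha> \<beta>
    using that prefix_trans by (auto simp: prepend_def)
  show "\<exists>\<kappa>\<in>prepend \<xi> X. \<alpha> \<preceq> \<kappa> \<and> \<beta> \<preceq> \<kappa>" if ab: "\<alpha> \<in> prepend \<xi> X" "\<beta> \<in> prepend \<xi> X" for \<alpha> \<beta>
  proof -
    obtain \<gamma> \<delta> where *: "\<gamma> \<in> X" "\<delta> \<in> X" "\<alpha> \<preceq> \<xi> \<cdot> \<gamma>" "\<beta> \<preceq> \<xi> \<cdot> \<delta>"
      using ab by (auto simp: prepend_def)
    then obtain \<kappa> where \<kappa>: "\<kappa> \<in> X" "\<gamma> \<preceq> \<kappa>" "\<delta> \<preceq> \<kappa>"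
      using assms tight_directed by metis
    then have "\<xi> \<cdot> \<gamma> \<preceq> \<xi> \<cdot> \<kappa>" "\<xi> \<cdot> \<delta> \<preceq> \<xi> \<cdot> \<kappa>"
      using * X assms prefix_cmp_iff by auto
    then show ?thesis
      using * \<kappa> assms prependI prefix_trans by blast
  qed
  show "\<exists>e\<in>E. \<beta> \<cdot> e \<in> prepend \<xi> X" if \<beta>: "\<beta> \<in> prepend \<xi> X" "E \<in> FE \<Lambda> (src \<beta>)" for \<beta> E
  proof -
    obtain \<alpha> where \<alpha>: "\<alpha> \<in> X" "\<beta> \<preceq> \<xi> \<cdot> \<alpha>"
      using \<beta>(1) by (auto simp: prepend_def)
    then obtain \<gamma> where \<gamma>: "\<beta> \<in> M" "\<gamma> \<in> M" "src \<beta> = rng \<gamma>" "\<xi> \<cdot> \<alpha> = \<beta> \<cdot> \<gamma>"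
      by (elim prefixE)
    have "src \<gamma> = src \<alpha>"
      using \<gamma> X[OF \<alpha>(1)] assms(1) by (metis sr_cmp)
    then obtain \<rho> e where \<rho>: "\<rho> \<in> M" "src \<alpha> = rng \<rho>" "\<alpha> \<cdot> \<rho> \<in> X" "e \<in> E" "e \<preceq> \<gamma> \<cdot> \<rho>"
      using tight_FE_ext[of X \<alpha> \<gamma> "src \<beta>" E] assms \<alpha> \<gamma> \<beta>(2) by auto
    have "\<xi> \<cdot> (\<alpha> \<cdot> \<rho>) = \<beta> \<cdot> (\<gamma> \<cdot> \<rho>)"
      using \<gamma> X[OF \<alpha>(1)] \<rho> assms(1) \<open>src \<gamma> = src \<alpha>\<close> by (metis cmp_assoc)
    moreover have "\<beta> \<cdot> e \<preceq> \<beta> \<cdot> (\<gamma> \<cdot> \<rho>)"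
      using \<rho> \<gamma> \<open>src \<gamma> = src \<alpha>\<close> prefix_cmp_iff[of \<beta> e "\<gamma> \<cdot> \<rho>"] prefix_M prefix_rng[of e] by auto
    ultimately show ?thesis
      using \<rho>(3,4) unfolding prepend_def by (intro bexI[of _ e]) (auto intro!: bexI[of _ "\<alpha> \<cdot> \<rho>"])
  qed
qed

lemma tight_compat:
  assumes "tight X" "\<alpha> \<in> X" "\<beta> \<in> X" shows "compat \<alpha> \<beta>"
  using assms tight_directed compatI by metis

text \<open>If no extension separates \<open>\<xi>\<alpha>\<close> from \<open>\<mu>\<alpha>\<close>, then the extensions of \<open>\<mu>\<alpha>\<close> by
  which it meets \<open>\<xi>\<alpha>\<close> are exhaustive, so tightness puts one of them into \<open>X\<close>.\<close>

lemma prepend_subset: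
  assumes "\<xi> \<in> M" "\<mu> \<in> M" "src \<xi> = src \<mu>" "tight X" "src \<xi> \<in> X"
    and all: "\<And>\<nu>. \<nu> \<in> M \<Longrightarrow> rng \<nu> = src \<xi> \<Longrightarrow> compat (\<xi> \<cdot> \<nu>) (\<mu> \<cdot> \<nu>)"
  shows "prepend \<xi> X \<subseteq> prepend \<mu> X"
proof -
  have "\<xi> \<cdot> \<alpha> \<in> prepend \<mu> X" if "\<alpha> \<in> X" for \<alpha>
  proof -
    have \<alpha>: "\<alpha> \<in> M" "rng \<alpha> = src \<xi>"
      using that assms tight_M tight_vertex[of X "src \<xi>" \<alpha>] by auto
    have "\<exists>\<rho>\<in>M. src \<alpha> = rng \<rho> \<and> \<alpha> \<cdot> \<rho> \<in> X \<and> \<xi> \<cdot> \<alpha> \<preceq> \<mu> \<cdot> \<alpha> \<cdot> \<rho>"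
    proof (cases "\<xi> \<cdot> \<alpha> \<preceq> \<mu> \<cdot> \<alpha>")
      case True
      moreover have "\<mu> \<cdot> \<alpha> \<cdot> src \<alpha> = \<mu> \<cdot> \<alpha>"
        using cmp_sr[of "\<mu> \<cdot> \<alpha>"] \<alpha> assms by simp
      ultimately show ?thesis
        using \<alpha> that by (intro bexI[of _ "src \<alpha>"]) auto
    next
      case False
      have "compat (\<mu> \<cdot> \<alpha> \<cdot> \<nu>) (\<xi> \<cdot> \<alpha>)" if "\<nu> \<in> M" "src (\<mu> \<cdot> \<alpha>) = rng \<nu>" for \<nu>
      proof -
        have "\<nu> \<in> M" "src \<alpha> = rng \<nu>"
          using that \<alpha> assms by auto
        then have "compat (\<mu> \<cdot> \<alpha> \<cdot> \<nu>) (\<xi> \<cdot> \<alpha> \<cdot> \<nu>)" "\<xi> \<cdot> \<alpha> \<preceq> \<xi> \<cdot> \<alpha> \<cdot> \<nu>" "\<mu> \<cdot> \<alpha> \<cdot> \<nu> \<in> M"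
          using all[of "\<alpha> \<cdot> \<nu>"] \<alpha> assms(1-3) compat_sym by (auto simp: cmp_assoc[symmetric] intro: prefixI)
        then show ?thesis
          using compat_prefix[of _ _ "\<mu> \<cdot> \<alpha> \<cdot> \<nu>" "\<xi> \<cdot> \<alpha>"] by auto
      qed
      then have "ext (\<mu> \<cdot> \<alpha>) {\<xi> \<cdot> \<alpha>} \<in> FE \<Lambda> (src \<alpha>)"
        using ext_FE[of "\<mu> \<cdot> \<alpha>" "{\<xi> \<cdot> \<alpha>}"] False \<alpha> assms by simp
      then obtain \<rho> where "\<rho> \<in> ext (\<mu> \<cdot> \<alpha>) {\<xi> \<cdot> \<alpha>}" "\<alpha> \<cdot> \<rho> \<in> X"
        using tight_FE[OF assms(4) \<open>\<alpha> \<in> X\<close>] by blast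
      then show ?thesis
        using extD[of \<rho> "\<mu> \<cdot> \<alpha>" "{\<xi> \<cdot> \<alpha>}"] \<alpha> assms(1-3) by (intro bexI[of _ \<rho>]) auto
    qed
    then show ?thesis
      using \<alpha> assms(1-3) by (auto simp: prepend_def cmp_assoc)
  qed
  then show ?thesis
    using prefix_trans by (fastforce simp: prepend_def)
qed

lemma prepend_eq:
  assumes "\<xi> \<in> M" "\<mu> \<in> M" "src \<xi> = src \<mu>" "tight X" "src \<xi> \<in> X"
    and "\<And>\<nu>. \<nu> \<in> M \<Longrightarrow> rng \<nu> = src \<xi> \<Longrightarrow> compat (\<xi> \<cdot> \<nu>) (\<mu> \<cdot> \<nu>)"
  shows "prepend \<xi> X = prepend \<mu> X"
  using assms prepend_subset[of \<xi> \<mu> X] prepend_subset[of \<mu> \<xi> X] compat_sym by auto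

text \<open>The construction of Rasiowa and Sikorski: a tight filter meeting countably many dense sets.
  Tightness itself amounts to meeting countably many dense sets.\<close>

lemma generic_tight:
  assumes v: "v \<in> W" "v \<in> vertices \<Lambda>"
    and W: "\<And>w E. w \<in> W \<Longrightarrow> w \<in> vertices \<Lambda> \<Longrightarrow> E \<in> FE \<Lambda> w \<Longrightarrow> \<exists>e\<in>E. src e \<in> W"
    and \<D>: "countable \<D>"
    and dense: "\<And>D \<alpha>. D \<in> \<D> \<Longrightarrow> \<alpha> \<in> M \<Longrightarrow> rng \<alpha> = v \<Longrightarrow> src \<alpha> \<in> W \<Longrightarrow>
      \<exists>\<beta>\<in>D. \<alpha> \<preceq> \<beta> \<and> src \<beta> \<in> W"
  shows "\<exists>X. tight X \<and> v \<in> X \<and> (\<forall>D\<in>\<D>. X \<inter> D \<noteq> {}) \<and>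
    (\<forall>\<alpha>\<in>X. \<exists>\<beta>. \<alpha> \<preceq> \<beta> \<and> src \<beta> \<in> W)"
proof -
  \<comment> \<open>The conditions of the construction: paths at \<open>v\<close> whose source stays
    in \<open>W\<close>. The hypothesis on \<open>W\<close> says that no finite exhaustive set
    forces them to leave it.\<close>
  define T where "T = {\<alpha> \<in> M. rng \<alpha> = v \<and> src \<alpha> \<in> W}"
  \<comment> \<open>Meeting all these sets gives tightness. The second alternative makes them dense
    above paths that can no longer reach \<alpha>; it is refuted later if \<alpha> belongs to the
    filter.\<close>
  define C where "C = (\<lambda>(\<alpha>, E). {\<gamma>. (\<exists>e\<in>E. \<alpha> \<cdot> e \<preceq> \<gamma>) \<or> (\<forall>\<kappa>. \<gamma> \<preceq> \<kappa> \<and> src \<kappa> \<in> W \<longrightarrow> \<not> \<alpha> \<preceq> \<kappa>)})"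
  define I where "I = {(\<alpha>, E). \<alpha> \<in> M \<and> E \<in> FE \<Lambda> (src \<alpha>)}"
  \<comment> \<open>\<open>UNIV\<close> makes the family nonempty, so that it can be enumerated by
    the natural numbers.\<close>
  define \<D>' where "\<D>' = insert UNIV (\<D> \<union> C ` I)"
  have "I \<subseteq> M \<times> {E. finite E \<and> E \<subseteq> M}"
    by (auto simp: I_def FE_iff)
  moreover have "countable \<dots>"
    by (intro countable_SIGMA countable_Mor countable_Collect_finite_subset)
  ultimately have "countable I"
    using countable_subset by blast
  then have "countable \<D>'"
    using \<D> by (auto simp: \<D>'_def)
  then obtain F :: "nat \<Rightarrow> 'a set" where F: "\<D>' = range F"
    using uncountable_def[of \<D>'] unfolding \<D>'_def by (metis insert_not_empty)
  have dense': "\<exists>\<beta>. \<beta> \<in> T \<and> \<beta> \<in> D \<and> \<alpha> \<preceq> \<beta>" if D: "D \<in> \<D>'" and \<alpha>: "\<alpha> \<in> T" for D \<alpha>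
  proof -
    consider "D = UNIV" | "D \<in> \<D>" | \<beta> E where "D = C (\<beta>, E)" "\<beta> \<in> M" "E \<in> FE \<Lambda> (src \<beta>)"
      using D by (auto simp: \<D>'_def I_def)
    then show ?thesis
    proof cases
      case 1
      then show ?thesis
        using \<alpha> by (auto simp: T_def)
    next
      case 2
      then show ?thesis
        using \<alpha> dense[of D \<alpha>] prefix_M(2)[of \<alpha>] prefix_rng[of \<alpha>] unfolding T_def by fastforce
    next
      case 3
      show ?thesis
      proof (cases "\<exists>\<kappa>. \<alpha> \<preceq> \<kappa> \<and> src \<kappa> \<in> W \<and> \<beta> \<preceq> \<kappa>")
        case False
        then show ?thesis
          using \<alpha> by (auto simp: 3(1) C_def T_def)
      next
        case True
        then obtain \<kappa> \<gamma> where \<kappa>: "\<alpha> \<preceq> \<kappa>" "src \<kappa> \<in> W" "\<gamma> \<in> M" "src \<beta> = rng \<gamma>" "\<kappa> = \<beta> \<cdot> \<gamma>"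
          by (auto elim: prefixE)
        \<comment> \<open>The path \<kappa> = \<beta>\<gamma> is continued by a tail that carries
          \<gamma> through \<open>E\<close>. If \<gamma> does not pass through \<open>E\<close> yet,
          such tails are exhaustive at \<open>src \<gamma>\<close>, and the hypothesis on
          \<open>W\<close> provides one that ends in \<open>W\<close>.\<close>
        have "\<exists>\<rho>\<in>M. rng \<rho> = src \<gamma> \<and> src \<rho> \<in> W \<and> (\<exists>e\<in>E. e \<preceq> \<gamma> \<cdot> \<rho>)"
        proof (cases "\<exists>e\<in>E. e \<preceq> \<gamma>")
          case True
          then show ?thesis
            using \<kappa> 3 by (intro bexI[of _ "src \<gamma>"]) auto
        next
          case False
          then have "ext \<gamma> E \<in> FE \<Lambda> (src \<gamma>)"
            using ext_FE' \<kappa> 3 by metis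
          then obtain \<rho> where "\<rho> \<in> ext \<gamma> E" "src \<rho> \<in> W"
            using W[of "src \<gamma>"] \<kappa> 3 by auto
          moreover have "E \<subseteq> M"
            using 3 by (auto simp: FE_iff)
          ultimately show ?thesis
            using extD[of \<rho> \<gamma> E] \<kappa> by metis
        qed
        then obtain \<rho> e where \<rho>: "\<rho> \<in> M" "rng \<rho> = src \<gamma>" "src \<rho> \<in> W" "e \<in> E" "e \<preceq> \<gamma> \<cdot> \<rho>"
          by auto
        have "\<kappa> \<preceq> \<kappa> \<cdot> \<rho>"
          using \<rho> \<kappa> 3 by (intro prefixI) auto
        then have "\<alpha> \<preceq> \<kappa> \<cdot> \<rho>"
          using \<kappa> prefix_trans by blast
        moreover have "\<beta> \<cdot> e \<preceq> \<beta> \<cdot> (\<gamma> \<cdot> \<rho>)"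
          using \<rho> \<kappa> 3 prefix_cmp_iff[of \<beta> e "\<gamma> \<cdot> \<rho>"] prefix_M prefix_rng[of e] by auto
        then have "\<kappa> \<cdot> \<rho> \<in> D"
          using \<rho> \<kappa> 3 by (auto simp: C_def cmp_assoc)
        moreover have "\<kappa> \<cdot> \<rho> \<in> T"
          using \<rho> \<kappa> 3 \<alpha> prefix_rng[OF \<open>\<alpha> \<preceq> \<kappa> \<cdot> \<rho>\<close>] by (auto simp: T_def)
        ultimately show ?thesis
          by blast
      qed
    qed
  qed
  have "v \<in> T"
    using v vertices_M rng_vertex src_vertex by (auto simp: T_def)
  have "\<exists>f. \<forall>n. f n \<in> T \<and> (f (Suc n) \<in> F n \<and> f n \<preceq> f (Suc n))"
  proof (rule dependent_nat_choice)
    show "\<exists>x. x \<in> T"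
      using \<open>v \<in> T\<close> by blast
    show "\<exists>y. y \<in> T \<and> (y \<in> F n \<and> x \<preceq> y)" if "x \<in> T" for x n
      using dense'[of "F n" x] that F by auto
  qed
  then obtain f where f: "\<And>n. f n \<in> T" "\<And>n. f (Suc n) \<in> F n" "\<And>n. f n \<preceq> f (Suc n)"
    by blast
  have mono: "f m \<preceq> f n" if "m \<le> n" for m n
    using that
  proof (induction n rule: dec_induct)
    case base
    then show ?case
      using f(1) by (simp add: T_def)
  next
    case (step n)
    then show ?case
      using f(3) prefix_trans by blast
  qed
  define X where "X = {\<alpha>. \<exists>n. \<alpha> \<preceq> f n}"
  have fX: "f n \<in> X" for n
    using mono[of n n] by (auto simp: X_def)
  have dir: "\<exists>n. \<alpha> \<preceq> f n \<and> \<beta> \<preceq> f n" if ab: "\<alpha> \<in> X" "\<beta> \<in> X" for \<alpha> \<beta>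
  proof -
    obtain i j where "\<alpha> \<preceq> f i" "\<beta> \<preceq> f j"
      using ab by (auto simp: X_def)
    then have "\<alpha> \<preceq> f (max i j)" "\<beta> \<preceq> f (max i j)"
      using mono[of i "max i j"] mono[of j "max i j"] prefix_trans[of \<alpha> "f i"] prefix_trans[of \<beta> "f j"]
      by simp_all
    then show ?thesis
      by blast
  qed
  have "tight X"
  proof (rule tightI)
    show "X \<noteq> {}"
      using fX by blast
    show "\<beta> \<in> X" if "\<alpha> \<in> X" "\<beta> \<preceq> \<alpha>" for \<alpha> \<beta>
      using that prefix_trans by (auto simp: X_def)
    show "\<exists>\<kappa>\<in>X. \<alpha> \<preceq> \<kappa> \<and> \<beta> \<preceq> \<kappa>" if "\<alpha> \<in> X" "\<beta> \<in> X" for \<alpha> \<beta>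
      using dir[OF that] fX by blast
    show "\<exists>e\<in>E. \<alpha> \<cdot> e \<in> X" if \<alpha>: "\<alpha> \<in> X" "E \<in> FE \<Lambda> (src \<alpha>)" for \<alpha> E
    proof -
      have "C (\<alpha>, E) \<in> \<D>'"
        using \<alpha> prefix_M by (auto simp: \<D>'_def I_def X_def)
      then obtain n where "F n = C (\<alpha>, E)"
        using F by auto
      then have n: "f (Suc n) \<in> C (\<alpha>, E)"
        using f(2) by metis
      \<comment> \<open>A later path \<open>f m\<close> extends both \<alpha> and the chosen element
        of \<open>C (\<alpha>, E)\<close> and ends in \<open>W\<close>, which rules out the second
        alternative.\<close>
      obtain m where m: "\<alpha> \<preceq> f m" "f (Suc n) \<preceq> f m"
        using dir \<alpha>(1) fX by blast
      moreover have "src (f m) \<in> W"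
        using f(1) by (simp add: T_def)
      ultimately obtain e where "e \<in> E" "\<alpha> \<cdot> e \<preceq> f (Suc n)"
        using n by (auto simp: C_def)
      then show ?thesis
        by (auto simp: X_def)
    qed
  qed
  moreover have "v \<in> X"
    using f(1)[of 0] rng_prefix[of "f 0"] by (auto simp: X_def T_def)
  moreover have "X \<inter> D \<noteq> {}" if "D \<in> \<D>" for D
  proof -
    have "D \<in> \<D>'"
      using that by (simp add: \<D>'_def)
    then obtain n where "F n = D"
      using F by blast
    then show ?thesis
      using f(2)[of n] fX by blast
  qed
  moreover have "\<exists>\<beta>. \<alpha> \<preceq> \<beta> \<and> src \<beta> \<in> W" if "\<alpha> \<in> X" for \<alpha>
    using that f(1) by (auto simp: X_def T_def)
  ultimately show ?thesis
    by blast
qed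

text \<open>The vertex \<open>v\<close> is itself a path at \<open>v\<close>, so some member of
  \<open>E\<close> is compatible with it.\<close>

lemma FE_nonempty: "v \<in> vertices \<Lambda> \<Longrightarrow> E \<in> FE \<Lambda> v \<Longrightarrow> E \<noteq> {}"
  using rng_vertex vertices_M by (fastforce simp: FE_iff)

lemma generic_tight_all:
  assumes "v \<in> vertices \<Lambda>" "countable \<D>"
    and "\<And>D \<alpha>. D \<in> \<D> \<Longrightarrow> \<alpha> \<in> M \<Longrightarrow> rng \<alpha> = v \<Longrightarrow> \<exists>\<beta>\<in>D. \<alpha> \<preceq> \<beta>"
  obtains X where "tight X" "v \<in> X" "\<And>D. D \<in> \<D> \<Longrightarrow> X \<inter> D \<noteq> {}"
proof -
  have "\<exists>e\<in>E. src e \<in> UNIV" if "w \<in> vertices \<Lambda>" "E \<in> FE \<Lambda> w" for w E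
    using that FE_nonempty by auto
  moreover have "\<exists>\<beta>\<in>D. \<alpha> \<preceq> \<beta> \<and> src \<beta> \<in> UNIV" if "D \<in> \<D>" "\<alpha> \<in> M" "rng \<alpha> = v" for D \<alpha>
    using assms(3)[OF that] by simp
  ultimately have "\<exists>X. tight X \<and> v \<in> X \<and> (\<forall>D\<in>\<D>. X \<inter> D \<noteq> {}) \<and>
    (\<forall>\<alpha>\<in>X. \<exists>\<beta>. \<alpha> \<preceq> \<beta> \<and> src \<beta> \<in> UNIV)"
    using generic_tight[OF UNIV_I assms(1) _ assms(2)] by presburger
  then show ?thesis
    using that by blast
qed

lemma tight_exists:
  assumes "v \<in> vertices \<Lambda>"
  obtains X where "tight X" "v \<in> X"
  by (rule generic_tight_all[OF assms countable_empty]) (use that in auto)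

text \<open>For each of the countably many pairs \<xi> \<noteq> \<mu>, the tails \<gamma> making
  \<xi>\<gamma> and \<mu>\<gamma> incompatible are dense: apply \<open>separable\<close> to
  \<xi>\<alpha> and \<mu>\<alpha>. A filter meeting all these sets has distinct translates, since
  members of one tight filter are compatible. The converse is \<open>prepend_eq\<close>.\<close>

lemma separable_iff:
  "separable \<longleftrightarrow> (\<forall>v\<in>vertices \<Lambda>. \<exists>X. tight X \<and> v \<in> X \<and>
    (\<forall>\<xi>\<in>M. \<forall>\<mu>\<in>M. src \<xi> = v \<and> src \<mu> = v \<and> \<xi> \<noteq> \<mu> \<longrightarrow> prepend \<xi> X \<noteq> prepend \<mu> X))"
proof
  assume sep: separable
  show "\<forall>v\<in>vertices \<Lambda>. \<exists>X. tight X \<and> v \<in> X \<and>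
    (\<forall>\<xi>\<in>M. \<forall>\<mu>\<in>M. src \<xi> = v \<and> src \<mu> = v \<and> \<xi> \<noteq> \<mu> \<longrightarrow> prepend \<xi> X \<noteq> prepend \<mu> X)"
  proof
    fix v assume v: "v \<in> vertices \<Lambda>"
    define D where "D = (\<lambda>(\<xi>, \<mu>). {\<gamma> \<in> M. \<not> compat (\<xi> \<cdot> \<gamma>) (\<mu> \<cdot> \<gamma>)})"
    define I where "I = {(\<xi>, \<mu>). \<xi> \<in> M \<and> \<mu> \<in> M \<and> src \<xi> = v \<and> src \<mu> = v \<and> \<xi> \<noteq> \<mu>}"
    have "I \<subseteq> M \<times> M"
      by (auto simp: I_def)
    then have "countable (D ` I)"
      using countable_SIGMA[of M "\<lambda>_. M"] countable_Mor countable_subset by blast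
    moreover have "\<exists>\<beta>\<in>D'. \<alpha> \<preceq> \<beta>" if D': "D' \<in> D ` I" and \<alpha>: "\<alpha> \<in> M" "rng \<alpha> = v" for D' \<alpha>
    proof -
      obtain \<xi> \<mu> where \<xi>: "D' = D (\<xi>, \<mu>)" "\<xi> \<in> M" "\<mu> \<in> M" "src \<xi> = v" "src \<mu> = v" "\<xi> \<noteq> \<mu>"
        using D' by (auto simp: I_def)
      then have "\<xi> \<cdot> \<alpha> \<noteq> \<mu> \<cdot> \<alpha>" "\<xi> \<cdot> \<alpha> \<in> M" "\<mu> \<cdot> \<alpha> \<in> M" "src (\<xi> \<cdot> \<alpha>) = src (\<mu> \<cdot> \<alpha>)"
        using \<alpha> cancel_right[of \<xi> \<mu> \<alpha>] by auto
      then obtain \<nu> where "\<nu> \<in> M" "rng \<nu> = src (\<xi> \<cdot> \<alpha>)" "\<not> compat (\<xi> \<cdot> \<alpha> \<cdot> \<nu>) (\<mu> \<cdot> \<alpha> \<cdot> \<nu>)"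
        using sep unfolding separable_def by metis
      then show ?thesis
        using \<xi> \<alpha> by (intro bexI[of _ "\<alpha> \<cdot> \<nu>"]) (auto simp: D_def cmp_assoc intro: prefixI)
    qed
    ultimately obtain X where X: "tight X" "v \<in> X" "\<And>D'. D' \<in> D ` I \<Longrightarrow> X \<inter> D' \<noteq> {}"
      using generic_tight_all[OF v] by metis
    have "prepend \<xi> X \<noteq> prepend \<mu> X" if \<xi>: "\<xi> \<in> M" "\<mu> \<in> M" "src \<xi> = v" "src \<mu> = v" "\<xi> \<noteq> \<mu>" for \<xi> \<mu>
    proof
      assume eq: "prepend \<xi> X = prepend \<mu> X"
      have "(\<xi>, \<mu>) \<in> I"
        using \<xi> by (simp add: I_def)
      then obtain \<gamma> where "\<gamma> \<in> X" "\<gamma> \<in> D (\<xi>, \<mu>)"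
        using X(3) by blast
      then show False
        using prependI[of \<xi> X \<gamma>] prependI[of \<mu> X \<gamma>] \<xi> X tight_prepend[of \<xi> X] eq tight_compat
        by (auto simp: D_def)
    qed
    then show "\<exists>X. tight X \<and> v \<in> X \<and>
      (\<forall>\<xi>\<in>M. \<forall>\<mu>\<in>M. src \<xi> = v \<and> src \<mu> = v \<and> \<xi> \<noteq> \<mu> \<longrightarrow> prepend \<xi> X \<noteq> prepend \<mu> X)"
      using X(1,2) by blast
  qed
next
  assume "\<forall>v\<in>vertices \<Lambda>. \<exists>X. tight X \<and> v \<in> X \<and>
    (\<forall>\<xi>\<in>M. \<forall>\<mu>\<in>M. src \<xi> = v \<and> src \<mu> = v \<and> \<xi> \<noteq> \<mu> \<longrightarrow> prepend \<xi> X \<noteq> prepend \<mu> X)"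
  then show separable
    unfolding separable_def by (metis prepend_eq src_in_vertices)
qed

end

section \<open>Boundary paths as tight filters\<close>

lemma enats_le_iff: "enats n \<le> m \<longleftrightarrow> (\<forall>i. enat (n i) \<le> m i)"
  by (auto simp: enats_def le_fun_def)

lemma enats_le_enats [simp]: "enats n \<le> enats m \<longleftrightarrow> n \<le> m"
  by (auto simp: enats_def le_fun_def)

lemma zero_le_fun [simp]: "0 \<le> (n :: 'k \<Rightarrow> nat)"
  by (simp add: le_fun_def)

lemma le_add_fun [simp]: "n \<le> n + (m :: 'k \<Rightarrow> nat)"
  by (simp add: le_fun_def)

lemma enats_mono: "p \<le> q \<Longrightarrow> enats q \<le> m \<Longrightarrow> enats p \<le> m"
  by (meson enats_le_enats order_trans)

lemma enats_sup: "enats p \<le> m \<Longrightarrow> enats q \<le> m \<Longrightarrow> enats (sup p q) \<le> m"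
  by (auto simp: enats_le_iff sup_nat_def max_def)

lemma enats_zero [simp]: "enats 0 \<le> m"
  by (simp add: enats_le_iff zero_enat_def[symmetric])

lemma enat_le_ext: "(\<And>n. enat n \<le> a \<longleftrightarrow> enat n \<le> b) \<Longrightarrow> a = b"
proof (induction a b rule: linorder_wlog)
  case (le a b)
  show ?case
  proof (rule ccontr)
    assume "a \<noteq> b"
    then have "a < b"
      using le by simp
    then obtain k where "a = enat k"
      by (cases a) auto
    then have "enat (Suc k) \<le> b"
      using \<open>a < b\<close> by (simp add: Suc_ile_eq)
    then show False
      using le(2)[of "Suc k"] \<open>a = enat k\<close> by simp
  qed
qed metis

text \<open>Tuples supported at one coordinate test that coordinate alone.\<close>

lemma enats_ext:
  fixes a b :: "'k \<Rightarrow> enat"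
  assumes "\<And>n. enats n \<le> a \<longleftrightarrow> enats n \<le> b"
  shows "a = b"
proof
  fix i :: 'k
  have "enats ((\<lambda>j. 0)(i := n)) \<le> c \<longleftrightarrow> enat n \<le> c i" for n c
    by (auto simp: enats_le_iff zero_enat_def[symmetric])
  then show "a i = b i"
    using assms enat_le_ext by metis
qed

context k_graph
begin

definition filt :: "('a, 'k) bpath \<Rightarrow> 'a set" where
  "filt x = {bseg x 0 n | n. enats n \<le> bdeg x}"

lemma boundary_seg:
  assumes "x \<in> boundary \<Lambda>" "p \<le> q" "enats q \<le> bdeg x"
  shows "bseg x p q \<in> M" "rng (bseg x p q) = bvert x p" "src (bseg x p q) = bvert x q"
    "deg (bseg x p q) = q - p"
proof -
  have "(p, q) \<in> Mor (Omega (bdeg x))"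
    using assms by (simp add: Omega_def)
  then have "bseg x p q \<in> M \<and> rng (bseg x p q) = snd x (rg (Omega (bdeg x)) (p, q)) \<and>
    src (bseg x p q) = snd x (sr (Omega (bdeg x)) (p, q)) \<and>
    deg (bseg x p q) = dg (Omega (bdeg x)) (p, q)"
    using assms(1) unfolding boundary_def deg_functor_def by blast
  then show "bseg x p q \<in> M" "rng (bseg x p q) = bvert x p" "src (bseg x p q) = bvert x q"
    "deg (bseg x p q) = q - p"
    by (simp_all add: Omega_def)
qed

lemma boundary_cmp:
  assumes "x \<in> boundary \<Lambda>" "p \<le> q" "q \<le> t" "enats t \<le> bdeg x"
  shows "bseg x p t = bseg x p q \<cdot> bseg x q t"
proof -
  have "(p, q) \<in> Mor (Omega (bdeg x))" "(q, t) \<in> Mor (Omega (bdeg x))"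
    "sr (Omega (bdeg x)) (p, q) = rg (Omega (bdeg x)) (q, t)"
    using assms enats_mono by (auto simp: Omega_def)
  then have "snd x (cmp (Omega (bdeg x)) (p, q) (q, t)) = bseg x p q \<cdot> bseg x q t"
    using assms(1) unfolding boundary_def deg_functor_def by blast
  then show ?thesis
    by (simp add: Omega_def)
qed

lemma boundary_deg0 [simp]:
  assumes "x \<in> boundary \<Lambda>" "enats n \<le> bdeg x"
  shows "deg (bseg x 0 n) = n"
  using boundary_seg(4)[of x 0 n] assms by (auto simp: fun_eq_iff le_fun_def)

lemma boundary_prefix:
  assumes "x \<in> boundary \<Lambda>" "p \<le> q" "enats q \<le> bdeg x"
  shows "bseg x 0 p \<preceq> bseg x 0 q"
  using boundary_cmp[OF assms(1) _ assms(2,3), of 0] boundary_seg[OF assms(1), of 0 p]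
    boundary_seg[OF assms] enats_mono[OF assms(2,3)] prefixI[of "bseg x 0 p" "bseg x p q"]
  by (simp add: le_fun_def)

lemma filt_iff: "\<alpha> \<in> filt x \<longleftrightarrow> enats (deg \<alpha>) \<le> bdeg x \<and> bseg x 0 (deg \<alpha>) = \<alpha>"
  if "x \<in> boundary \<Lambda>"
  using that by (auto simp: filt_def intro!: exI[of _ "deg \<alpha>"])

lemma bseg_filt: "x \<in> boundary \<Lambda> \<Longrightarrow> enats n \<le> bdeg x \<Longrightarrow> bseg x 0 n \<in> filt x"
  by (auto simp: filt_def)

lemma tight_filt:
  assumes x: "x \<in> boundary \<Lambda>"
  shows "tight (filt x)"
proof (rule tightI)
  show "filt x \<noteq> {}"
    using bseg_filt[OF x, of 0] by auto
  show "\<beta> \<in> filt x" if "\<alpha> \<in> filt x" "\<beta> \<preceq> \<alpha>" for \<alpha> \<beta>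
  proof -
    obtain n where n: "\<alpha> = bseg x 0 n" "enats n \<le> bdeg x"
      using \<open>\<alpha> \<in> filt x\<close> by (auto simp: filt_def)
    have "deg \<beta> \<le> n"
      using prefix_deg[OF that(2)] n x by simp
    then have "\<beta> = bseg x 0 (deg \<beta>)" "enats (deg \<beta>) \<le> bdeg x"
      using boundary_prefix[OF x _ n(2)] n that(2) x enats_mono[OF _ n(2), of "deg \<beta>"]
        prefix_eq[of \<beta> \<alpha> "bseg x 0 (deg \<beta>)"]
      by auto
    then show ?thesis
      using filt_iff[OF x] by metis
  qed
  show "\<exists>\<kappa>\<in>filt x. \<alpha> \<preceq> \<kappa> \<and> \<beta> \<preceq> \<kappa>" if "\<alpha> \<in> filt x" "\<beta> \<in> filt x" for \<alpha> \<beta>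
  proof -
    obtain p q where pq: "\<alpha> = bseg x 0 p" "enats p \<le> bdeg x" "\<beta> = bseg x 0 q" "enats q \<le> bdeg x"
      using \<open>\<alpha> \<in> filt x\<close> \<open>\<beta> \<in> filt x\<close> by (auto simp: filt_def)
    then have "enats (sup p q) \<le> bdeg x"
      using enats_sup by blast
    then show ?thesis
      using pq boundary_prefix[OF x, of p "sup p q"] boundary_prefix[OF x, of q "sup p q"]
      by (intro bexI[of _ "bseg x 0 (sup p q)"] bseg_filt x) auto
  qed
  show "\<exists>e\<in>E. \<alpha> \<cdot> e \<in> filt x" if "\<alpha> \<in> filt x" "E \<in> FE \<Lambda> (src \<alpha>)" for \<alpha> E
  proof -
    obtain n where n: "\<alpha> = bseg x 0 n" "enats n \<le> bdeg x"
      using \<open>\<alpha> \<in> filt x\<close> by (auto simp: filt_def)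
    then have "E \<in> FE \<Lambda> (bvert x n)"
      using that(2) boundary_seg(3)[OF x, of 0 n] by (simp add: le_fun_def)
    then obtain e where "e \<in> E" "enats (n + deg e) \<le> bdeg x" "bseg x n (n + deg e) = e"
      using x n unfolding boundary_def by blast
    then show ?thesis
      using boundary_cmp[OF x, of 0 n "n + deg e"] n bseg_filt[OF x, of "n + deg e"]
      by (intro bexI[of _ e]) simp_all
  qed
qed

lemma filt_vertex: "x \<in> boundary \<Lambda> \<Longrightarrow> bvert x 0 \<in> filt x"
  using bseg_filt[of x 0] by simp

lemma filt_degrees: "x \<in> boundary \<Lambda> \<Longrightarrow> enats n \<le> bdeg x \<longleftrightarrow> (\<exists>\<alpha>\<in>filt x. deg \<alpha> = n)"
  using bseg_filt filt_iff by (metis boundary_deg0)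

text \<open>Left cancellation recovers all segments from those starting at 0; a filter records only
  the latter.\<close>

lemma bseg_eqI:
  assumes "x \<in> boundary \<Lambda>" "p \<le> q" "enats q \<le> bdeg x" "\<gamma> \<in> M" "src (bseg x 0 p) = rng \<gamma>"
    and "bseg x 0 q = bseg x 0 p \<cdot> \<gamma>"
  shows "bseg x p q = \<gamma>"
  using boundary_cmp[OF assms(1) _ assms(2,3), of 0] boundary_seg[OF assms(1), of 0 p]
    boundary_seg[OF assms(1-3)] enats_mono[OF assms(2,3)] assms(4-) cancel_left[of "bseg x 0 p" "bseg x p q" \<gamma>]
  by (simp add: le_fun_def)

text \<open>The degrees of the members determine \<open>bdeg\<close>, the unique member of each
  degree is an initial segment, and cancellation gives the other segments. Outside
  \<open>Omega\<close> both functors are undefined.\<close>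

lemma filt_inject:
  assumes x: "x \<in> boundary \<Lambda>" and y: "y \<in> boundary \<Lambda>" and eq: "filt x = filt y"
  shows "x = y"
proof -
  have deg: "bdeg x = bdeg y"
    using filt_degrees x y eq by (intro enats_ext) auto
  have seg0: "bseg x 0 q = bseg y 0 q" if "enats q \<le> bdeg x" for q
    using that tight_deg_eq[OF tight_filt[OF x], of "bseg x 0 q" "bseg y 0 q"] bseg_filt[OF x, of q]
      bseg_filt[OF y, of q] x y deg eq
    by simp
  have "snd x = snd y"
  proof (rule extensionalityI)
    show "snd x \<in> extensional (Mor (Omega (bdeg x)))" "snd y \<in> extensional (Mor (Omega (bdeg x)))"
      using x y deg by (auto simp: boundary_def)
    fix pq assume "pq \<in> Mor (Omega (bdeg x))"
    then obtain p q where pq: "pq = (p, q)" "p \<le> q" "enats q \<le> bdeg x"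
      by (auto simp: Omega_def)
    have "bseg x p q = bseg y p q"
    proof (rule bseg_eqI[OF x pq(2,3)])
      show "bseg y p q \<in> M"
        using boundary_seg[OF y pq(2)] pq deg by simp
      show "src (bseg x 0 p) = rng (bseg y p q)"
        using boundary_seg(2)[OF y pq(2)] boundary_seg(3)[OF y, of 0 p] pq deg seg0[of p]
          enats_mono[OF pq(2,3)] by (simp add: le_fun_def)
      show "bseg x 0 q = bseg x 0 p \<cdot> bseg y p q"
        using seg0[of p] seg0[of q] pq deg boundary_cmp[OF y, of 0 p q] enats_mono[OF pq(2,3)]
        by (simp add: le_fun_def)
    qed
    then show "snd x pq = snd y pq"
      by (simp add: pq)
  qed
  with deg show ?thesis
    by (simp add: prod_eq_iff)
qed

text \<open>The supremum is taken in each coordinate separately, but the filter is directed and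
  there are finitely many coordinates: the witnesses have a common extension in \<open>X\<close>,
  and its segment of degree \<open>n\<close> is the required member.\<close>

lemma tight_degrees:
  assumes X: "tight X"
  shows "(\<exists>\<alpha>\<in>X. deg \<alpha> = n) \<longleftrightarrow> enats n \<le> (\<lambda>i. SUP \<alpha>\<in>X. enat (deg \<alpha> i))"
proof
  assume "\<exists>\<alpha>\<in>X. deg \<alpha> = n"
  then show "enats n \<le> (\<lambda>i. SUP \<alpha>\<in>X. enat (deg \<alpha> i))"
    by (auto simp: enats_le_iff intro: SUP_upper)
next
  assume le: "enats n \<le> (\<lambda>i. SUP \<alpha>\<in>X. enat (deg \<alpha> i))"
  have ex: "\<exists>\<alpha>\<in>X. n i \<le> deg \<alpha> i" for i
  proof (rule ccontr)
    assume "\<not> ?thesis"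
    then have lt: "deg \<alpha> i < n i" if "\<alpha> \<in> X" for \<alpha>
      using that by (meson not_le)
    \<comment> \<open>The subtraction is harmless: \<open>X\<close> is nonempty, so some degree lies
      below \<open>n i\<close> and \<open>n i\<close> is positive.\<close>
    have "(SUP \<alpha>\<in>X. enat (deg \<alpha> i)) \<le> enat (n i - 1)"
      using lt by (intro SUP_least) fastforce
    moreover have "0 < n i"
      using lt tight_nonempty[OF X] by fastforce
    moreover have "enat (n i) \<le> (SUP \<alpha>\<in>X. enat (deg \<alpha> i))"
      using le by (simp add: enats_le_iff)
    ultimately have "enat (n i) \<le> enat (n i - 1)"
      by (meson order_trans)
    then show False
      using \<open>0 < n i\<close> by simp
  qed
  have "\<exists>\<kappa>\<in>X. \<forall>i\<in>S. n i \<le> deg \<kappa> i" if "finite S" for S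
    using that
  proof (induction S)
    case empty
    then show ?case
      using tight_nonempty[OF X] by auto
  next
    case (insert i S)
    then obtain \<kappa> where \<kappa>: "\<kappa> \<in> X" "\<And>i. i \<in> S \<Longrightarrow> n i \<le> deg \<kappa> i"
      by blast
    obtain \<alpha> where \<alpha>: "\<alpha> \<in> X" "n i \<le> deg \<alpha> i"
      using ex by blast
    obtain \<beta> where \<beta>: "\<beta> \<in> X" "\<kappa> \<preceq> \<beta>" "\<alpha> \<preceq> \<beta>"
      using tight_directed[OF X \<kappa>(1) \<alpha>(1)] by metis
    then have "deg \<kappa> \<le> deg \<beta>" "deg \<alpha> \<le> deg \<beta>"
      using prefix_deg by auto
    then have "n j \<le> deg \<beta> j" if "j \<in> insert i S" for j
      using that \<kappa>(2) \<alpha>(2) by (auto simp: le_fun_def intro: order_trans)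
    then show ?case
      using \<beta>(1) by blast
  qed
  from this[of UNIV] obtain \<kappa> where "\<kappa> \<in> X" "n \<le> deg \<kappa>"
    by (auto simp: le_fun_def)
  then show "\<exists>\<alpha>\<in>X. deg \<alpha> = n"
    using tight_of_degree[OF X] by metis
qed

text \<open>The degree is the supremum of the degrees in \<open>X\<close>, the initial segments are
  the members \<open>g n\<close> of each degree, and x(p,q) is the tail of \<open>g q\<close> after
  \<open>g p\<close>. Tightness of \<open>X\<close> becomes the boundary condition.\<close>

lemma filt_surj:
  assumes X: "tight X"
  obtains x where "x \<in> boundary \<Lambda>" "filt x = X"
proof -
  define m where "m = (\<lambda>i. SUP \<alpha>\<in>X. enat (deg \<alpha> i))"
  have m: "enats n \<le> m \<longleftrightarrow> (\<exists>\<alpha>\<in>X. deg \<alpha> = n)" for n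
    unfolding m_def using tight_degrees[OF X] by simp
  then obtain g where g: "\<And>n. enats n \<le> m \<Longrightarrow> g n \<in> X \<and> deg (g n) = n"
    by metis
  have gM: "g n \<in> M" "deg (g n) = n" "g n \<in> X" if "enats n \<le> m" for n
    using g[OF that] tight_M[OF X] by auto
  have g_unique: "g (deg \<alpha>) = \<alpha>" if "\<alpha> \<in> X" for \<alpha>
    using that g[of "deg \<alpha>"] m tight_deg_eq[OF X] by blast
  have "\<exists>\<gamma>\<in>M. src (g p) = rng \<gamma> \<and> g q = g p \<cdot> \<gamma>" if pq: "p \<le> q" "enats q \<le> m" for p q
  proof -
    have "enats p \<le> m"
      using pq enats_mono by blast
    obtain \<kappa> where "g p \<preceq> \<kappa>" "g q \<preceq> \<kappa>"
      using tight_directed[OF X] g \<open>enats p \<le> m\<close> pq(2) by metis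
    then have "g p \<preceq> g q"
      using prefix_linear gM \<open>enats p \<le> m\<close> pq by metis
    then show ?thesis
      by (elim prefixE) auto
  qed
  \<comment> \<open>The segment x(p,q). It is unique by left cancellation, and identities, degrees
    and composition all follow from that.\<close>
  then obtain h where h: "\<And>p q. p \<le> q \<Longrightarrow> enats q \<le> m \<Longrightarrow>
      h p q \<in> M \<and> src (g p) = rng (h p q) \<and> g q = g p \<cdot> h p q"
    by metis
  have h_unique: "h p q = \<gamma>"
    if "p \<le> q" "enats q \<le> m" "\<gamma> \<in> M" "src (g p) = rng \<gamma>" "g q = g p \<cdot> \<gamma>" for p q \<gamma>
    using that h[of p q] gM[of p] enats_mono[of p q m] cancel_left by metis
  have hid: "h p p = src (g p)" if "enats p \<le> m" for p
    using that gM[of p] by (intro h_unique) auto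
  have hsrc: "src (h p q) = src (g q)" if "p \<le> q" "enats q \<le> m" for p q
    using h[OF that] gM[of p] enats_mono[OF that] by simp
  have hdeg: "deg (h p q) = q - p" if "p \<le> q" "enats q \<le> m" for p q
  proof -
    have "deg (g q) = deg (g p) + deg (h p q)"
      using h[OF that] gM(1)[of p] enats_mono[OF that] by simp
    then have "q = p + deg (h p q)"
      using gM(2)[of p] gM(2)[of q] enats_mono[OF that] that by simp
    then show ?thesis
      by (metis add_diff_cancel_left')
  qed
  have hcmp: "h p t = h p q \<cdot> h q t" if "p \<le> q" "q \<le> t" "enats t \<le> m" for p q t
  proof (rule h_unique)
    have "enats q \<le> m" "enats p \<le> m"
      using that enats_mono by blast+
    note H = h[OF that(1) this(1)] h[OF that(2,3)] hsrc[OF that(1) this(1)] gM(1)[OF this(2)]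
    show "g t = g p \<cdot> (h p q \<cdot> h q t)"
      using H by (metis cmp_assoc)
    have "src (h p q) = rng (h q t)"
      using H by metis
    then show "h p q \<cdot> h q t \<in> M" "src (g p) = rng (h p q \<cdot> h q t)"
      using H by (metis cmp_closed, metis rg_cmp)
  qed (use that in auto)
  define x where "x = (m, restrict (\<lambda>(p, q). h p q) (Mor (Omega m)))"
  have seg: "bseg x p q = h p q" if "p \<le> q" "enats q \<le> m" for p q
    using that by (simp add: x_def Omega_def)
  have [simp]: "bdeg x = m"
    by (simp add: x_def)
  have g0: "rng (g n) = src (g 0)" if "enats n \<le> m" for n
  proof -
    have "g 0 \<in> M" "deg (g 0) = 0"
      using gM[of 0] by auto
    then show ?thesis
      using h[of 0 n] that src_vertex[of "g 0"] rng_vertex[of "g 0"] by (simp add: vertices_def le_fun_def)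
  qed
  have h0: "h 0 n = g n" if "enats n \<le> m" for n
  proof (rule h_unique)
    have "g 0 \<in> M" "deg (g 0) = 0"
      using gM[of 0] by auto
    then show "g n = g 0 \<cdot> g n"
      using g0[OF that] gM[OF that] src_vertex[of "g 0"] by (simp add: vertices_def) (metis cmp_rg)
  qed (use that gM g0 in \<open>auto simp: le_fun_def\<close>)
  have "deg_functor (Omega m) \<Lambda> (snd x)"
    unfolding deg_functor_def
  proof (intro conjI ballI impI)
    fix \<alpha> assume "\<alpha> \<in> Mor (Omega m)"
    then obtain p q where \<alpha>: "\<alpha> = (p, q)" "p \<le> q" "enats q \<le> m"
      by (auto simp: Omega_def)
    have "enats p \<le> m"
      using \<alpha> enats_mono by blast
    then show "snd x \<alpha> \<in> M" "rng (snd x \<alpha>) = snd x (rg (Omega m) \<alpha>)"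
      "src (snd x \<alpha>) = snd x (sr (Omega m) \<alpha>)" "deg (snd x \<alpha>) = dg (Omega m) \<alpha>"
      using \<alpha> seg[of p q] seg[of p p] seg[of q q] h[of p q] hid hsrc[of p q] hdeg[of p q]
      by (simp_all add: Omega_def)
    fix \<beta> assume "\<beta> \<in> Mor (Omega m)" "sr (Omega m) \<alpha> = rg (Omega m) \<beta>"
    then obtain t where \<beta>: "\<beta> = (q, t)" "q \<le> t" "enats t \<le> m"
      using \<alpha> by (auto simp: Omega_def)
    then show "snd x (cmp (Omega m) \<alpha> \<beta>) = snd x \<alpha> \<cdot> snd x \<beta>"
      using \<alpha> seg[of p q] seg[of q t] seg[of p t] hcmp[of p q t] by (simp add: Omega_def)
  qed
  moreover have "snd x \<in> extensional (Mor (Omega m))"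
    by (simp add: x_def)
  moreover have "\<exists>e\<in>E. enats (n + deg e) \<le> m \<and> bseg x n (n + deg e) = e"
    if n: "enats n \<le> m" "E \<in> FE \<Lambda> (bvert x n)" for n E
  proof -
    have E: "E \<in> FE \<Lambda> (src (g n))"
      using n seg[of n n] hid by simp
    then obtain e where e: "e \<in> E" "g n \<cdot> e \<in> X"
      using tight_FE[OF X] gM n by blast
    then have "e \<in> M" "rng e = src (g n)"
      using E gM[OF n(1)] by (auto simp: FE_iff)
    then have deg: "deg (g n \<cdot> e) = n + deg e"
      using gM n by simp
    then have le: "enats (n + deg e) \<le> m"
      using e m by blast
    moreover have "g (n + deg e) = g n \<cdot> e"
      using g_unique[OF e(2)] deg by simp
    then have "h n (n + deg e) = e"
      using le \<open>e \<in> M\<close> \<open>rng e = src (g n)\<close> by (intro h_unique) (auto simp: le_fun_def)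
    ultimately show ?thesis
      using e seg[of n "n + deg e"] by (intro bexI[of _ e]) (auto simp: le_fun_def)
  qed
  ultimately have "x \<in> boundary \<Lambda>"
    by (auto simp: boundary_def)
  moreover have "filt x = X"
  proof -
    have "bseg x 0 n = g n" if "enats n \<le> m" for n
      using seg[of 0 n] h0 that by simp
    then have "filt x = {g n | n. enats n \<le> m}"
      unfolding filt_def by force
    also have "\<dots> = X"
      using gM g_unique m by auto metis
    finally show ?thesis .
  qed
  ultimately show ?thesis
    using that by blast
qed

end

context fa_kgraph
begin

section \<open>Prepending a path to a boundary path\<close>

lemma is_bcons_iff:
  assumes \<xi>: "\<xi> \<in> M" and x: "x \<in> boundary \<Lambda>" and src: "src \<xi> = bvert x 0"
  shows "is_bcons \<Lambda> \<xi> x y \<longleftrightarrow> y \<in> boundary \<Lambda> \<and> filt y = prepend \<xi> (filt x)"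
proof
  have X: "tight (filt x)" "src \<xi> \<in> filt x"
    using tight_filt x filt_vertex src by auto
  have rng: "rng (bseg x 0 n) = src \<xi>" if "enats n \<le> bdeg x" for n
    using boundary_seg(2)[OF x _ that, of 0] src by (simp add: le_fun_def)
  have bM: "bseg x 0 n \<in> M" if "enats n \<le> bdeg x" for n
    using boundary_seg(1)[OF x _ that, of 0] by (simp add: le_fun_def)
  have le_add: "n \<le> deg \<xi> + (n - deg \<xi>)" for n
    by (auto simp: le_fun_def)
  \<comment> \<open>Truncated subtraction is what is wanted here: a coordinate of \<open>n\<close>
    below that of \<open>deg \<xi>\<close> is covered by \<xi> and imposes no condition on
    \<open>x\<close>. Segments of \<xi>x whose degree is not comparable with
    \<open>deg \<xi>\<close> are handled in this way.\<close>
  have add: "enats n \<le> enats (deg \<xi>) + bdeg x \<longleftrightarrow> enats (n - deg \<xi>) \<le> bdeg x" for n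
  proof -
    have "enat a \<le> enat b + c \<longleftrightarrow> enat (a - b) \<le> c" for a b c
      by (cases c) auto
    then show ?thesis
      unfolding enats_le_iff by (simp add: enats_def)
  qed
  {
    assume "is_bcons \<Lambda> \<xi> x y"
    then have y: "y \<in> boundary \<Lambda>" and bdeg: "bdeg y = enats (deg \<xi>) + bdeg x"
      and y0: "bseg y 0 (deg \<xi>) = \<xi>"
      and seg: "\<And>p q. p \<le> q \<Longrightarrow> enats q \<le> bdeg x \<Longrightarrow> bseg y (deg \<xi> + p) (deg \<xi> + q) = bseg x p q"
      by (auto simp: is_bcons_def)
    have yn: "bseg y 0 (deg \<xi> + n) = \<xi> \<cdot> bseg x 0 n" "enats (deg \<xi> + n) \<le> bdeg y"
      if n: "enats n \<le> bdeg x" for n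
    proof -
      show *: "enats (deg \<xi> + n) \<le> bdeg y"
        using add[of "deg \<xi> + n"] n bdeg by simp
      show "bseg y 0 (deg \<xi> + n) = \<xi> \<cdot> bseg x 0 n"
        using boundary_cmp[OF y _ _ *, of 0 "deg \<xi>"] y0 seg[of 0 n] n by (simp add: le_fun_def)
    qed
    have "filt y = prepend \<xi> (filt x)"
    proof (intro equalityI subsetI)
      fix \<beta> assume "\<beta> \<in> filt y"
      then obtain n where n: "\<beta> = bseg y 0 n" "enats n \<le> bdeg y"
        by (auto simp: filt_def)
      then have q: "enats (n - deg \<xi>) \<le> bdeg x"
        using add bdeg by simp
      have "\<beta> \<preceq> \<xi> \<cdot> bseg x 0 (n - deg \<xi>)"
        using boundary_prefix[OF y _ yn(2)[OF q], of n] yn(1)[OF q] n le_add by simp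
      then show "\<beta> \<in> prepend \<xi> (filt x)"
        using bseg_filt[OF x q] by (auto simp: prepend_def)
    next
      fix \<beta> assume "\<beta> \<in> prepend \<xi> (filt x)"
      then obtain n where "\<beta> \<preceq> \<xi> \<cdot> bseg x 0 n" "enats n \<le> bdeg x"
        by (auto simp: prepend_def filt_def)
      then show "\<beta> \<in> filt y"
        using yn[of n] bseg_filt[OF y, of "deg \<xi> + n"] tight_prefix[OF tight_filt[OF y]] by simp
    qed
    with y show "y \<in> boundary \<Lambda> \<and> filt y = prepend \<xi> (filt x)"
      by simp
  }
  assume "y \<in> boundary \<Lambda> \<and> filt y = prepend \<xi> (filt x)"
  then have y: "y \<in> boundary \<Lambda>" and fy: "filt y = prepend \<xi> (filt x)"
    by auto
  have "enats n \<le> bdeg y \<longleftrightarrow> enats (n - deg \<xi>) \<le> bdeg x" for n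
  proof
    assume "enats n \<le> bdeg y"
    then obtain \<beta> where "\<beta> \<in> filt y" "deg \<beta> = n"
      using filt_degrees y by blast
    then obtain q where q: "\<beta> \<preceq> \<xi> \<cdot> bseg x 0 q" "enats q \<le> bdeg x"
      unfolding fy by (auto simp: prepend_def filt_def)
    then have "n \<le> deg \<xi> + q"
      using prefix_deg[OF q(1)] \<open>deg \<beta> = n\<close> \<xi> x bM[OF q(2)] rng[OF q(2)] by simp
    then have "n - deg \<xi> \<le> q"
      by (auto simp: le_fun_def fun_diff_def le_diff_conv add.commute)
    then show "enats (n - deg \<xi>) \<le> bdeg x"
      using q(2) enats_mono by blast
  next
    assume q: "enats (n - deg \<xi>) \<le> bdeg x"
    have "\<xi> \<cdot> bseg x 0 (n - deg \<xi>) \<in> filt y"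
      unfolding fy using prependI[OF \<xi> X] bseg_filt[OF x q] by simp
    then have "enats (deg \<xi> + (n - deg \<xi>)) \<le> bdeg y"
      using filt_degrees[OF y, of "deg \<xi> + (n - deg \<xi>)"] \<xi> x bM[OF q] rng[OF q] q
      by (intro iffD2[OF filt_degrees[OF y]]) (auto intro!: bexI[of _ "\<xi> \<cdot> bseg x 0 (n - deg \<xi>)"])
    then show "enats n \<le> bdeg y"
      using enats_mono le_add by blast
  qed
  then have bdeg: "bdeg y = enats (deg \<xi>) + bdeg x"
    using add by (intro enats_ext) simp
  have yn: "bseg y 0 (deg \<xi> + n) = \<xi> \<cdot> bseg x 0 n" if n: "enats n \<le> bdeg x" for n
  proof -
    have "\<xi> \<cdot> bseg x 0 n \<in> filt y"
      unfolding fy using prependI[OF \<xi> X] bseg_filt[OF x n] by simp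
    then show ?thesis
      using filt_iff[OF y, of "\<xi> \<cdot> bseg x 0 n"] \<xi> x bM[OF n] rng[OF n] n by simp
  qed
  have "\<xi> \<in> filt y"
    unfolding fy using prepend_self[OF \<xi> X] .
  then have "bseg y 0 (deg \<xi>) = \<xi>"
    using filt_iff[OF y] by simp
  moreover have "bseg y (deg \<xi> + p) (deg \<xi> + q) = bseg x p q" if pq: "p \<le> q" "enats q \<le> bdeg x" for p q
  proof (rule bseg_eqI[OF y])
    have p: "enats p \<le> bdeg x"
      using enats_mono[OF pq] .
    note S = boundary_seg[OF x pq]
    have srcp: "src (bseg x 0 p) = bvert x p"
      using boundary_seg(3)[OF x _ p, of 0] by (simp add: le_fun_def)
    show "deg \<xi> + p \<le> deg \<xi> + q"
      using pq by (simp add: le_fun_def)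
    show "enats (deg \<xi> + q) \<le> bdeg y"
      using add[of "deg \<xi> + q"] pq bdeg by simp
    show "bseg x p q \<in> M"
      using S by simp
    show "src (bseg y 0 (deg \<xi> + p)) = rng (bseg x p q)"
      using yn[OF p] \<xi> bM[OF p] rng[OF p] S srcp by simp
    show "bseg y 0 (deg \<xi> + q) = bseg y 0 (deg \<xi> + p) \<cdot> bseg x p q"
      using yn[OF p] yn[OF pq(2)] boundary_cmp[OF x _ pq, of 0] \<xi> bM[OF p] rng[OF p] S srcp
      by (simp add: le_fun_def cmp_assoc)
  qed
  ultimately show "is_bcons \<Lambda> \<xi> x y"
    using y bdeg by (simp add: is_bcons_def)
qed

text \<open>Existence comes from \<open>tight_prepend\<close> and \<open>filt_surj\<close>,
  uniqueness from \<open>filt_inject\<close>; so the description in \<open>bcons\<close>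
  denotes.\<close>

lemma bcons_filt:
  assumes \<xi>: "\<xi> \<in> M" and x: "x \<in> boundary \<Lambda>" and src: "src \<xi> = bvert x 0"
  shows "bcons \<Lambda> \<xi> x \<in> boundary \<Lambda>" "filt (bcons \<Lambda> \<xi> x) = prepend \<xi> (filt x)"
proof -
  have "tight (prepend \<xi> (filt x))"
    using tight_prepend[OF \<xi> tight_filt[OF x]] filt_vertex[OF x] src by simp
  then obtain y where y: "y \<in> boundary \<Lambda>" "filt y = prepend \<xi> (filt x)"
    by (metis filt_surj)
  then have "bcons \<Lambda> \<xi> x = y"
    unfolding bcons_def is_bcons_iff[OF assms] using filt_inject by (intro the_equality) auto
  with y show "bcons \<Lambda> \<xi> x \<in> boundary \<Lambda>" "filt (bcons \<Lambda> \<xi> x) = prepend \<xi> (filt x)"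
    by auto
qed

lemma bvert_0_iff: "x \<in> boundary \<Lambda> \<Longrightarrow> v \<in> vertices \<Lambda> \<Longrightarrow> bvert x 0 = v \<longleftrightarrow> v \<in> filt x"
  using filt_vertex filt_iff[of x v] by (auto simp: vertices_def)

section \<open>Aperiodicity and cofinality in terms of tight filters\<close>

theorem aperiodic_iff_separable: "aperiodic_kgraph \<Lambda> \<longleftrightarrow> separable"
proof -
  define Q where "Q = (\<lambda>v X. \<forall>\<xi>\<in>M. \<forall>\<mu>\<in>M. src \<xi> = v \<and> src \<mu> = v \<and> \<xi> \<noteq> \<mu> \<longrightarrow>
    prepend \<xi> X \<noteq> prepend \<mu> X)"
  have Q: "aperiodic_path \<Lambda> x \<longleftrightarrow> Q (bvert x 0) (filt x)" if x: "x \<in> boundary \<Lambda>" for x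
  proof -
    have "bcons \<Lambda> \<xi> x = bcons \<Lambda> \<mu> x \<longleftrightarrow> prepend \<xi> (filt x) = prepend \<mu> (filt x)"
      if "\<xi> \<in> M" "\<mu> \<in> M" "src \<xi> = bvert x 0" "src \<mu> = bvert x 0" for \<xi> \<mu>
      using bcons_filt[OF that(1) x that(3)] bcons_filt[OF that(2) x that(4)] filt_inject by metis
    then show ?thesis
      using x by (auto simp: aperiodic_path_def paths_from_def Q_def)
  qed
  have "(\<exists>x. aperiodic_path \<Lambda> x \<and> bvert x 0 = v) \<longleftrightarrow> (\<exists>X. tight X \<and> v \<in> X \<and> Q v X)"
    if v: "v \<in> vertices \<Lambda>" for v
  proof
    assume "\<exists>x. aperiodic_path \<Lambda> x \<and> bvert x 0 = v"
    then obtain x where x: "aperiodic_path \<Lambda> x" "bvert x 0 = v" "x \<in> boundary \<Lambda>"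
      by (auto simp: aperiodic_path_def)
    then show "\<exists>X. tight X \<and> v \<in> X \<and> Q v X"
      using Q tight_filt bvert_0_iff[OF x(3) v] by blast
  next
    assume "\<exists>X. tight X \<and> v \<in> X \<and> Q v X"
    then obtain x where "x \<in> boundary \<Lambda>" "v \<in> filt x" "Q v (filt x)"
      using filt_surj by metis
    then show "\<exists>x. aperiodic_path \<Lambda> x \<and> bvert x 0 = v"
      using Q bvert_0_iff v by blast
  qed
  then show ?thesis
    unfolding aperiodic_kgraph_def separable_iff Q_def by simp
qed

theorem cofinal_iff:
  "cofinal_kgraph \<Lambda> \<longleftrightarrow> (\<forall>v\<in>vertices \<Lambda>. \<forall>X. tight X \<longrightarrow>
     (\<exists>\<alpha>\<in>X. \<exists>\<kappa>\<in>M. rng \<kappa> = v \<and> src \<kappa> = src \<alpha>))"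
proof -
  have "(\<exists>n. enats n \<le> bdeg x \<and> paths_to \<Lambda> v \<inter> paths_from \<Lambda> (bvert x n) \<noteq> {}) \<longleftrightarrow>
    (\<exists>\<alpha>\<in>filt x. \<exists>\<kappa>\<in>M. rng \<kappa> = v \<and> src \<kappa> = src \<alpha>)" if x: "x \<in> boundary \<Lambda>" for x v
  proof -
    have "src (bseg x 0 n) = bvert x n" if "enats n \<le> bdeg x" for n
      using boundary_seg(3)[OF x _ that, of 0] by (simp add: le_fun_def)
    then have "(\<exists>\<alpha>\<in>filt x. P (src \<alpha>)) \<longleftrightarrow> (\<exists>n. enats n \<le> bdeg x \<and> P (bvert x n))" for P
      unfolding filt_def by force
    from this[of "\<lambda>w. \<exists>\<kappa>\<in>M. rng \<kappa> = v \<and> src \<kappa> = w"]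
    have "(\<exists>n. enats n \<le> bdeg x \<and> (\<exists>\<kappa>\<in>M. rng \<kappa> = v \<and> src \<kappa> = bvert x n)) \<longleftrightarrow>
      (\<exists>\<alpha>\<in>filt x. \<exists>\<kappa>\<in>M. rng \<kappa> = v \<and> src \<kappa> = src \<alpha>)"
      by simp
    moreover have "paths_to \<Lambda> v \<inter> paths_from \<Lambda> w \<noteq> {} \<longleftrightarrow> (\<exists>\<kappa>\<in>M. rng \<kappa> = v \<and> src \<kappa> = w)" for w
      by (auto simp: paths_to_def paths_from_def)
    ultimately show ?thesis
      by simp
  qed
  then have "cofinal_kgraph \<Lambda> \<longleftrightarrow> (\<forall>v\<in>vertices \<Lambda>. \<forall>X\<in>filt ` boundary \<Lambda>.
      \<exists>\<alpha>\<in>X. \<exists>\<kappa>\<in>M. rng \<kappa> = v \<and> src \<kappa> = src \<alpha>)"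
    by (simp add: cofinal_kgraph_def)
  moreover have "filt ` boundary \<Lambda> = {X. tight X}"
    using tight_filt by (auto elim: filt_surj)
  ultimately show ?thesis
    by simp
qed

end

section \<open>Ideals of the free algebra\<close>

lemma poly_mapping_expand:
  fixes f :: "'w \<Rightarrow>\<^sub>0 'b::comm_monoid_add"
  shows "f = (\<Sum>w\<in>Poly_Mapping.keys f. Poly_Mapping.single w (Poly_Mapping.lookup f w))"
proof (rule poly_mapping_eqI)
  fix k
  show "Poly_Mapping.lookup f k =
    Poly_Mapping.lookup (\<Sum>w\<in>Poly_Mapping.keys f. Poly_Mapping.single w (Poly_Mapping.lookup f w)) k"
    by (simp add: lookup_sum lookup_single when_def sum.delta in_keys_iff)
qed

lemma poly_mapping_additive_induct [case_names zero single add]: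
  fixes f :: "'w \<Rightarrow>\<^sub>0 'b::comm_monoid_add"
  assumes "P 0" "\<And>w c. P (Poly_Mapping.single w c)" "\<And>f g. P f \<Longrightarrow> P g \<Longrightarrow> P (f + g)"
  shows "P f"
proof -
  have "P (\<Sum>w\<in>S. Poly_Mapping.single w (Poly_Mapping.lookup f w))" if "finite S" for S
    using that by induction (auto intro: assms)
  then show ?thesis
    by (subst poly_mapping_expand) simp
qed

definition lin :: "('w \<Rightarrow> 'r) \<Rightarrow> ('w \<Rightarrow>\<^sub>0 'r::comm_ring_1) \<Rightarrow> 'r" where
  "lin T f = (\<Sum>w\<in>Poly_Mapping.keys f. Poly_Mapping.lookup f w * T w)"

lemma lin_superset:
  assumes "finite S" "Poly_Mapping.keys f \<subseteq> S"
  shows "lin T f = (\<Sum>w\<in>S. Poly_Mapping.lookup f w * T w)"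
  unfolding lin_def using assms by (intro sum.mono_neutral_left) (auto simp: in_keys_iff)

lemma lin_add [simp]: "lin T (f + g) = lin T f + lin T g"
proof -
  let ?S = "Poly_Mapping.keys f \<union> Poly_Mapping.keys g"
  have "Poly_Mapping.keys (f + g) \<subseteq> ?S"
    by (rule keys_add)
  then show ?thesis
    by (simp add: lin_superset[of ?S] lookup_add algebra_simps sum.distrib)
qed

lemma lin_zero [simp]: "lin T 0 = 0"
  by (simp add: lin_def)

lemma lin_single [simp]: "lin T (Poly_Mapping.single w c) = c * T w"
  by (simp add: lin_def)

lemma lin_uminus [simp]: "lin T (- f) = - lin T f"
proof -
  have "Poly_Mapping.keys (- f) = Poly_Mapping.keys f"
    by (auto simp: in_keys_iff)
  then show ?thesis
    by (simp add: lin_def sum_negf)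
qed

lemma lin_diff [simp]: "lin T (f - g) = lin T f - lin T g"
  using lin_add[of T f "- g"] by simp

lemma lin_sum [simp]: "lin T (\<Sum>i\<in>I. f i) = (\<Sum>i\<in>I. lin T (f i))"
  by (induction I rule: infinite_finite_induct) auto

abbreviation scal :: "'r \<Rightarrow> 'g word \<Rightarrow>\<^sub>0 'r::comm_ring_1" where
  "scal \<equiv> Poly_Mapping.single 0"

lemma scal_commute: "scal c * f = f * scal c"
  by (induction f rule: poly_mapping_additive_induct) (auto simp: mult_single algebra_simps)

lemma scal_left_commute: "f * (scal c * g) = scal c * (f * g)"
  by (simp only: mult.assoc[symmetric] scal_commute[of c f])

lemma smult_eq_scal: "Poly_Mapping.map ((*) a) f = scal a * f"
  by (rule mult_map_scale_conv_mult)

lemma scal_1 [simp]: "scal 1 = 1"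
  by simp

lemma letters_add [simp]: "letters (u + v) = letters u @ letters v"
  by (simp add: plus_word_def)

lemma letters_zero [simp]: "letters 0 = []"
  by (simp add: zero_word_def)

lemma letters_eq_Nil [simp]: "letters w = [] \<longleftrightarrow> w = 0"
  by (cases w) (simp add: zero_word_def)

text \<open>A retraction of the unital free algebra on the whole type onto the words in
  \<open>X\<close>, the empty word included. It is multiplicative because a concatenation has all
  its letters in \<open>X\<close> exactly if both parts do.\<close>

definition proj :: "'g set \<Rightarrow> ('g word \<Rightarrow>\<^sub>0 'r) \<Rightarrow> 'g word \<Rightarrow>\<^sub>0 'r::comm_ring_1" where
  "proj X f = (\<Sum>w\<in>{w \<in> Poly_Mapping.keys f. set (letters w) \<subseteq> X}.
     Poly_Mapping.single w (Poly_Mapping.lookup f w))"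

lemma lookup_proj:
  "Poly_Mapping.lookup (proj X f) w = (if set (letters w) \<subseteq> X then Poly_Mapping.lookup f w else 0)"
  by (auto simp: proj_def lookup_sum lookup_single when_def sum.delta in_keys_iff)

lemma proj_add: "proj X (f + g) = proj X f + proj X g"
  by (rule poly_mapping_eqI) (simp add: lookup_proj lookup_add)

lemma proj_zero [simp]: "proj X 0 = 0"
  by (simp add: proj_def)

lemma proj_single:
  "proj X (Poly_Mapping.single w c) = (if set (letters w) \<subseteq> X then Poly_Mapping.single w c else 0)"
  by (rule poly_mapping_eqI) (auto simp: lookup_proj lookup_single when_def)

lemma proj_mult: "proj X (f * g) = proj X f * proj X g"
proof (induction f rule: poly_mapping_additive_induct)
  case (single w c)
  show ?case
    by (induction g rule: poly_mapping_additive_induct)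
      (auto simp: proj_single mult_single proj_add distrib_left)
qed (simp_all add: proj_add distrib_right)

section \<open>Ideals of the unital ring and of the free algebra without unit\<close>

definition two_sided :: "'b::ring_1 set \<Rightarrow> bool" where
  "two_sided J \<longleftrightarrow> 0 \<in> J \<and> (\<forall>a\<in>J. \<forall>b\<in>J. a + b \<in> J) \<and> (\<forall>a\<in>J. \<forall>x. x * a \<in> J \<and> a * x \<in> J)"

lemma two_sidedD:
  assumes "two_sided J"
  shows "0 \<in> J" "a \<in> J \<Longrightarrow> b \<in> J \<Longrightarrow> a + b \<in> J" "a \<in> J \<Longrightarrow> x * a \<in> J" "a \<in> J \<Longrightarrow> a * x \<in> J"
    "a \<in> J \<Longrightarrow> - a \<in> J" "a \<in> J \<Longrightarrow> b \<in> J \<Longrightarrow> a - b \<in> J"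
proof -
  show min: "- a \<in> J" if "a \<in> J" for a
    using assms that unfolding two_sided_def by (metis mult_minus1)
  show "0 \<in> J" "a \<in> J \<Longrightarrow> b \<in> J \<Longrightarrow> a + b \<in> J" "a \<in> J \<Longrightarrow> x * a \<in> J" "a \<in> J \<Longrightarrow> a * x \<in> J"
    using assms by (auto simp: two_sided_def)
  show "a \<in> J \<Longrightarrow> b \<in> J \<Longrightarrow> a - b \<in> J"
    using assms min unfolding two_sided_def by (metis diff_conv_add_uminus)
qed

abbreviation fcarrier :: "'g set \<Rightarrow> ('g word \<Rightarrow>\<^sub>0 'r::comm_ring_1) set" where
  "fcarrier X \<equiv> carrier (free_algebra X)"

lemma free_algebra_simps [simp]:
  "mult (free_algebra X) = (*)" "zero (free_algebra X) = 0" "add (free_algebra X) = (+)"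
  "smult (free_algebra X) a f = scal a * f"
  by (simp_all add: free_algebra_def smult_eq_scal)

lemma fcarrier_iff:
  "f \<in> fcarrier X \<longleftrightarrow> (\<forall>w\<in>Poly_Mapping.keys f. w \<noteq> 0 \<and> set (letters w) \<subseteq> X)"
  by (simp add: free_algebra_def)

lemma fcarrier_zero [simp]: "0 \<in> fcarrier X"
  by (simp add: fcarrier_iff)

lemma fcarrier_add [intro]: "f \<in> fcarrier X \<Longrightarrow> g \<in> fcarrier X \<Longrightarrow> f + g \<in> fcarrier X"
  using keys_add[of f g] by (auto simp: fcarrier_iff)

lemma fcarrier_uminus [intro]: "f \<in> fcarrier X \<Longrightarrow> - f \<in> fcarrier X"
  by (auto simp: fcarrier_iff in_keys_iff)

lemma fcarrier_diff [intro]: "f \<in> fcarrier X \<Longrightarrow> g \<in> fcarrier X \<Longrightarrow> f - g \<in> fcarrier X"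
  using fcarrier_add[of f X "- g"] by auto

lemma fcarrier_mult [intro]: "f \<in> fcarrier X \<Longrightarrow> g \<in> fcarrier X \<Longrightarrow> f * g \<in> fcarrier X"
  using keys_mult[of f g] by (fastforce simp: fcarrier_iff simp flip: letters_eq_Nil)

lemma fcarrier_scal [intro]: "f \<in> fcarrier X \<Longrightarrow> scal c * f \<in> fcarrier X"
proof -
  assume f: "f \<in> fcarrier X"
  have "Poly_Mapping.keys (scal c * f) \<subseteq> Poly_Mapping.keys f"
    using keys_mult[of "scal c" f] by (auto split: if_splits)
  then show ?thesis
    using f by (auto simp: fcarrier_iff)
qed

lemma fcarrier_sum [intro]: "(\<And>i. i \<in> I \<Longrightarrow> f i \<in> fcarrier X) \<Longrightarrow> (\<Sum>i\<in>I. f i) \<in> fcarrier X"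
  by (induction I rule: infinite_finite_induct) auto

lemma fcarrier_gen [intro]: "g \<in> X \<Longrightarrow> gen g \<in> fcarrier X"
  by (auto simp: gen_def fcarrier_iff zero_word_def)

lemma fcarrier_list_prod:
  assumes "xs \<noteq> []" "set xs \<subseteq> fcarrier X"
  shows "list_prod (*) xs \<in> fcarrier X"
proof -
  have "foldr (*) ys z \<in> fcarrier X" if "set ys \<subseteq> fcarrier X" "z \<in> fcarrier X" for ys z
    using that by (induction ys) auto
  moreover have "set (butlast xs) \<subseteq> fcarrier X" "last xs \<in> fcarrier X"
    using assms by (auto dest: in_set_butlastD)
  ultimately show ?thesis
    by (simp add: list_prod_def)
qed

lemma proj_fcarrier: "f \<in> fcarrier X \<Longrightarrow> proj X f = f"
  by (rule poly_mapping_eqI) (auto simp: lookup_proj fcarrier_iff in_keys_iff)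

definition fideal :: "'g set \<Rightarrow> ('g word \<Rightarrow>\<^sub>0 'r::comm_ring_1) set \<Rightarrow> bool" where
  "fideal X J \<longleftrightarrow> J \<subseteq> fcarrier X \<and> 0 \<in> J \<and> (\<forall>a\<in>J. \<forall>b\<in>J. a + b \<in> J) \<and>
     (\<forall>a\<in>J. \<forall>x\<in>fcarrier X. a * x \<in> J \<and> x * a \<in> J) \<and> (\<forall>c. \<forall>a\<in>J. scal c * a \<in> J)"

lemma fidealD:
  assumes "fideal X J"
  shows "a \<in> J \<Longrightarrow> a \<in> fcarrier X" "0 \<in> J" "a \<in> J \<Longrightarrow> b \<in> J \<Longrightarrow> a + b \<in> J"
    "a \<in> J \<Longrightarrow> x \<in> fcarrier X \<Longrightarrow> a * x \<in> J" "a \<in> J \<Longrightarrow> x \<in> fcarrier X \<Longrightarrow> x * a \<in> J"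
    "a \<in> J \<Longrightarrow> scal c * a \<in> J" "a \<in> J \<Longrightarrow> - a \<in> J" "a \<in> J \<Longrightarrow> b \<in> J \<Longrightarrow> a - b \<in> J"
proof -
  show min: "- a \<in> J" if "a \<in> J" for a
    using assms that unfolding fideal_def by (metis mult_minus1 scal_1 single_uminus)
  show "a \<in> J \<Longrightarrow> b \<in> J \<Longrightarrow> a - b \<in> J"
    using assms min unfolding fideal_def by (metis diff_conv_add_uminus)
qed (use assms in \<open>auto simp: fideal_def\<close>)

lemma algebra_ideal_free: "algebra_ideal J (free_algebra X) \<longleftrightarrow> fideal X J"
proof
  assume J: "algebra_ideal J (free_algebra X)"
  then interpret additive_subgroup J "free_algebra X"
    by (simp add: algebra_ideal_def)
  show "fideal X J"
    using J a_subset zero_closed a_closed by (auto simp: fideal_def algebra_ideal_def)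
next
  assume J: "fideal X J"
  have inv: "inv\<^bsub>add_monoid (free_algebra X)\<^esub> a = - a" if "a \<in> fcarrier X" for a
    unfolding m_inv_def using that
    by (intro the_equality) (auto simp: eq_neg_iff_add_eq_0 add.commute)
  have "subgroup J (add_monoid (free_algebra X))"
  proof
    show "inv\<^bsub>add_monoid (free_algebra X)\<^esub> a \<in> J" if "a \<in> J" for a
      unfolding inv[OF fidealD(1)[OF J that]] using fidealD(7)[OF J that] .
  qed (use fidealD[OF J] in auto)
  then show "algebra_ideal J (free_algebra X)"
    using fidealD[OF J] by (auto simp: algebra_ideal_def intro: additive_subgroup.intro)
qed

text \<open>An ideal of the non-unital algebra thereby becomes an ideal of an ordinary ring, where 1
  is available and products need no carrier conditions.\<close>

lemma two_sided_proj:
  assumes "fideal X J"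
  shows "two_sided {f. proj X f \<in> J}"
proof -
  note J = fidealD[OF assms]
  have "proj X x * a \<in> J \<and> a * proj X x \<in> J" if "a \<in> J" for a x
  proof -
    \<comment> \<open>Removing the coefficient at the empty word puts \<open>proj X x\<close> into
      the non-unital algebra; the removed part is a scalar, which \<open>J\<close> absorbs
      too.\<close>
    define x' where "x' = proj X x - scal (Poly_Mapping.lookup x 0)"
    have "x' \<in> fcarrier X"
      by (auto simp: x'_def fcarrier_iff in_keys_iff lookup_minus lookup_proj lookup_single when_def
          split: if_splits)
    then have "x' * a \<in> J" "a * x' \<in> J"
      using J that by auto
    moreover have "scal (Poly_Mapping.lookup x 0) * a \<in> J"
      using J that by auto
    moreover have "proj X x = x' + scal (Poly_Mapping.lookup x 0)"
      by (simp add: x'_def)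
    ultimately show ?thesis
      using J(3) by (simp add: distrib_left distrib_right scal_commute[symmetric])
  qed
  then show ?thesis
    using J by (auto simp: two_sided_def proj_add proj_mult)
qed

section \<open>Quotients of the free algebra\<close>

context
  fixes X :: "'g set" and K :: "('g word \<Rightarrow>\<^sub>0 'r::comm_ring_1) set"
  assumes K: "fideal X K"
begin

definition coset :: "('g word \<Rightarrow>\<^sub>0 'r) \<Rightarrow> ('g word \<Rightarrow>\<^sub>0 'r) set" where
  "coset f = K +>\<^bsub>free_algebra X\<^esub> f"

abbreviation quot :: "('r, ('g word \<Rightarrow>\<^sub>0 'r) set) module" where
  "quot \<equiv> quotient_algebra (free_algebra X) K"

lemma coset_iff: "g \<in> coset f \<longleftrightarrow> g - f \<in> K"
  unfolding coset_def a_r_coset_def' by (force simp: algebra_simps)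

lemma coset_eq_iff: "coset f = coset g \<longleftrightarrow> f - g \<in> K"
proof
  assume "coset f = coset g"
  then show "f - g \<in> K"
    using coset_iff fidealD(2)[OF K] by (metis diff_self)
next
  assume fg: "f - g \<in> K"
  have "h - f \<in> K \<longleftrightarrow> h - g \<in> K" for h
    using fidealD(3)[OF K, of "h - f" "f - g"] fidealD(8)[OF K, of "h - g" "f - g"] fg by auto
  then show "coset f = coset g"
    using coset_iff by auto
qed

lemma quot_carrier: "carrier quot = coset ` fcarrier X"
  by (auto simp: quotient_algebra_def A_RCOSETS_def' coset_def)

lemma quot_zero: "zero quot = coset 0"
  using coset_iff by (auto simp: quotient_algebra_def)

lemma quot_add: "coset f \<oplus>\<^bsub>quot\<^esub> coset g = coset (f + g)"
proof (intro equalityI subsetI)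
  fix h assume "h \<in> coset f \<oplus>\<^bsub>quot\<^esub> coset g"
  then obtain a b where "a - f \<in> K" "b - g \<in> K" "h = a + b"
    by (auto simp: quotient_algebra_def set_add_def' coset_iff)
  then show "h \<in> coset (f + g)"
    using fidealD(3)[OF K, of "a - f" "b - g"] by (simp add: coset_iff algebra_simps)
next
  fix h assume "h \<in> coset (f + g)"
  then have "h - g \<in> coset f" "g \<in> coset g" "h = (h - g) + g"
    using fidealD(2)[OF K] by (auto simp: coset_iff algebra_simps)
  then show "h \<in> coset f \<oplus>\<^bsub>quot\<^esub> coset g"
    unfolding quotient_algebra_def set_add_def'
    by simp (intro bexI[of _ "h - g"] bexI[of _ g], auto)
qed

lemma quot_mult:
  assumes "f \<in> fcarrier X" "g \<in> fcarrier X"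
  shows "coset f \<otimes>\<^bsub>quot\<^esub> coset g = coset (f * g)"
proof -
  have "coset (a * b) = coset (f * g)" if "a \<in> coset f" "b \<in> coset g" for a b
  proof -
    have *: "a - f \<in> K" "b - g \<in> K"
      using that coset_iff by auto
    then have "b \<in> fcarrier X"
      using fidealD(1)[OF K] assms fcarrier_add[of "b - g" X g] by simp
    \<comment> \<open>This sum telescopes to \<open>a * b - f * g\<close>.\<close>
    then have "(a - f) * b + f * (b - g) \<in> K"
      using * assms by (intro fidealD(3)[OF K] fidealD(4,5)[OF K])
    then show ?thesis
      by (simp add: coset_eq_iff algebra_simps)
  qed
  moreover have "f \<in> coset f" "g \<in> coset g"
    using fidealD(2)[OF K] by (auto simp: coset_iff)
  ultimately have "(\<Union>a\<in>coset f. \<Union>b\<in>coset g. coset (a * b)) = coset (f * g)"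
    by blast
  then show ?thesis
    by (simp add: quotient_algebra_def rcoset_mult_def coset_def)
qed

lemma quot_smult: "a \<odot>\<^bsub>quot\<^esub> coset f = coset (scal a * f)"
proof -
  have "coset (scal a * g) = coset (scal a * f)" if "g \<in> coset f" for g
    using that fidealD(6)[OF K, of "g - f" a] by (simp add: coset_eq_iff coset_iff algebra_simps)
  moreover have "f \<in> coset f"
    using fidealD(2)[OF K] by (auto simp: coset_iff)
  ultimately have "(\<Union>g\<in>coset f. coset (scal a * g)) = coset (scal a * f)"
    by blast
  then show ?thesis
    by (simp add: quotient_algebra_def coset_def)
qed

section \<open>Correspondence between ideals of the quotient and ideals containing
  \<open>K\<close>\<close>

lemma ideal_quotD:
  assumes I: "algebra_ideal I quot"
  shows "fideal X {f \<in> fcarrier X. coset f \<in> I}" "K \<subseteq> {f \<in> fcarrier X. coset f \<in> I}"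
    "coset ` {f \<in> fcarrier X. coset f \<in> I} = I"
proof -
  interpret additive_subgroup I quot
    using I by (simp add: algebra_ideal_def)
  have I0: "coset 0 \<in> I"
    using zero_closed quot_zero by simp
  have sub: "I \<subseteq> coset ` fcarrier X"
    using a_subset quot_carrier by simp
  have add: "coset (f + g) \<in> I" if "coset f \<in> I" "coset g \<in> I" for f g
    using a_closed[OF that] quot_add by simp
  have mult: "coset (f * g) \<in> I" "coset (g * f) \<in> I"
    if "coset f \<in> I" "f \<in> fcarrier X" "g \<in> fcarrier X" for f g
    using that I quot_mult unfolding algebra_ideal_def quot_carrier by (metis imageI)+
  have smult: "coset (scal a * f) \<in> I" if "coset f \<in> I" for a f
    using that I quot_smult unfolding algebra_ideal_def by metis
  show "fideal X {f \<in> fcarrier X. coset f \<in> I}"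
    using I0 add mult smult by (auto simp: fideal_def)
  show "K \<subseteq> {f \<in> fcarrier X. coset f \<in> I}"
  proof
    fix f assume "f \<in> K"
    then have "coset f = coset 0"
      by (simp add: coset_eq_iff)
    with \<open>f \<in> K\<close> show "f \<in> {f \<in> fcarrier X. coset f \<in> I}"
      using I0 fidealD(1)[OF K] by simp
  qed
  show "coset ` {f \<in> fcarrier X. coset f \<in> I} = I"
    using sub by auto
qed

lemma coset_image_iff:
  assumes J: "fideal X J" "K \<subseteq> J"
  shows "coset f \<in> coset ` J \<longleftrightarrow> f \<in> J"
proof
  assume "coset f \<in> coset ` J"
  then obtain g where "g \<in> J" "f - g \<in> K"
    using coset_eq_iff by auto
  then show "f \<in> J"
    using fidealD(3)[OF J(1), of "f - g" g] J(2) by auto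
qed auto

lemma ideal_quotI:
  assumes J: "fideal X J" "K \<subseteq> J"
  shows "algebra_ideal (coset ` J) quot"
proof -
  note D = fidealD[OF J(1)]
  have inv: "inv\<^bsub>add_monoid quot\<^esub> (coset f) = coset (- f)" if "f \<in> fcarrier X" for f
    unfolding m_inv_def
  proof (rule the_equality)
    show "coset (- f) \<in> carrier (add_monoid quot) \<and>
      coset f \<otimes>\<^bsub>add_monoid quot\<^esub> coset (- f) = \<one>\<^bsub>add_monoid quot\<^esub> \<and>
      coset (- f) \<otimes>\<^bsub>add_monoid quot\<^esub> coset f = \<one>\<^bsub>add_monoid quot\<^esub>"
      using that by (auto simp: quot_carrier quot_add quot_zero)
    fix y assume "y \<in> carrier (add_monoid quot) \<and>
      coset f \<otimes>\<^bsub>add_monoid quot\<^esub> y = \<one>\<^bsub>add_monoid quot\<^esub> \<and>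
      y \<otimes>\<^bsub>add_monoid quot\<^esub> coset f = \<one>\<^bsub>add_monoid quot\<^esub>"
    then obtain g where "y = coset g" "coset (g + f) = coset 0"
      by (auto simp: quot_carrier quot_add quot_zero)
    then show "y = coset (- f)"
      by (simp add: coset_eq_iff)
  qed
  have "subgroup (coset ` J) (add_monoid quot)"
  proof
    show "coset ` J \<subseteq> carrier (add_monoid quot)"
      using D(1) by (auto simp: quot_carrier)
    show "x \<otimes>\<^bsub>add_monoid quot\<^esub> y \<in> coset ` J" if "x \<in> coset ` J" "y \<in> coset ` J" for x y
      using that D(3) by (auto simp: quot_add)
    show "\<one>\<^bsub>add_monoid quot\<^esub> \<in> coset ` J"
      using D(2) by (auto simp: quot_zero)
    show "inv\<^bsub>add_monoid quot\<^esub> x \<in> coset ` J" if "x \<in> coset ` J" for x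
      using that D(1,7) inv by auto
  qed
  moreover have "x \<otimes>\<^bsub>quot\<^esub> y \<in> coset ` J \<and> y \<otimes>\<^bsub>quot\<^esub> x \<in> coset ` J"
    if "x \<in> coset ` J" "y \<in> carrier quot" for x y
    using that D(1,4,5) by (auto simp: quot_carrier quot_mult)
  moreover have "a \<odot>\<^bsub>quot\<^esub> x \<in> coset ` J" if "x \<in> coset ` J" for a x
    using that D(6) by (auto simp: quot_smult)
  ultimately show ?thesis
    by (simp add: algebra_ideal_def additive_subgroup_def)
qed

lemma coset_image_eq_iff:
  assumes "fideal X J" "K \<subseteq> J"
  shows "coset ` J = {zero quot} \<longleftrightarrow> J = K" "coset ` J = carrier quot \<longleftrightarrow> J = fcarrier X"
proof -
  show "coset ` J = {zero quot} \<longleftrightarrow> J = K"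
  proof
    assume "coset ` J = {zero quot}"
    then have "f \<in> K" if "f \<in> J" for f
      using that coset_eq_iff[of f 0] quot_zero by auto
    then show "J = K"
      using assms by auto
  next
    assume "J = K"
    then show "coset ` J = {zero quot}"
      using coset_eq_iff[of _ 0] quot_zero fidealD(2)[OF K] by auto
  qed
  show "coset ` J = carrier quot \<longleftrightarrow> J = fcarrier X"
  proof
    assume eq: "coset ` J = carrier quot"
    have "f \<in> J" if "f \<in> fcarrier X" for f
      using that coset_image_iff[OF assms, of f] eq quot_carrier by auto
    then show "J = fcarrier X"
      using fidealD(1)[OF assms(1)] by auto
  qed (simp add: quot_carrier)
qed

end

section \<open>The relations of the Kumjian--Pask algebra\<close>

context k_graph
begin

abbreviation fc :: "('a gen word \<Rightarrow>\<^sub>0 'r::comm_ring_1) set" where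
  "fc \<equiv> fcarrier (generators \<Lambda>)"

lemma gen_Path [intro, simp]: "\<alpha> \<in> M \<Longrightarrow> gen (Path \<alpha>) \<in> fc"
  by (auto simp: generators_def)

lemma gen_star [intro, simp]: "\<alpha> \<in> M \<Longrightarrow> gen (star \<Lambda> \<alpha>) \<in> fc"
  by (auto simp: generators_def star_def vertices_def)

lemma generators_cases:
  assumes "g \<in> generators \<Lambda>"
  obtains \<alpha> where "\<alpha> \<in> M" "g = Path \<alpha>" | \<alpha> where "\<alpha> \<in> M" "g = star \<Lambda> \<alpha>"
proof -
  consider \<alpha> where "\<alpha> \<in> M" "g = Path \<alpha>" | \<alpha> where "\<alpha> \<in> M" "deg \<alpha> \<noteq> 0" "g = Ghost \<alpha>"
    using assms by (auto simp: generators_def vertices_def)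
  then show ?thesis
    using that by cases (auto simp: star_def)
qed

lemma star_vertex: "v \<in> vertices \<Lambda> \<Longrightarrow> star \<Lambda> v = Path v"
  by (simp add: star_def vertices_def)

end

context fa_kgraph
begin

lemma relators_fc: "kp_relators \<Lambda> \<subseteq> (fc :: ('a gen word \<Rightarrow>\<^sub>0 'r::comm_ring_1) set)"
proof
  fix f :: "'a gen word \<Rightarrow>\<^sub>0 'r" assume "f \<in> kp_relators \<Lambda>"
  then show "f \<in> fc"
  proof cases
    case (KP3 \<alpha> \<mu>)
    then show ?thesis
      by (auto simp: Lmin_iff intro!: fcarrier_diff fcarrier_sum)
  next
    case (KP4 v E xs)
    \<comment> \<open>Nonemptiness matters: \<open>list_prod\<close> of the empty list is
      \<open>last []\<close>, of which nothing is known.\<close>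
    then have "xs \<noteq> []" "set xs \<subseteq> M"
      using FE_nonempty by (auto simp: FE_iff)
    then show ?thesis
      unfolding KP4(1) using KP4(2) vertices_M by (intro fcarrier_list_prod) auto
  qed (auto simp: vertices_M intro!: fcarrier_diff)
qed

lemma fideal_Inter: "\<S> \<noteq> {} \<Longrightarrow> (\<And>J. J \<in> \<S> \<Longrightarrow> fideal X J) \<Longrightarrow> fideal X (\<Inter>\<S>)"
  unfolding fideal_def by blast

lemma kp_ideal_fideal: "fideal (generators \<Lambda>) (kp_ideal \<Lambda> :: ('a gen word \<Rightarrow>\<^sub>0 'r::comm_ring_1) set)"
proof -
  have "fideal (generators \<Lambda>) (fc :: ('a gen word \<Rightarrow>\<^sub>0 'r) set)"
    by (auto simp: fideal_def)
  then show ?thesis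
    unfolding kp_ideal_def kp_free_def algebra_ideal_free
    using relators_fc by (intro fideal_Inter) auto
qed

lemma relators_kp_ideal: "kp_relators \<Lambda> \<subseteq> kp_ideal \<Lambda>"
  unfolding kp_ideal_def by blast

lemma kp_ideal_least: "fideal (generators \<Lambda>) J \<Longrightarrow> kp_relators \<Lambda> \<subseteq> J \<Longrightarrow> kp_ideal \<Lambda> \<subseteq> J"
  unfolding kp_ideal_def kp_free_def algebra_ideal_free by blast

definition basic :: "('a gen word \<Rightarrow>\<^sub>0 'r::comm_ring_1) set \<Rightarrow> bool" where
  "basic J \<longleftrightarrow> fideal (generators \<Lambda>) J \<and> kp_ideal \<Lambda> \<subseteq> J \<and>
     (\<forall>c. \<forall>v\<in>vertices \<Lambda>. c \<noteq> 0 \<and> scal c * gen (Path v) \<in> J \<longrightarrow> gen (Path v) \<in> J)"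

text \<open>The correspondence of ideals moves the whole question into the free algebra; cosets do
  not occur after this point.\<close>

lemma basically_simple_iff:
  "basically_simple TYPE('r::comm_ring_1) \<Lambda> \<longleftrightarrow>
     (\<forall>J :: ('a gen word \<Rightarrow>\<^sub>0 'r) set. basic J \<longrightarrow> J = kp_ideal \<Lambda> \<or> J = fc)"
proof -
  let ?K = "kp_ideal \<Lambda> :: ('a gen word \<Rightarrow>\<^sub>0 'r) set"
  let ?cs = "coset (generators \<Lambda>) ?K"
  note K = kp_ideal_fideal[where 'r = 'r]
  have alg: "kp_algebra \<Lambda> = quotient_algebra (free_algebra (generators \<Lambda>)) ?K"
    by (simp add: kp_algebra_def kp_free_def)
  have gen: "kp_gen \<Lambda> g = ?cs (gen g)" for g
    by (simp add: kp_gen_def kp_free_def coset_def[OF K])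
  show ?thesis
  proof
    assume simple: "basically_simple TYPE('r) \<Lambda>"
    show "\<forall>J :: ('a gen word \<Rightarrow>\<^sub>0 'r) set. basic J \<longrightarrow> J = kp_ideal \<Lambda> \<or> J = fc"
    proof (intro allI impI)
      fix J :: "('a gen word \<Rightarrow>\<^sub>0 'r) set" assume "basic J"
      then have J: "fideal (generators \<Lambda>) J" "?K \<subseteq> J"
        "\<And>c v. v \<in> vertices \<Lambda> \<Longrightarrow> c \<noteq> 0 \<Longrightarrow> scal c * gen (Path v) \<in> J \<Longrightarrow> gen (Path v) \<in> J"
        by (auto simp: basic_def)
      have "basic_ideal \<Lambda> (?cs ` J)"
        unfolding basic_ideal_def alg gen quot_smult[OF K] coset_image_iff[OF K J(1,2)]
        using ideal_quotI[OF K J(1,2)] J(3) by blast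
      then have "?cs ` J = {zero (kp_algebra \<Lambda>)} \<or> ?cs ` J = carrier (kp_algebra \<Lambda>)"
        using simple unfolding basically_simple_def by blast
      then show "J = kp_ideal \<Lambda> \<or> J = fc"
        unfolding alg coset_image_eq_iff[OF K J(1,2)] .
    qed
  next
    assume simple: "\<forall>J :: ('a gen word \<Rightarrow>\<^sub>0 'r) set. basic J \<longrightarrow> J = kp_ideal \<Lambda> \<or> J = fc"
    show "basically_simple TYPE('r) \<Lambda>"
      unfolding basically_simple_def
    proof (intro allI impI)
      fix I :: "('a gen word \<Rightarrow>\<^sub>0 'r) set set" assume I: "basic_ideal \<Lambda> I"
      define J where "J = {f \<in> fc. ?cs f \<in> I}"
      have "algebra_ideal I (quotient_algebra (free_algebra (generators \<Lambda>)) ?K)"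
        using I unfolding basic_ideal_def alg by blast
      note J = ideal_quotD[OF K this, folded J_def]
      have "basic J"
        using J(1,2) I vertices_M unfolding basic_def basic_ideal_def alg gen quot_smult[OF K]
        by (auto simp: J_def)
      then have "J = kp_ideal \<Lambda> \<or> J = fc"
        using simple by blast
      then show "I = {zero (kp_algebra \<Lambda>)} \<or> I = carrier (kp_algebra \<Lambda>)"
        unfolding alg using coset_image_eq_iff[OF K J(1,2)] J(3) by simp
    qed
  qed
qed

end

section \<open>The action on boundary paths\<close>

type_synonym ('a, 'k) state = "'a set \<times> ('k \<Rightarrow> int)"

context fa_kgraph
begin

text \<open>The generators act by partial bijections on pairs of a tight filter and a vector of integers,
  which moves by \<open>c\<close> times the degree.  For \<open>c = 1\<close> the vector detects the degree grading; for
  \<open>c = 0\<close> this is the action on boundary paths.\<close>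

primrec step :: "int \<Rightarrow> 'a gen \<Rightarrow> ('a, 'k) state \<Rightarrow> ('a, 'k) state option" where
  "step c (Path \<alpha>) y = (if \<alpha> \<in> fst y
     then Some (shift \<alpha> (fst y), \<lambda>i. snd y i - c * int (deg \<alpha> i)) else None)"
| "step c (Ghost \<alpha>) y = (if src \<alpha> \<in> fst y
     then Some (prepend \<alpha> (fst y), \<lambda>i. snd y i + c * int (deg \<alpha> i)) else None)"

text \<open>The leftmost letter moves the point first. A generator acts on functions by composition
  with its partial map, (g h)(y) = h(g y), so this order turns products of words into composites of
  operators.\<close>

primrec traj :: "int \<Rightarrow> 'a gen list \<Rightarrow> ('a, 'k) state \<Rightarrow> ('a, 'k) state option" where
  "traj c [] y = Some y"
| "traj c (g # gs) y = Option.bind (step c g y) (traj c gs)"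

lemma traj_append: "traj c (gs @ gs') y = Option.bind (traj c gs y) (traj c gs')"
  by (induction gs arbitrary: y) (auto split: bind_split)

definition eval_at :: "(('a, 'k) state \<Rightarrow> 'r::zero) \<Rightarrow> ('a, 'k) state option \<Rightarrow> 'r" where
  "eval_at h y = (case y of None \<Rightarrow> 0 | Some y' \<Rightarrow> h y')"

definition act :: "int \<Rightarrow> ('a gen word \<Rightarrow>\<^sub>0 'r::comm_ring_1) \<Rightarrow> (('a, 'k) state \<Rightarrow> 'r) \<Rightarrow> ('a, 'k) state \<Rightarrow> 'r"
  where "act c f h y = lin (\<lambda>w. eval_at h (traj c (letters w) y)) f"

lemma act_simps [simp]:
  "act c (f + g) h y = act c f h y + act c g h y"
  "act c (f - g) h y = act c f h y - act c g h y"
  "act c 0 h y = 0"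
  "act c (\<Sum>i\<in>I. F i) h y = (\<Sum>i\<in>I. act c (F i) h y)"
  by (simp_all add: act_def)

lemma act_single: "act c (Poly_Mapping.single w a) h y = a * eval_at h (traj c (letters w) y)"
  by (simp add: act_def)

lemma act_mult [simp]: "act c (f * g) h y = act c f (act c g h) y"
proof (induction f rule: poly_mapping_additive_induct)
  case (single w a)
  show ?case
  proof (induction g rule: poly_mapping_additive_induct)
    case zero
    then show ?case
      by (simp add: act_def eval_at_def split: option.split)
  next
    case (single w' b)
    then show ?case
      by (simp add: act_def mult_single traj_append eval_at_def split: option.split bind_split)
  next
    case (add g g')
    have "eval_at (\<lambda>y. act c g h y + act c g' h y) y' = eval_at (act c g h) y' + eval_at (act c g' h) y'" for y'
      by (simp add: eval_at_def split: option.split)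
    then show ?case
      using add by (simp add: distrib_left act_single)
  qed
qed (simp_all add: distrib_right)

lemma act_gen: "act c (gen g) h y = eval_at h (step c g y)"
  by (cases "step c g y") (simp_all add: act_def gen_def)

lemma act_scal [simp]: "act c (scal a) h y = a * h y"
  by (simp add: act_single eval_at_def)

lemma act_Path [simp]: "act c (gen (Path \<alpha>)) h (X, z) =
    (if \<alpha> \<in> X then h (shift \<alpha> X, \<lambda>i. z i - c * int (deg \<alpha> i)) else 0)"
  by (simp add: act_gen eval_at_def)

lemma step_star:
  assumes "tight X" "\<alpha> \<in> M"
  shows "step c (star \<Lambda> \<alpha>) (X, z) = (if src \<alpha> \<in> X
    then Some (prepend \<alpha> X, \<lambda>i. z i + c * int (deg \<alpha> i)) else None)"
proof (cases "deg \<alpha> = 0")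
  case True
  then have "\<alpha> \<in> vertices \<Lambda>"
    using assms by (simp add: vertices_def)
  then show ?thesis
    using True src_vertex shift_vertex[OF assms(1)] prepend_vertex[OF assms(1)] by (simp add: star_def)
qed (simp add: star_def)

lemma act_star [simp]: "tight X \<Longrightarrow> \<alpha> \<in> M \<Longrightarrow> act c (gen (star \<Lambda> \<alpha>)) h (X, z) =
    (if src \<alpha> \<in> X then h (prepend \<alpha> X, \<lambda>i. z i + c * int (deg \<alpha> i)) else 0)"
  by (simp add: act_gen eval_at_def step_star)

lemma src_in_shift: "tight X \<Longrightarrow> \<alpha> \<in> X \<Longrightarrow> src \<alpha> \<in> shift \<alpha> X"
  using tight_M by (auto simp: shift_def)

lemma act_range_proj:
  assumes "tight X" "\<alpha> \<in> M"
  shows "act c (gen (Path \<alpha>) * gen (star \<Lambda> \<alpha>)) h (X, z) = (if \<alpha> \<in> X then h (X, z) else 0)"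
  using assms tight_shift src_in_shift prepend_shift by simp

text \<open>At a given filter at most one term of the sum survives: all \<rho> occurring in
  \<open>Lmin \<Lambda> \<alpha> \<mu>\<close> have the same degree, so at most one lies in
  \<open>X\<close>, and it determines \<tau> by cancellation. A surviving term exists exactly if
  \<alpha>X is defined and passes through \<mu>.\<close>

lemma act_KP3:
  assumes X: "tight X" and \<alpha>: "\<alpha> \<in> M" and \<mu>: "\<mu> \<in> M"
  shows "act c (gen (star \<Lambda> \<alpha>) * gen (Path \<mu>)) h (X, z) =
    act c (\<Sum>(\<rho>, \<tau>)\<in>Lmin \<Lambda> \<alpha> \<mu>. gen (Path \<rho>) * gen (star \<Lambda> \<tau>)) h (X, z)"
proof -
  define t where "t = (\<lambda>(\<rho>, \<tau>). if \<rho> \<in> X then h (prepend \<tau> (shift \<rho> X),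
    \<lambda>i. z i - c * int (deg \<rho> i) + c * int (deg \<tau> i)) else 0)"
  have "act c (\<Sum>(\<rho>, \<tau>)\<in>Lmin \<Lambda> \<alpha> \<mu>. gen (Path \<rho>) * gen (star \<Lambda> \<tau>)) h (X, z) = sum t (Lmin \<Lambda> \<alpha> \<mu>)"
    unfolding act_simps
  proof (intro sum.cong refl)
    fix p assume "p \<in> Lmin \<Lambda> \<alpha> \<mu>"
    then obtain \<rho> \<tau> where p: "p = (\<rho>, \<tau>)" "(\<rho>, \<tau>) \<in> Lmin \<Lambda> \<alpha> \<mu>"
      by (cases p) auto
    then have L: "\<rho> \<in> M" "\<tau> \<in> M" "src \<alpha> = rng \<rho>" "src \<mu> = rng \<tau>" "\<alpha> \<cdot> \<rho> = \<mu> \<cdot> \<tau>"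
      using \<alpha> \<mu> by (auto simp: Lmin_iff)
    then have "src \<tau> = src \<rho>"
      using \<alpha> \<mu> by (metis sr_cmp)
    then show "act c (case p of (\<rho>, \<tau>) \<Rightarrow> gen (Path \<rho>) * gen (star \<Lambda> \<tau>)) h (X, z) = t p"
      using p L X tight_shift[OF X, of \<rho>] src_in_shift[OF X, of \<rho>] by (simp add: t_def)
  qed
  also have "\<dots> = act c (gen (star \<Lambda> \<alpha>) * gen (Path \<mu>)) h (X, z)"
  proof (cases "src \<alpha> \<in> X \<and> \<mu> \<in> prepend \<alpha> X")
    case True
    then have Y: "tight (prepend \<alpha> X)" "\<alpha> \<in> prepend \<alpha> X"
      using X \<alpha> tight_prepend prepend_self by auto
    \<comment> \<open>A member of \<alpha>X beyond both paths contains the minimal common extension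
      that provides the surviving term.\<close>
    obtain \<kappa> where \<kappa>: "\<kappa> \<in> prepend \<alpha> X" "\<alpha> \<preceq> \<kappa>" "\<mu> \<preceq> \<kappa>"
      using tight_directed[OF Y] True by metis
    then obtain \<rho> \<tau> where L: "(\<rho>, \<tau>) \<in> Lmin \<Lambda> \<alpha> \<mu>" "\<alpha> \<cdot> \<rho> \<preceq> \<kappa>"
      using Lmin_below by metis
    then have L': "\<rho> \<in> M" "\<tau> \<in> M" "src \<alpha> = rng \<rho>" "src \<mu> = rng \<tau>" "\<alpha> \<cdot> \<rho> = \<mu> \<cdot> \<tau>"
      using \<alpha> \<mu> by (auto simp: Lmin_iff)
    then have "\<rho> \<in> shift \<alpha> (prepend \<alpha> X)"
      using tight_prefix[OF Y(1) \<kappa>(1) L(2)] by (simp add: shift_def)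
    then have \<rho>: "\<rho> \<in> X"
      using shift_prepend[OF \<alpha> X] True by simp
    have src: "src \<tau> = src \<rho>"
      using L' \<alpha> \<mu> by (metis sr_cmp)
    define Z where "Z = shift \<rho> X"
    have Z: "tight Z" "src \<rho> \<in> Z" "X = prepend \<rho> Z"
      using X \<rho> tight_shift src_in_shift prepend_shift by (auto simp: Z_def)
    \<comment> \<open>Writing X = \<rho>Z gives \<alpha>X = \<alpha>\<rho>Z = \<mu>\<tau>Z, so
      removing \<mu> leaves \<tau>Z.\<close>
    have "prepend \<alpha> X = prepend \<mu> (prepend \<tau> Z)"
      using prepend_cmp[of Z \<alpha> \<rho>] prepend_cmp[of Z \<mu> \<tau>] Z L' \<alpha> \<mu> src by simp
    moreover have "src \<mu> \<in> prepend \<tau> Z"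
      using prepend_self[of \<tau> Z] tight_rng_in[OF tight_prepend[of \<tau> Z], of \<tau>] Z L' src by simp
    ultimately have shift: "shift \<mu> (prepend \<alpha> X) = prepend \<tau> Z"
      using shift_prepend[OF \<mu> tight_prepend[of \<tau> Z]] Z L' src by simp
    \<comment> \<open>The vectors agree because d(\<alpha>) + d(\<rho>) = d(\<mu>) + d(\<tau>):
      relation (KP3) is homogeneous for the grading.\<close>
    have deg: "z i + c * int (deg \<alpha> i) - c * int (deg \<mu> i) = z i - c * int (deg \<rho> i) + c * int (deg \<tau> i)" for i
    proof -
      have "deg \<alpha> + deg \<rho> = deg \<mu> + deg \<tau>"
        using L' \<alpha> \<mu> by (metis dg_cmp)
      then have "deg \<alpha> i + deg \<rho> i = deg \<mu> i + deg \<tau> i"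
        by (metis plus_fun_apply)
      then have "int (deg \<alpha> i) - int (deg \<mu> i) = int (deg \<tau> i) - int (deg \<rho> i)"
        by linarith
      then have "c * int (deg \<alpha> i) - c * int (deg \<mu> i) = c * int (deg \<tau> i) - c * int (deg \<rho> i)"
        by (metis right_diff_distrib)
      then show ?thesis
        by linarith
    qed
    have "t p = (if p = (\<rho>, \<tau>) then t (\<rho>, \<tau>) else 0)" if hp: "p \<in> Lmin \<Lambda> \<alpha> \<mu>" for p
    proof (cases "fst p \<in> X")
      case True
      obtain \<rho>' \<tau>' where p: "p = (\<rho>', \<tau>')" "(\<rho>', \<tau>') \<in> Lmin \<Lambda> \<alpha> \<mu>"
        using hp by (cases p) auto
      then have P: "\<rho>' \<in> M" "\<tau>' \<in> M" "src \<alpha> = rng \<rho>'" "src \<mu> = rng \<tau>'" "\<alpha> \<cdot> \<rho>' = \<mu> \<cdot> \<tau>'"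
        using \<alpha> \<mu> by (auto simp: Lmin_iff)
      have "deg (\<alpha> \<cdot> \<rho>') = deg (\<alpha> \<cdot> \<rho>)"
        using L(1) p(2) \<alpha> \<mu> Lmin_iff by metis
      then have "deg \<rho>' = deg \<rho>"
        using L'(1,3) P(1,3) \<alpha> by simp
      then have "\<rho>' = \<rho>"
        using tight_deg_eq[OF X] True \<rho> p by simp
      moreover from this have "\<tau>' = \<tau>"
        using P L' \<mu> cancel_left[of \<mu> \<tau>' \<tau>] by simp
      ultimately show ?thesis
        using p by simp
    next
      case False
      then show ?thesis
        using \<rho> by (auto simp: t_def split: prod.split)
    qed
    then have "sum t (Lmin \<Lambda> \<alpha> \<mu>) = (\<Sum>p\<in>Lmin \<Lambda> \<alpha> \<mu>. if p = (\<rho>, \<tau>) then t (\<rho>, \<tau>) else 0)"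
      by (intro sum.cong) auto
    also have "\<dots> = t (\<rho>, \<tau>)"
      using L(1) finite_Lmin[OF \<alpha> \<mu>] by simp
    finally show ?thesis
      using True X \<alpha> \<rho> shift by (simp add: t_def Z_def deg)
  next
    case False
    \<comment> \<open>A term with \<rho> in \<open>X\<close> would put \<alpha>\<rho> = \<mu>\<tau>,
      and with it \<mu>, into \<alpha>X.\<close>
    have "t p = 0" if p: "p \<in> Lmin \<Lambda> \<alpha> \<mu>" for p
    proof -
      obtain \<rho> \<tau> where "p = (\<rho>, \<tau>)" "(\<rho>, \<tau>) \<in> Lmin \<Lambda> \<alpha> \<mu>"
        using p by (cases p) auto
      moreover from this have L: "\<rho> \<in> M" "\<tau> \<in> M" "src \<alpha> = rng \<rho>" "src \<mu> = rng \<tau>" "\<alpha> \<cdot> \<rho> = \<mu> \<cdot> \<tau>"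
        using \<alpha> \<mu> by (auto simp: Lmin_iff)
      moreover have "\<rho> \<notin> X"
      proof
        assume "\<rho> \<in> X"
        then have "src \<alpha> \<in> X"
          using tight_rng_in[OF X] L by simp
        moreover have "\<alpha> \<cdot> \<rho> \<in> prepend \<alpha> X"
          using prependI \<alpha> X \<open>\<rho> \<in> X\<close> calculation by blast
        then have "\<mu> \<in> prepend \<alpha> X"
          using tight_prefix[OF tight_prepend[OF \<alpha> X calculation], of "\<alpha> \<cdot> \<rho>" \<mu>] L prefixI[OF \<mu> L(2,4)] by simp
        ultimately show False
          using False by simp
      qed
      ultimately show ?thesis
        by (simp add: t_def)
    qed
    then show ?thesis
      using False X \<alpha> by simp
  qed
  finally show ?thesis
    by simp
qed

section \<open>Invariant sets of filters and the kernels of their actions\<close>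

definition invariant :: "'a set set \<Rightarrow> bool" where
  "invariant \<T> \<longleftrightarrow> (\<forall>X\<in>\<T>. tight X \<and> (\<forall>\<alpha>\<in>X. shift \<alpha> X \<in> \<T>) \<and>
     (\<forall>\<alpha>\<in>M. src \<alpha> \<in> X \<longrightarrow> prepend \<alpha> X \<in> \<T>))"

definition annihilator :: "int \<Rightarrow> 'a set set \<Rightarrow> ('a gen word \<Rightarrow>\<^sub>0 'r::comm_ring_1) set" where
  "annihilator c \<T> = {f \<in> fc. \<forall>h z. \<forall>X\<in>\<T>. act c f h (X, z) = 0}"

lemma traj_invariant:
  assumes "invariant \<T>" "set gs \<subseteq> generators \<Lambda>" "fst y \<in> \<T>" "traj c gs y = Some y'"
  shows "fst y' \<in> \<T>"
  using assms(2-)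
proof (induction gs arbitrary: y)
  case (Cons g gs)
  then obtain y'' where y'': "step c g y = Some y''" "traj c gs y'' = Some y'"
    by (auto simp: bind_eq_Some_conv)
  have "fst y'' \<in> \<T>"
  proof (cases g)
    case (Path \<alpha>)
    then show ?thesis
      using y''(1) Cons.prems(2) assms(1) by (auto simp: invariant_def split: if_splits)
  next
    case (Ghost \<alpha>)
    then have "\<alpha> \<in> M"
      using Cons.prems(1) by (auto simp: generators_def)
    then show ?thesis
      using Ghost y''(1) Cons.prems(2) assms(1) by (auto simp: invariant_def split: if_splits)
  qed
  then show ?case
    using Cons y'' by simp
qed simp

text \<open>A right factor merely changes the test function. A left factor moves the point, and
  invariance keeps it in \<T>.\<close>

lemma annihilator_fideal:
  assumes "invariant \<T>"
  shows "fideal (generators \<Lambda>) (annihilator c \<T> :: ('a gen word \<Rightarrow>\<^sub>0 'r::comm_ring_1) set)"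
proof -
  have "act c (x * f) h (X, z) = 0"
    if f: "f \<in> annihilator c \<T>" and x: "x \<in> fc" and X: "X \<in> \<T>"
    for f x :: "'a gen word \<Rightarrow>\<^sub>0 'r" and h X z
  proof -
    have "eval_at (act c f h) (traj c (letters w) (X, z)) = 0" if "w \<in> Poly_Mapping.keys x" for w
    proof (cases "traj c (letters w) (X, z)")
      case (Some y)
      have "set (letters w) \<subseteq> generators \<Lambda>"
        using that x by (auto simp: fcarrier_iff)
      then have "fst y \<in> \<T>"
        using traj_invariant[OF assms _ _ Some] X by simp
      then show ?thesis
        using Some f by (cases y) (simp add: eval_at_def annihilator_def)
    qed (simp add: eval_at_def)
    then show ?thesis
      unfolding act_mult by (simp add: act_def[of c x] lin_def)
  qed
  then show ?thesis
    unfolding fideal_def by (auto simp: annihilator_def)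
qed

lemma relators_annihilator:
  assumes \<T>: "invariant \<T>"
  shows "kp_relators \<Lambda> \<subseteq> (annihilator c \<T> :: ('a gen word \<Rightarrow>\<^sub>0 'r::comm_ring_1) set)"
proof
  fix f :: "'a gen word \<Rightarrow>\<^sub>0 'r" assume f: "f \<in> kp_relators \<Lambda>"
  have "act c f h (X, z) = 0" if X: "tight X" for h X z
    using f
  proof cases
    case (KP1_idem v)
    then show ?thesis
      using shift_vertex[OF X] by (simp add: vertices_def)
  next
    case (KP1_orth v w)
    then show ?thesis
      using shift_vertex[OF X, of v] tight_vertex[OF X, of v w] rng_vertex[of w] by auto
  next
    case (KP2 \<alpha> \<mu>)
    then show ?thesis
      unfolding KP2(1) using shift_cmp[OF X KP2(2-)] by (simp add: algebra_simps)
  next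
    case (KP2_star \<alpha> \<mu>)
    have "src \<alpha> \<in> prepend \<mu> X \<and> tight (prepend \<mu> X)" if "src \<mu> \<in> X"
      using that prepend_self[of \<mu> X] tight_prepend[of \<mu> X] tight_rng_in[of "prepend \<mu> X" \<mu>] X KP2_star
      by auto
    then show ?thesis
      unfolding KP2_star(1) using KP2_star(2-) X prepend_cmp[OF X KP2_star(2-)]
      by (auto simp: algebra_simps)
  next
    case (KP3 \<alpha> \<mu>)
    then show ?thesis
      using act_KP3[OF X KP3(2,3), of c h z] by simp
  next
    case (KP4 v E xs)
    let ?q = "\<lambda>\<alpha>. gen (Path v) - gen (Path \<alpha>) * gen (star \<Lambda> \<alpha>) :: 'a gen word \<Rightarrow>\<^sub>0 'r"
    \<comment> \<open>Each factor multiplies by the indicator of the filters that contain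
      \<open>v\<close> but not \<alpha>. The product is supported on the filters containing
      \<open>v\<close> and avoiding all of \<open>E\<close>, and tightness leaves none.\<close>
    have factor: "act c (?q \<alpha>) h (X, z) = (if v \<in> X \<and> \<alpha> \<notin> X then h (X, z) else 0)"
      if "\<alpha> \<in> M" "rng \<alpha> = v" for \<alpha> h
      using that shift_vertex[OF X KP4(2)] act_range_proj[OF X, of \<alpha> c h z] tight_rng_in[OF X, of \<alpha>] KP4(2)
      by (auto simp: vertices_def)
    have "act c (list_prod (*) (map ?q xs)) h (X, z) =
      (if v \<in> X \<and> (\<forall>\<alpha>\<in>set xs. \<alpha> \<notin> X) then h (X, z) else 0)"
      if "xs \<noteq> []" "set xs \<subseteq> {\<alpha> \<in> M. rng \<alpha> = v}" for xs
      using that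
    proof (induction xs rule: list_nonempty_induct)
      case (single \<alpha>)
      then show ?case
        using factor[of \<alpha> h] by (simp add: list_prod_def)
    next
      case (cons \<alpha> xs)
      then have "list_prod (*) (map ?q (\<alpha> # xs)) = ?q \<alpha> * list_prod (*) (map ?q xs)"
        by (simp add: list_prod_def)
      moreover have "act c (?q \<alpha> * p) h (X, z) =
        (if v \<in> X \<and> \<alpha> \<notin> X then act c p h (X, z) else 0)" for p
        unfolding act_mult using cons.prems by (intro factor) auto
      ultimately show ?case
        using cons by simp
    qed
    moreover have "\<exists>e\<in>E. e \<in> X" if vX: "v \<in> X"
    proof -
      obtain e where "e \<in> E" "v \<cdot> e \<in> X"
        using tight_FE[OF X vX, of E] KP4 src_vertex by auto
      moreover have "e \<in> M" "rng e = v"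
        using KP4(2,3) \<open>e \<in> E\<close> by (auto simp: FE_iff)
      then have "v \<cdot> e = e"
        using cmp_rg[of e] by simp
      ultimately show ?thesis
        by auto
    qed
    moreover have "xs \<noteq> []" "set xs \<subseteq> {\<alpha> \<in> M. rng \<alpha> = v}"
      using KP4(2,3,5) FE_nonempty[OF KP4(2,3)] by (auto simp: FE_iff)
    ultimately show ?thesis
      unfolding KP4(1) using KP4(5) by auto
  qed
  then show "f \<in> annihilator c \<T>"
    using f relators_fc \<T> by (auto simp: annihilator_def invariant_def)
qed

lemma kp_ideal_annihilator: "invariant \<T> \<Longrightarrow> kp_ideal \<Lambda> \<subseteq> annihilator c \<T>"
  by (intro kp_ideal_least annihilator_fideal relators_annihilator)

text \<open>The constant function 1 is sent to a function with the value \<open>a\<close> at any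
  filter containing \<open>v\<close>. No power of cancellation in the ring is used, so the kernel is
  basic over every R.\<close>

lemma vertex_annihilator:
  assumes "invariant \<T>" "v \<in> vertices \<Lambda>" "a \<noteq> 0"
  shows "scal a * gen (Path v) \<in> annihilator c \<T> \<longleftrightarrow> (\<forall>X\<in>\<T>. v \<notin> X)"
proof
  assume l: "scal a * gen (Path v) \<in> annihilator c \<T>"
  show "\<forall>X\<in>\<T>. v \<notin> X"
  proof (intro ballI notI)
    fix X assume "X \<in> \<T>" "v \<in> X"
    then have "act c (scal a * gen (Path v)) (\<lambda>_. 1) (X, \<lambda>_. 0) = a"
      by simp
    moreover have "act c (scal a * gen (Path v)) (\<lambda>_. 1) (X, \<lambda>_. 0) = 0"
      using l \<open>X \<in> \<T>\<close> unfolding annihilator_def by blast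
    ultimately show False
      using assms(3) by simp
  qed
next
  assume "\<forall>X\<in>\<T>. v \<notin> X"
  then show "scal a * gen (Path v) \<in> annihilator c \<T>"
    using vertices_M[OF assms(2)] unfolding annihilator_def by (auto intro: fcarrier_scal)
qed

lemma vertex_annihilator_1:
  "invariant \<T> \<Longrightarrow> v \<in> vertices \<Lambda> \<Longrightarrow> gen (Path v) \<in> annihilator c \<T> \<longleftrightarrow> (\<forall>X\<in>\<T>. v \<notin> X)"
  using vertex_annihilator[of \<T> v 1 c] by simp

lemma basic_annihilator: "invariant \<T> \<Longrightarrow> basic (annihilator c \<T>)"
  using annihilator_fideal kp_ideal_annihilator vertex_annihilator vertex_annihilator_1
  unfolding basic_def by metis

lemma invariant_tight: "invariant {X. tight X}"
  by (auto simp: invariant_def tight_shift tight_prepend)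

lemma vertex_not_kp_ideal:
  assumes "v \<in> vertices \<Lambda>"
  shows "gen (Path v) \<notin> kp_ideal \<Lambda>"
proof -
  obtain X where "tight X" "v \<in> X"
    using tight_exists[OF assms] .
  then have "gen (Path v) \<notin> annihilator 0 {X. tight X}"
    using vertex_annihilator_1[OF invariant_tight assms] by blast
  then show ?thesis
    using kp_ideal_annihilator[OF invariant_tight] by blast
qed

section \<open>Basic simplicity forces cofinality and aperiodicity\<close>

lemma basically_simple_imp_cofinal:
  assumes simple: "basically_simple TYPE('r::comm_ring_1) \<Lambda>"
  shows "cofinal_kgraph \<Lambda>"
proof (rule ccontr)
  assume "\<not> cofinal_kgraph \<Lambda>"
  then obtain v X where v: "v \<in> vertices \<Lambda>" and X: "tight X"
    and not: "\<And>\<alpha> \<kappa>. \<alpha> \<in> X \<Longrightarrow> \<kappa> \<in> M \<Longrightarrow> rng \<kappa> = v \<Longrightarrow> src \<kappa> \<noteq> src \<alpha>"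
    unfolding cofinal_iff by blast
  \<comment> \<open>The boundary paths that \<open>v\<close> does not reach. The filter
    \<open>X\<close> is one of them, so the kernel is not everything; no member contains
    \<open>v\<close>, since \<open>v\<close> reaches itself, so the kernel contains the generator of
    \<open>v\<close>.\<close>
  define \<T> where "\<T> = {Y. tight Y \<and> (\<forall>\<alpha>\<in>Y. \<forall>\<kappa>\<in>M. rng \<kappa> = v \<longrightarrow> src \<kappa> \<noteq> src \<alpha>)}"
  define J where "J = (annihilator 0 \<T> :: ('a gen word \<Rightarrow>\<^sub>0 'r) set)"
  have inv: "invariant \<T>"
    unfolding invariant_def
  proof (intro ballI conjI impI)
    fix Y assume Y: "Y \<in> \<T>"
    then show tight: "tight Y"
      by (simp add: \<T>_def)
    show "shift \<alpha> Y \<in> \<T>" if \<alpha>: "\<alpha> \<in> Y" for \<alpha>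
    proof -
      have "src \<kappa> \<noteq> src \<beta>" if "\<beta> \<in> shift \<alpha> Y" "\<kappa> \<in> M" "rng \<kappa> = v" for \<beta> \<kappa>
      proof -
        have "\<alpha> \<cdot> \<beta> \<in> Y" "src (\<alpha> \<cdot> \<beta>) = src \<beta>"
          using that tight_M[OF tight \<alpha>] by (auto simp: shift_def)
        then show ?thesis
          using Y that unfolding \<T>_def by fastforce
      qed
      then show ?thesis
        using tight_shift[OF tight \<alpha>] by (simp add: \<T>_def)
    qed
    show "prepend \<alpha> Y \<in> \<T>" if \<alpha>: "\<alpha> \<in> M" "src \<alpha> \<in> Y" for \<alpha>
    proof -
      have "src \<kappa> \<noteq> src \<beta>" if \<beta>: "\<beta> \<in> prepend \<alpha> Y" "\<kappa> \<in> M" "rng \<kappa> = v" for \<beta> \<kappa>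
      proof
        assume eq: "src \<kappa> = src \<beta>"
        obtain \<delta> where \<delta>: "\<delta> \<in> Y" "\<beta> \<preceq> \<alpha> \<cdot> \<delta>"
          using \<beta> by (auto simp: prepend_def)
        obtain \<gamma> where \<gamma>: "\<gamma> \<in> M" "src \<beta> = rng \<gamma>" "\<alpha> \<cdot> \<delta> = \<beta> \<cdot> \<gamma>" "\<beta> \<in> M"
          using \<delta>(2) by (elim prefixE)
        \<comment> \<open>If \<open>v\<close> reached the segment \<beta> of \<alpha>\<delta> =
          \<beta>\<gamma> by \<kappa>, then it would reach \<delta>, and so \<open>Y\<close>, by
          \<kappa>\<gamma>.\<close>
        have "src \<delta> = src \<gamma>"
          using \<gamma> \<alpha> tight_M[OF tight \<delta>(1)] tight_vertex[OF tight _ \<alpha>(2) \<delta>(1)] by (metis sr_cmp src_in_vertices)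
        then have "src (\<kappa> \<cdot> \<gamma>) = src \<delta>" "\<kappa> \<cdot> \<gamma> \<in> M" "rng (\<kappa> \<cdot> \<gamma>) = v"
          using eq \<gamma> \<beta> by auto
        then show False
          using Y \<delta>(1) unfolding \<T>_def by blast
      qed
      then show ?thesis
        using tight_prepend[OF \<alpha>(1) tight \<alpha>(2)] by (simp add: \<T>_def)
    qed
  qed
  have "v \<notin> Y" if "Y \<in> \<T>" for Y
    using that v vertices_M rng_vertex by (auto simp: \<T>_def)
  then have "gen (Path v) \<in> J"
    unfolding J_def using vertex_annihilator_1[OF inv v] by blast
  moreover have "gen (Path v) \<notin> kp_ideal \<Lambda>"
    using vertex_not_kp_ideal[OF v] .
  ultimately have "J = fc"
    using simple basic_annihilator[OF inv, where c = 0] unfolding basically_simple_iff J_def by blast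
  obtain \<alpha> where \<alpha>: "\<alpha> \<in> X"
    using tight_nonempty[OF X] by blast
  then have "rng \<alpha> \<in> vertices \<Lambda>" "rng \<alpha> \<in> X" "X \<in> \<T>"
    using tight_M[OF X] tight_rng_in[OF X] X not by (auto simp: \<T>_def)
  then have "gen (Path (rng \<alpha>)) \<notin> J"
    unfolding J_def using vertex_annihilator_1[OF inv] by blast
  then show False
    using \<open>J = fc\<close> tight_M[OF X \<alpha>] by simp
qed

lemma basically_simple_imp_separable:
  assumes simple: "basically_simple TYPE('r::comm_ring_1) \<Lambda>"
  shows separable
proof (rule ccontr)
  assume "\<not> separable"
  then obtain \<xi> \<mu> where \<xi>: "\<xi> \<in> M" "\<mu> \<in> M" "src \<xi> = src \<mu>" "\<xi> \<noteq> \<mu>"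
    and compat: "\<And>\<nu>. \<nu> \<in> M \<Longrightarrow> rng \<nu> = src \<xi> \<Longrightarrow> compat (\<xi> \<cdot> \<nu>) (\<mu> \<cdot> \<nu>)"
    unfolding separable_def by blast
  define a :: "'a gen word \<Rightarrow>\<^sub>0 'r" where "a = gen (Path \<xi>) - gen (Path \<mu>)"
  have eq: "prepend \<xi> Y = prepend \<mu> Y" if "tight Y" "src \<xi> \<in> Y" for Y
    using prepend_eq[OF \<xi>(1-3) that compat] .
  \<comment> \<open>A filter through \<xi> has the form \<xi>Y, which is \<mu>Y by
    \<open>prepend_eq\<close>. Thus both generators act on boundary paths by the same partial
    map.\<close>
  have "\<xi> \<in> X \<longleftrightarrow> \<mu> \<in> X" and "\<xi> \<in> X \<Longrightarrow> shift \<xi> X = shift \<mu> X" if X: "tight X" for X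
  proof -
    have *: "\<mu> \<in> X \<and> shift \<mu> X = shift \<xi> X" if "\<xi> \<in> X"
      using eq[of "shift \<xi> X"] tight_shift[OF X that] src_in_shift[OF X that] prepend_shift[OF X that]
        shift_prepend[OF \<xi>(2), of "shift \<xi> X"] prepend_self[OF \<xi>(2), of "shift \<xi> X"] \<xi>(3) by simp
    have "\<xi> \<in> X" if "\<mu> \<in> X"
      using eq[of "shift \<mu> X"] tight_shift[OF X that] src_in_shift[OF X that] prepend_shift[OF X that]
        prepend_self[OF \<xi>(1), of "shift \<mu> X"] \<xi>(3) by simp
    with * show "\<xi> \<in> X \<longleftrightarrow> \<mu> \<in> X" "\<xi> \<in> X \<Longrightarrow> shift \<xi> X = shift \<mu> X"
      by auto
  qed
  then have ann: "a \<in> annihilator 0 {X. tight X}"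
    using \<xi> by (auto simp: annihilator_def a_def)
  obtain Y where Y: "tight Y" "src \<xi> \<in> Y"
    using tight_exists[of "src \<xi>"] \<xi> by auto
  define X where "X = prepend \<xi> Y"
  have X: "tight X" "\<xi> \<in> X" "\<mu> \<in> X" "shift \<xi> X = Y" "shift \<mu> X = Y"
    using tight_prepend[OF \<xi>(1) Y] prepend_self[OF \<xi>(1) Y] prepend_self[OF \<xi>(2), of Y]
      shift_prepend[OF \<xi>(1) Y] shift_prepend[OF \<xi>(2), of Y] eq[OF Y] Y \<xi>(3) by (auto simp: X_def)
  \<comment> \<open>Both paths lie in \<open>X\<close>, and a tight filter has only one member of
    each degree.\<close>
  have "deg \<xi> \<noteq> deg \<mu>"
    using tight_deg_eq[OF X(1-3)] \<xi>(4) by blast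
  moreover have "deg \<xi> = deg \<mu>" if "(\<lambda>i. - int (deg \<mu> i)) = (\<lambda>i. - int (deg \<xi> i))"
    using that by (simp add: fun_eq_iff)
  ultimately have "(\<lambda>i. - int (deg \<mu> i)) \<noteq> (\<lambda>i. - int (deg \<xi> i))"
    by blast
  \<comment> \<open>The test function is the indicator of the vector reached from 0 by \<xi>. The
    path \<mu> leads to the same filter but to another vector, so only the first term of
    \<open>a\<close> contributes.\<close>
  then have "act 1 a (\<lambda>y. if snd y = (\<lambda>i. - int (deg \<xi> i)) then 1 else 0) (X, \<lambda>i. 0) = 1"
    using X by (simp add: a_def)
  then have "a \<notin> annihilator 1 {X. tight X}"
    using X(1) zero_neq_one unfolding annihilator_def by force
  then have "a \<notin> kp_ideal \<Lambda>"
    using kp_ideal_annihilator[OF invariant_tight] by blast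
  then have "annihilator 0 {X. tight X} = (fc :: ('a gen word \<Rightarrow>\<^sub>0 'r) set)"
    using simple basic_annihilator[OF invariant_tight, where c = 0] ann unfolding basically_simple_iff by blast
  then have "(gen (Path (src \<xi>)) :: 'a gen word \<Rightarrow>\<^sub>0 'r) \<in> annihilator 0 {X. tight X}"
    using \<xi> by simp
  then show False
    using vertex_annihilator_1[OF invariant_tight, of "src \<xi>"] \<xi> Y by auto
qed

end

section \<open>Calculations modulo the relations\<close>

context fa_kgraph
begin

text \<open>The parameter \<open>R\<close> only fixes the type \<open>'r\<close> of coefficients throughout the calculations.\<close>

context
  fixes R :: "'r::comm_ring_1 itself"
begin

text \<open>Congruence modulo the ideal of the unital ring from \<open>two_sided_proj\<close>; on
  \<open>fc\<close> it is equality in the Kumjian-Pask algebra. The projection makes the unit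
  usable, as in \<open>1 - pr n\<close>.\<close>

definition eqv :: "('a gen word \<Rightarrow>\<^sub>0 'r) \<Rightarrow> ('a gen word \<Rightarrow>\<^sub>0 'r) \<Rightarrow> bool" (infix "\<approx>" 50) where
  "a \<approx> b \<longleftrightarrow> proj (generators \<Lambda>) (a - b) \<in> kp_ideal \<Lambda>"

lemma two_sided_rel: "two_sided {f :: 'a gen word \<Rightarrow>\<^sub>0 'r. proj (generators \<Lambda>) f \<in> kp_ideal \<Lambda>}"
  by (intro two_sided_proj kp_ideal_fideal)

lemmas rel = two_sidedD[OF two_sided_rel, simplified]

lemma eqv_0_iff: "a \<in> fc \<Longrightarrow> a \<approx> 0 \<longleftrightarrow> a \<in> kp_ideal \<Lambda>"
  by (simp add: eqv_def proj_fcarrier)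

lemma eqv_refl [simp]: "a \<approx> a"
  using rel(1) by (simp add: eqv_def)

lemma eqv_sym: "a \<approx> b \<Longrightarrow> b \<approx> a"
  using rel(5)[of "a - b"] by (simp add: eqv_def)

lemma eqv_trans [trans]: "a \<approx> b \<Longrightarrow> b \<approx> c \<Longrightarrow> a \<approx> c"
  using rel(2)[of "a - b" "b - c"] by (simp add: eqv_def)

lemma eqv_add: "a \<approx> b \<Longrightarrow> a' \<approx> b' \<Longrightarrow> a + a' \<approx> b + b'"
  using rel(2)[of "a - b" "a' - b'"] by (simp add: eqv_def add_diff_add)

lemma eqv_diff: "a \<approx> b \<Longrightarrow> a' \<approx> b' \<Longrightarrow> a - a' \<approx> b - b'"
  using rel(6)[of "a - b" "a' - b'"] by (simp add: eqv_def algebra_simps)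

lemma eqv_mult: "a \<approx> b \<Longrightarrow> a' \<approx> b' \<Longrightarrow> a * a' \<approx> b * b'"
  using rel(2)[OF rel(4)[of "a - b" a'] rel(3)[of "a' - b'" b]] by (simp add: eqv_def algebra_simps)

lemma eqv_mult_left: "a \<approx> b \<Longrightarrow> c * a \<approx> c * b"
  by (simp add: eqv_mult)

lemma eqv_mult_right: "a \<approx> b \<Longrightarrow> a * c \<approx> b * c"
  by (simp add: eqv_mult)

lemma eqv_sum: "(\<And>i. i \<in> I \<Longrightarrow> f i \<approx> g i) \<Longrightarrow> (\<Sum>i\<in>I. f i) \<approx> (\<Sum>i\<in>I. g i)"
  by (induction I rule: infinite_finite_induct) (auto intro: eqv_add)

lemma eqv_sum_0: "(\<And>i. i \<in> I \<Longrightarrow> f i \<approx> 0) \<Longrightarrow> (\<Sum>i\<in>I. f i) \<approx> 0"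
  using eqv_sum[of I f "\<lambda>_. 0"] by simp

lemma relators_eqv: "a \<in> kp_relators \<Lambda> \<Longrightarrow> a \<approx> 0"
  using subsetD[OF relators_kp_ideal, of a] subsetD[OF relators_fc, of a] eqv_0_iff by blast

lemma relators_eqv_diff: "a - b \<in> kp_relators \<Lambda> \<Longrightarrow> a \<approx> b"
  using relators_eqv[of "a - b"] by (simp add: eqv_def)

section \<open>Products of paths, ghost paths and range projections\<close>

abbreviation S :: "'a \<Rightarrow> 'a gen word \<Rightarrow>\<^sub>0 'r" where "S \<alpha> \<equiv> gen (Path \<alpha>)"
abbreviation S' :: "'a \<Rightarrow> 'a gen word \<Rightarrow>\<^sub>0 'r" where "S' \<alpha> \<equiv> gen (star \<Lambda> \<alpha>)"
abbreviation pr :: "'a \<Rightarrow> 'a gen word \<Rightarrow>\<^sub>0 'r" where "pr \<alpha> \<equiv> S \<alpha> * S' \<alpha>"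

lemma S_S: "\<alpha> \<in> M \<Longrightarrow> \<beta> \<in> M \<Longrightarrow> src \<alpha> = rng \<beta> \<Longrightarrow> S \<alpha> * S \<beta> \<approx> S (\<alpha> \<cdot> \<beta>)"
  by (intro relators_eqv_diff kp_relators.KP2)

lemma S'_S': "\<alpha> \<in> M \<Longrightarrow> \<beta> \<in> M \<Longrightarrow> src \<alpha> = rng \<beta> \<Longrightarrow> S' \<beta> * S' \<alpha> \<approx> S' (\<alpha> \<cdot> \<beta>)"
  by (intro relators_eqv_diff kp_relators.KP2_star)

lemma S_src: "\<alpha> \<in> M \<Longrightarrow> S \<alpha> * S (src \<alpha>) \<approx> S \<alpha>"
  using S_S[of \<alpha> "src \<alpha>"] by simp

lemma rng_S: "\<alpha> \<in> M \<Longrightarrow> S (rng \<alpha>) * S \<alpha> \<approx> S \<alpha>"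
  using S_S[of "rng \<alpha>" \<alpha>] by simp

lemma src_S': "\<alpha> \<in> M \<Longrightarrow> S (src \<alpha>) * S' \<alpha> \<approx> S' \<alpha>"
  using S'_S'[of \<alpha> "src \<alpha>"] by (simp add: star_vertex)

lemma S'_rng: "\<alpha> \<in> M \<Longrightarrow> S' \<alpha> * S (rng \<alpha>) \<approx> S' \<alpha>"
  using S'_S'[of "rng \<alpha>" \<alpha>] by (simp add: star_vertex)

lemma vertex_orth: "v \<in> vertices \<Lambda> \<Longrightarrow> w \<in> vertices \<Lambda> \<Longrightarrow> v \<noteq> w \<Longrightarrow> S v * S w \<approx> 0"
  by (intro relators_eqv kp_relators.KP1_orth)

lemma S_S_0:
  assumes "\<alpha> \<in> M" "\<beta> \<in> M" "src \<alpha> \<noteq> rng \<beta>"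
  shows "S \<alpha> * S \<beta> \<approx> 0"
proof -
  have "S \<alpha> * S \<beta> \<approx> (S \<alpha> * S (src \<alpha>)) * (S (rng \<beta>) * S \<beta>)"
    using assms by (intro eqv_mult eqv_sym[OF S_src] eqv_sym[OF rng_S])
  also have "\<dots> = S \<alpha> * (S (src \<alpha>) * S (rng \<beta>)) * S \<beta>"
    by (simp add: mult.assoc)
  also have "\<dots> \<approx> S \<alpha> * 0 * S \<beta>"
    using assms by (intro eqv_mult vertex_orth eqv_refl) auto
  finally show ?thesis
    by simp
qed

lemma S'_S:
  "\<alpha> \<in> M \<Longrightarrow> \<mu> \<in> M \<Longrightarrow> S' \<alpha> * S \<mu> \<approx> (\<Sum>(\<rho>, \<tau>)\<in>Lmin \<Lambda> \<alpha> \<mu>. S \<rho> * S' \<tau>)"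
  by (intro relators_eqv_diff kp_relators.KP3)

lemma S'_S_0: "\<alpha> \<in> M \<Longrightarrow> \<mu> \<in> M \<Longrightarrow> \<not> compat \<alpha> \<mu> \<Longrightarrow> S' \<alpha> * S \<mu> \<approx> 0"
  using S'_S[of \<alpha> \<mu>] Lmin_nonempty_iff[of \<alpha> \<mu>] by simp

lemma S'_S_prefix:
  assumes "\<alpha> \<in> M" "\<gamma> \<in> M" "src \<alpha> = rng \<gamma>"
  shows "S' \<alpha> * S (\<alpha> \<cdot> \<gamma>) \<approx> S \<gamma>"
proof -
  have "S' \<alpha> * S (\<alpha> \<cdot> \<gamma>) \<approx> S \<gamma> * S (src \<gamma>)"
    using S'_S[of \<alpha> "\<alpha> \<cdot> \<gamma>"] assms by (simp add: Lmin_prefix star_vertex)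
  also have "\<dots> \<approx> S \<gamma>"
    using assms by (intro S_src)
  finally show ?thesis .
qed

lemma S'_S_same: "\<alpha> \<in> M \<Longrightarrow> S' \<alpha> * S \<alpha> \<approx> S (src \<alpha>)"
  using S'_S_prefix[of \<alpha> "src \<alpha>"] by simp

lemma pr_S_prefix:
  assumes "n \<preceq> \<kappa>"
  shows "pr n * S \<kappa> \<approx> S \<kappa>"
proof -
  obtain \<gamma> where \<gamma>: "n \<in> M" "\<gamma> \<in> M" "src n = rng \<gamma>" "\<kappa> = n \<cdot> \<gamma>"
    using assms by (elim prefixE)
  have "pr n * S \<kappa> = S n * (S' n * S (n \<cdot> \<gamma>))"
    by (simp add: \<gamma> mult.assoc)
  also have "\<dots> \<approx> S n * S \<gamma>"
    using \<gamma> by (intro eqv_mult_left S'_S_prefix)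
  also have "\<dots> \<approx> S \<kappa>"
    unfolding \<gamma>(4) using \<gamma> by (intro S_S)
  finally show ?thesis .
qed

lemma pr_S_incompat:
  assumes "n \<in> M" "\<kappa> \<in> M" "\<not> compat n \<kappa>"
  shows "pr n * S \<kappa> \<approx> 0"
  using eqv_mult_left[OF S'_S_0[OF assms], of "S n"] by (simp add: mult.assoc)

lemma pr_S:
  assumes "n \<in> M" "\<kappa> \<in> M"
  shows "pr n * S \<kappa> \<approx> (\<Sum>(\<rho>, \<tau>)\<in>Lmin \<Lambda> n \<kappa>. S (\<kappa> \<cdot> \<tau>) * S' \<tau>)"
proof -
  have "pr n * S \<kappa> \<approx> S n * (\<Sum>(\<rho>, \<tau>)\<in>Lmin \<Lambda> n \<kappa>. S \<rho> * S' \<tau>)"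
    unfolding mult.assoc using assms by (intro eqv_mult_left S'_S)
  also have "\<dots> = (\<Sum>(\<rho>, \<tau>)\<in>Lmin \<Lambda> n \<kappa>. S n * S \<rho> * S' \<tau>)"
    by (simp add: sum_distrib_left mult.assoc case_prod_beta)
  also have "\<dots> \<approx> (\<Sum>(\<rho>, \<tau>)\<in>Lmin \<Lambda> n \<kappa>. S (\<kappa> \<cdot> \<tau>) * S' \<tau>)"
  proof (intro eqv_sum, clarify)
    fix \<rho> \<tau> assume "(\<rho>, \<tau>) \<in> Lmin \<Lambda> n \<kappa>"
    then have "\<rho> \<in> M" "src n = rng \<rho>" "n \<cdot> \<rho> = \<kappa> \<cdot> \<tau>"
      using assms by (auto simp: Lmin_iff)
    then show "S n * S \<rho> * S' \<tau> \<approx> S (\<kappa> \<cdot> \<tau>) * S' \<tau>"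
      using S_S[of n \<rho>] assms by (intro eqv_mult_right) simp
  qed
  finally show ?thesis .
qed

lemma pr_pr:
  assumes "n \<in> M" "m \<in> M"
  shows "pr n * pr m \<approx> (\<Sum>(\<rho>, \<tau>)\<in>Lmin \<Lambda> n m. S (m \<cdot> \<tau>) * S' (m \<cdot> \<tau>))"
proof -
  have "pr n * pr m = pr n * S m * S' m"
    by (simp add: mult.assoc)
  also have "\<dots> \<approx> (\<Sum>(\<rho>, \<tau>)\<in>Lmin \<Lambda> n m. S (m \<cdot> \<tau>) * S' \<tau>) * S' m"
    using assms by (intro eqv_mult_right pr_S)
  also have "\<dots> = (\<Sum>(\<rho>, \<tau>)\<in>Lmin \<Lambda> n m. S (m \<cdot> \<tau>) * (S' \<tau> * S' m))"
    by (simp add: sum_distrib_right mult.assoc case_prod_beta)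
  also have "\<dots> \<approx> (\<Sum>(\<rho>, \<tau>)\<in>Lmin \<Lambda> n m. S (m \<cdot> \<tau>) * S' (m \<cdot> \<tau>))"
    using assms by (intro eqv_sum) (auto simp: Lmin_iff intro!: eqv_mult_left S'_S')
  finally show ?thesis .
qed

text \<open>Both products are the sum of the range projections of the minimal common extensions, and
  \<open>Lmin\<close> is symmetric.\<close>

lemma pr_commute:
  assumes "n \<in> M" "m \<in> M"
  shows "pr n * pr m \<approx> pr m * pr n"
proof -
  have "pr n * pr m \<approx> (\<Sum>(\<rho>, \<tau>)\<in>Lmin \<Lambda> n m. S (m \<cdot> \<tau>) * S' (m \<cdot> \<tau>))"
    by (rule pr_pr[OF assms])
  also have "\<dots> = (\<Sum>(\<tau>, \<rho>)\<in>Lmin \<Lambda> m n. S (n \<cdot> \<rho>) * S' (n \<cdot> \<rho>))"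
    by (rule sum.reindex_bij_witness[of _ prod.swap prod.swap])
      (auto simp: Lmin_swap[OF assms], auto simp: Lmin_iff[OF assms(2,1)])
  also have "\<dots> \<approx> pr m * pr n"
    by (rule eqv_sym[OF pr_pr[OF assms(2,1)]])
  finally show ?thesis .
qed

text \<open>\<open>Qprod N\<close> is the projection onto the complement of the cylinders of the paths in \<open>N\<close>.\<close>

primrec Qprod :: "'a list \<Rightarrow> 'a gen word \<Rightarrow>\<^sub>0 'r" where
  "Qprod [] = 1"
| "Qprod (n # N) = Qprod N * (1 - pr n)"

text \<open>A case distinction on \<mu>: the first term is the part of \<open>S \<tau>\<close>
  outside the cylinder of \<mu>, the sum is the part inside, where \<tau> has been lengthened to an
  extension of \<mu>.\<close>

lemma Qprod_step:
  assumes "\<mu> \<in> M" "\<tau> \<in> M"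
  shows "a * Qprod N * S \<tau> \<approx>
    a * Qprod (\<mu> # N) * S \<tau> + (\<Sum>(\<rho>, \<sigma>)\<in>Lmin \<Lambda> \<mu> \<tau>. a * Qprod N * S (\<tau> \<cdot> \<sigma>) * S' \<sigma>)"
proof -
  have "a * Qprod N * S \<tau> = a * Qprod (\<mu> # N) * S \<tau> + a * Qprod N * (pr \<mu> * S \<tau>)"
    by (simp add: algebra_simps)
  also have "\<dots> \<approx> a * Qprod (\<mu> # N) * S \<tau> +
      a * Qprod N * (\<Sum>(\<rho>, \<sigma>)\<in>Lmin \<Lambda> \<mu> \<tau>. S (\<tau> \<cdot> \<sigma>) * S' \<sigma>)"
    using assms by (intro eqv_add eqv_refl eqv_mult_left pr_S)
  also have "\<dots> = a * Qprod (\<mu> # N) * S \<tau> +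
      (\<Sum>(\<rho>, \<sigma>)\<in>Lmin \<Lambda> \<mu> \<tau>. a * Qprod N * S (\<tau> \<cdot> \<sigma>) * S' \<sigma>)"
    by (simp add: sum_distrib_left mult.assoc case_prod_beta)
  finally show ?thesis .
qed

text \<open>If the factor next to \<open>S \<tau>\<close> belongs to a segment of \<tau>, it kills
  \<open>S \<tau>\<close>. Otherwise it produces \<open>S \<tau>\<close> and terms starting with
  longer paths \<tau>\<sigma>; these still extend \<open>n\<close>, which occurs in the rest of the
  list.\<close>

lemma Qprod_kill:
  assumes "n \<in> set N" "set N \<subseteq> M" "n \<preceq> \<tau>"
  shows "Qprod N * S \<tau> \<approx> 0"
  using assms
proof (induction N arbitrary: \<tau>)
  case (Cons m N)
  have \<tau>: "\<tau> \<in> M"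
    using Cons.prems prefix_M by blast
  have eq: "Qprod (m # N) * S \<tau> = Qprod N * (S \<tau> - pr m * S \<tau>)"
    by (simp add: algebra_simps)
  show ?case
  proof (cases "m \<preceq> \<tau>")
    case True
    then have "Qprod (m # N) * S \<tau> \<approx> Qprod N * (S \<tau> - S \<tau>)"
      unfolding eq by (intro eqv_mult_left eqv_diff eqv_refl pr_S_prefix)
    then show ?thesis
      by simp
  next
    case False
    then have n: "n \<in> set N"
      using Cons.prems by auto
    have "Qprod N * S \<tau> \<approx> 0"
      using Cons.IH[OF n _ Cons.prems(3)] Cons.prems by simp
    moreover have "Qprod N * (pr m * S \<tau>) \<approx> 0"
    proof -
      have "Qprod N * (pr m * S \<tau>) \<approx> Qprod N * (\<Sum>(\<rho>, \<sigma>)\<in>Lmin \<Lambda> m \<tau>. S (\<tau> \<cdot> \<sigma>) * S' \<sigma>)"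
        using Cons.prems \<tau> by (intro eqv_mult_left pr_S) auto
      also have "\<dots> = (\<Sum>(\<rho>, \<sigma>)\<in>Lmin \<Lambda> m \<tau>. Qprod N * S (\<tau> \<cdot> \<sigma>) * S' \<sigma>)"
        by (simp add: sum_distrib_left mult.assoc case_prod_beta)
      also have "\<dots> \<approx> 0"
      proof (intro eqv_sum_0, clarify)
        fix \<rho> \<sigma> assume "(\<rho>, \<sigma>) \<in> Lmin \<Lambda> m \<tau>"
        then have "\<tau> \<preceq> \<tau> \<cdot> \<sigma>"
          using Cons.prems \<tau> by (intro prefixI) (auto simp: Lmin_iff)
        then have "Qprod N * S (\<tau> \<cdot> \<sigma>) \<approx> 0"
          using Cons.IH[OF n] Cons.prems prefix_trans[of n \<tau>] by simp
        then show "Qprod N * S (\<tau> \<cdot> \<sigma>) * S' \<sigma> \<approx> 0"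
          using eqv_mult_right by fastforce
      qed
      finally show ?thesis .
    qed
    ultimately show ?thesis
      unfolding eq right_diff_distrib using eqv_diff by fastforce
  qed
qed simp

lemma Qprod_fix:
  assumes "set N \<subseteq> M" "\<tau> \<in> M" "\<And>n. n \<in> set N \<Longrightarrow> \<not> compat n \<tau>"
  shows "Qprod N * S \<tau> \<approx> S \<tau>"
  using assms
proof (induction N)
  case (Cons n N)
  have "Qprod (n # N) * S \<tau> = Qprod N * (S \<tau> - pr n * S \<tau>)"
    by (simp add: algebra_simps)
  also have "\<dots> \<approx> Qprod N * (S \<tau> - 0)"
    using Cons.prems by (intro eqv_mult_left eqv_diff eqv_refl pr_S_incompat) auto
  also have "\<dots> \<approx> S \<tau>"
    using Cons by simp
  finally show ?case .
qed simp

lemma Qprod_commute: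
  assumes "set N \<subseteq> M" "\<tau> \<in> M"
  shows "pr \<tau> * Qprod N \<approx> Qprod N * pr \<tau>"
  using assms
proof (induction N)
  case (Cons n N)
  have "pr \<tau> * Qprod (n # N) = pr \<tau> * Qprod N * (1 - pr n)"
    by (simp add: mult.assoc)
  also have "\<dots> \<approx> Qprod N * pr \<tau> * (1 - pr n)"
    using Cons by (intro eqv_mult_right) simp
  also have "\<dots> = Qprod N * (pr \<tau> - pr \<tau> * pr n)"
    by (simp add: algebra_simps)
  also have "\<dots> \<approx> Qprod N * (pr \<tau> - pr n * pr \<tau>)"
    using Cons.prems by (intro eqv_mult_left eqv_diff eqv_refl pr_commute) auto
  also have "\<dots> = Qprod (n # N) * pr \<tau>"
    by (simp add: algebra_simps)
  finally show ?case .
qed simp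

text \<open>Since \<open>S' \<mu>\<close> absorbs \<open>pr \<mu>\<close>, that projection can be
  inserted and moved past \<open>Qprod N\<close>, where it leaves \<open>Qprod N * S \<mu>\<close>,
  which vanishes.\<close>

lemma S'_Qprod:
  assumes "\<mu> \<in> set N" "set N \<subseteq> M"
  shows "S' \<mu> * Qprod N \<approx> 0"
proof -
  have \<mu>: "\<mu> \<in> M"
    using assms by auto
  have "S' \<mu> \<approx> S' \<mu> * S \<mu> * S' \<mu>"
    by (rule eqv_trans[OF eqv_sym[OF src_S'[OF \<mu>]] eqv_mult_right[OF eqv_sym[OF S'_S_same[OF \<mu>]]]])
  then have "S' \<mu> * Qprod N \<approx> S' \<mu> * S \<mu> * S' \<mu> * Qprod N"
    by (rule eqv_mult_right)
  also have "\<dots> = S' \<mu> * (pr \<mu> * Qprod N)"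
    by (simp add: mult.assoc)
  also have "\<dots> \<approx> S' \<mu> * (Qprod N * pr \<mu>)"
    using assms(2) \<mu> by (intro eqv_mult_left Qprod_commute)
  also have "\<dots> = S' \<mu> * (Qprod N * S \<mu>) * S' \<mu>"
    by (simp add: mult.assoc)
  also have "\<dots> \<approx> S' \<mu> * 0 * S' \<mu>"
    using assms \<mu> by (intro eqv_mult_left eqv_mult_right Qprod_kill) auto
  finally show ?thesis
    by simp
qed

text \<open>This brings \<open>S \<tau>\<close> to the front, where it can cancel ghosts, and leaves
  a compressed projection on the right.\<close>

lemma Qprod_S:
  assumes "set N \<subseteq> M" "\<tau> \<in> M"
  shows "Qprod N * S \<tau> \<approx> S \<tau> * (S' \<tau> * Qprod N * S \<tau>)"
proof -
  have "Qprod N * S \<tau> \<approx> Qprod N * (pr \<tau> * S \<tau>)"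
    using assms by (intro eqv_mult_left eqv_sym[OF pr_S_prefix]) simp
  also have "\<dots> = (Qprod N * pr \<tau>) * S \<tau>"
    by (simp add: mult.assoc)
  also have "\<dots> \<approx> (pr \<tau> * Qprod N) * S \<tau>"
    using assms by (intro eqv_mult_right eqv_sym[OF Qprod_commute])
  finally show ?thesis
    by (simp add: mult.assoc)
qed

subsection \<open>Spanning monomials\<close>

text \<open>Closing under congruence as well as addition lets properties of all elements be proved
  by induction on the monomials alone.\<close>

inductive spanned :: "('a gen word \<Rightarrow>\<^sub>0 'r) \<Rightarrow> bool" where
  zero: "spanned 0"
| mono: "\<xi> \<in> M \<Longrightarrow> \<mu> \<in> M \<Longrightarrow> src \<xi> = src \<mu> \<Longrightarrow> spanned (scal c * (S \<xi> * S' \<mu>))"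
| add: "spanned a \<Longrightarrow> spanned b \<Longrightarrow> spanned (a + b)"
| eqv: "spanned a \<Longrightarrow> a \<approx> b \<Longrightarrow> spanned b"

lemma spanned_sum: "(\<And>i. i \<in> I \<Longrightarrow> spanned (f i)) \<Longrightarrow> spanned (\<Sum>i\<in>I. f i)"
  by (induction I rule: infinite_finite_induct) (auto intro: spanned.zero spanned.add)

lemma S_mult_spanned:
  assumes "spanned a" "\<alpha> \<in> M"
  shows "spanned (S \<alpha> * a)"
  using assms(1)
proof induction
  case (mono \<xi> \<mu> c)
  have eq: "S \<alpha> * (scal c * (S \<xi> * S' \<mu>)) = scal c * (S \<alpha> * S \<xi> * S' \<mu>)"
    by (simp only: scal_left_commute mult.assoc)
  show ?case
  proof (cases "src \<alpha> = rng \<xi>")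
    case True
    then have "scal c * (S (\<alpha> \<cdot> \<xi>) * S' \<mu>) \<approx> S \<alpha> * (scal c * (S \<xi> * S' \<mu>))"
      unfolding eq using mono assms(2) by (intro eqv_mult_left eqv_mult_right eqv_sym[OF S_S])
    moreover have "spanned (scal c * (S (\<alpha> \<cdot> \<xi>) * S' \<mu>))"
      using mono assms(2) True by (intro spanned.mono) auto
    ultimately show ?thesis
      by (rule spanned.eqv[rotated])
  next
    case False
    then have "scal c * (0 * S' \<mu>) \<approx> S \<alpha> * (scal c * (S \<xi> * S' \<mu>))"
      unfolding eq using mono assms(2) by (intro eqv_mult_left eqv_mult_right eqv_sym[OF S_S_0])
    then show ?thesis
      using spanned.eqv[OF spanned.zero] by simp
  qed
next
  case zero
  then show ?case
    by (simp add: spanned.zero)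
next
  case (add a b)
  then show ?case
    by (simp add: distrib_left spanned.add)
next
  case (eqv a b)
  then show ?case
    by (blast intro: spanned.eqv eqv_mult_left)
qed

lemma S'_mult_spanned:
  assumes "spanned a" "\<alpha> \<in> M"
  shows "spanned (S' \<alpha> * a)"
  using assms(1)
proof induction
  case (mono \<xi> \<mu> c)
  have "S' \<alpha> * (scal c * (S \<xi> * S' \<mu>)) = scal c * (S' \<alpha> * S \<xi> * S' \<mu>)"
    by (simp only: scal_left_commute mult.assoc)
  also have "\<dots> \<approx> scal c * ((\<Sum>(\<rho>, \<tau>)\<in>Lmin \<Lambda> \<alpha> \<xi>. S \<rho> * S' \<tau>) * S' \<mu>)"
    using mono assms(2) by (intro eqv_mult_left eqv_mult_right S'_S)
  also have "\<dots> = (\<Sum>(\<rho>, \<tau>)\<in>Lmin \<Lambda> \<alpha> \<xi>. scal c * (S \<rho> * (S' \<tau> * S' \<mu>)))"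
    by (simp add: sum_distrib_left sum_distrib_right mult.assoc case_prod_beta)
  also have "\<dots> \<approx> (\<Sum>(\<rho>, \<tau>)\<in>Lmin \<Lambda> \<alpha> \<xi>. scal c * (S \<rho> * S' (\<mu> \<cdot> \<tau>)))"
    using mono assms(2) by (intro eqv_sum) (auto simp: Lmin_iff intro!: eqv_mult_left S'_S')
  finally have "(\<Sum>(\<rho>, \<tau>)\<in>Lmin \<Lambda> \<alpha> \<xi>. scal c * (S \<rho> * S' (\<mu> \<cdot> \<tau>))) \<approx>
      S' \<alpha> * (scal c * (S \<xi> * S' \<mu>))"
    by (rule eqv_sym)
  moreover have "spanned (\<Sum>(\<rho>, \<tau>)\<in>Lmin \<Lambda> \<alpha> \<xi>. scal c * (S \<rho> * S' (\<mu> \<cdot> \<tau>)))"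
  proof (intro spanned_sum, clarify)
    fix \<rho> \<tau> assume "(\<rho>, \<tau>) \<in> Lmin \<Lambda> \<alpha> \<xi>"
    then have L: "\<rho> \<in> M" "\<tau> \<in> M" "src \<alpha> = rng \<rho>" "src \<xi> = rng \<tau>" "\<alpha> \<cdot> \<rho> = \<xi> \<cdot> \<tau>"
      using mono assms(2) by (auto simp: Lmin_iff)
    then have "src \<rho> = src \<tau>"
      using mono assms(2) by (metis sr_cmp)
    then show "spanned (scal c * (S \<rho> * S' (\<mu> \<cdot> \<tau>)))"
      using L mono by (intro spanned.mono) auto
  qed
  ultimately show ?case
    by (rule spanned.eqv[rotated])
next
  case zero
  then show ?case
    by (simp add: spanned.zero)
next
  case (add a b)
  then show ?case
    by (simp add: distrib_left spanned.add)
next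
  case (eqv a b)
  then show ?case
    by (blast intro: spanned.eqv eqv_mult_left)
qed

lemma scal_gen: "scal c * gen g = Poly_Mapping.single (Word [g]) c"
  by (simp add: gen_def mult_single)

lemma spanned_gen:
  assumes "g \<in> generators \<Lambda>"
  shows "spanned (scal c * gen g)"
  using assms
proof (cases rule: generators_cases)
  case (1 \<alpha>)
  have "spanned (scal c * (S \<alpha> * S' (src \<alpha>)))"
    using 1 by (intro spanned.mono) auto
  moreover have "scal c * (S \<alpha> * S' (src \<alpha>)) \<approx> scal c * gen g"
    using 1 S_src by (auto simp: star_vertex intro!: eqv_mult_left)
  ultimately show ?thesis
    by (rule spanned.eqv)
next
  case (2 \<alpha>)
  have "spanned (scal c * (S (src \<alpha>) * S' \<alpha>))"
    using 2 by (intro spanned.mono) auto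
  moreover have "scal c * (S (src \<alpha>) * S' \<alpha>) \<approx> scal c * gen g"
    using 2 src_S' by (auto intro!: eqv_mult_left)
  ultimately show ?thesis
    by (rule spanned.eqv)
qed

text \<open>Words are built up by multiplication from the left, where (KP3) keeps the form of a path
  followed by a ghost path. Words are nonempty, so the unit never has to be spanned.\<close>

lemma spanned_fc:
  assumes "a \<in> fc"
  shows "spanned a"
proof -
  have word: "spanned (Poly_Mapping.single (Word gs) c)" if "gs \<noteq> []" "set gs \<subseteq> generators \<Lambda>" for gs c
    using that
  proof (induction gs rule: list_nonempty_induct)
    case (single g)
    then show ?case
      using spanned_gen[of g c] by (simp add: scal_gen)
  next
    case (cons g gs)
    have eq: "Poly_Mapping.single (Word (g # gs)) c = gen g * Poly_Mapping.single (Word gs) c"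
      by (simp add: gen_def mult_single plus_word_def)
    have "g \<in> generators \<Lambda>" "spanned (Poly_Mapping.single (Word gs) c)"
      using cons by auto
    then show ?case
      unfolding eq by (metis generators_cases S_mult_spanned S'_mult_spanned)
  qed
  have "spanned (Poly_Mapping.single w c)" if "w \<in> Poly_Mapping.keys a" for w c
    using that assms word[of "letters w" c] by (cases w) (fastforce simp: fcarrier_iff zero_word_def)
  then show ?thesis
    by (subst poly_mapping_expand) (intro spanned_sum)
qed

text \<open>Finite sums of vertices are local units. Demanding the identity for all larger finite
  sets is what lets it pass to sums, where the two sets are united.\<close>

lemma spanned_local_unit:
  assumes "spanned a"
  shows "\<exists>V. finite V \<and> V \<subseteq> vertices \<Lambda> \<and>
    (\<forall>W. finite W \<and> V \<subseteq> W \<and> W \<subseteq> vertices \<Lambda> \<longrightarrow> (\<Sum>v\<in>W. a * S v) \<approx> a)"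
  using assms
proof induction
  case zero
  then show ?case
    by (intro exI[of _ "{}"]) simp
next
  case (mono \<xi> \<mu> c)
  have "(\<Sum>v\<in>W. scal c * (S \<xi> * S' \<mu>) * S v) \<approx> scal c * (S \<xi> * S' \<mu>)"
    if W: "finite W" "rng \<mu> \<in> W" "W \<subseteq> vertices \<Lambda>" for W
  proof -
    have *: "S' \<mu> * S v \<approx> (if v = rng \<mu> then S' \<mu> else 0)" if "v \<in> W" for v
    proof (cases "v = rng \<mu>")
      case True
      then show ?thesis
        using mono S'_rng by simp
    next
      case False
      have "S' \<mu> * S v \<approx> (S' \<mu> * S (rng \<mu>)) * S v"
        using mono by (intro eqv_mult_right eqv_sym[OF S'_rng])
      also have "\<dots> = S' \<mu> * (S (rng \<mu>) * S v)"
        by (simp add: mult.assoc)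
      also have "\<dots> \<approx> S' \<mu> * 0"
        using mono False that W by (intro eqv_mult_left vertex_orth) auto
      finally show ?thesis
        using False by simp
    qed
    have "(\<Sum>v\<in>W. scal c * (S \<xi> * S' \<mu>) * S v) = (\<Sum>v\<in>W. scal c * S \<xi> * (S' \<mu> * S v))"
      by (simp add: mult.assoc)
    also have "\<dots> \<approx> (\<Sum>v\<in>W. scal c * S \<xi> * (if v = rng \<mu> then S' \<mu> else 0))"
      using * by (intro eqv_sum eqv_mult_left)
    also have "\<dots> = scal c * S \<xi> * (\<Sum>v\<in>W. if v = rng \<mu> then S' \<mu> else 0)"
      by (simp only: sum_distrib_left)
    also have "\<dots> = scal c * (S \<xi> * S' \<mu>)"
      using W by (simp add: mult.assoc)
    finally show ?thesis .
  qed
  then show ?case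
    using mono by (intro exI[of _ "{rng \<mu>}"]) auto
next
  case (add a b)
  from add.IH(1) obtain V where V: "finite V" "V \<subseteq> vertices \<Lambda>"
    "\<forall>W. finite W \<and> V \<subseteq> W \<and> W \<subseteq> vertices \<Lambda> \<longrightarrow> (\<Sum>v\<in>W. a * S v) \<approx> a"
    by (elim exE conjE)
  from add.IH(2) obtain V' where V': "finite V'" "V' \<subseteq> vertices \<Lambda>"
    "\<forall>W. finite W \<and> V' \<subseteq> W \<and> W \<subseteq> vertices \<Lambda> \<longrightarrow> (\<Sum>v\<in>W. b * S v) \<approx> b"
    by (elim exE conjE)
  have "(\<Sum>v\<in>W. (a + b) * S v) \<approx> a + b" if "finite W" "V \<union> V' \<subseteq> W" "W \<subseteq> vertices \<Lambda>" for W
    unfolding distrib_right sum.distrib using V(3) V'(3) that by (intro eqv_add) auto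
  then show ?case
    using V V' by (intro exI[of _ "V \<union> V'"]) auto
next
  case (eqv a b)
  from eqv.IH obtain V where V: "finite V" "V \<subseteq> vertices \<Lambda>"
    "\<forall>W. finite W \<and> V \<subseteq> W \<and> W \<subseteq> vertices \<Lambda> \<longrightarrow> (\<Sum>v\<in>W. a * S v) \<approx> a"
    by (elim exE conjE)
  have "(\<Sum>v\<in>W. b * S v) \<approx> b" if "finite W" "V \<subseteq> W" "W \<subseteq> vertices \<Lambda>" for W
  proof -
    have "(\<Sum>v\<in>W. b * S v) \<approx> (\<Sum>v\<in>W. a * S v)"
      by (intro eqv_sum eqv_mult_right eqv_sym[OF eqv.hyps(2)])
    also have "\<dots> \<approx> a"
      using V that by simp
    also have "\<dots> \<approx> b"
      by (rule eqv.hyps(2))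
    finally show ?thesis .
  qed
  then show ?case
    using V by (intro exI[of _ V]) auto
qed

subsection \<open>Reduction to combinations of paths\<close>

text \<open>A condition on the formal element and not on its class: \<open>b = 0\<close> below means
  that all coefficients vanish.\<close>

definition path_combo :: "'a \<Rightarrow> ('a gen word \<Rightarrow>\<^sub>0 'r) \<Rightarrow> bool" where
  "path_combo w b \<longleftrightarrow> Poly_Mapping.keys b \<subseteq> {Word [Path \<xi>] | \<xi>. \<xi> \<in> M \<and> src \<xi> = w}"

lemma path_combo_zero: "path_combo w 0"
  by (simp add: path_combo_def)

lemma path_combo_add: "path_combo w a \<Longrightarrow> path_combo w b \<Longrightarrow> path_combo w (a + b)"
  unfolding path_combo_def using keys_add[of a b] by blast

lemma path_combo_S: "\<xi> \<in> M \<Longrightarrow> src \<xi> = w \<Longrightarrow> path_combo w (scal c * S \<xi>)"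
  unfolding path_combo_def scal_gen by auto

lemma path_combo_expand:
  assumes "path_combo w b"
  obtains L c where "finite L" "L \<subseteq> M" "src ` L \<subseteq> {w}" "\<And>\<xi>. \<xi> \<in> L \<Longrightarrow> c \<xi> \<noteq> 0"
    "b = (\<Sum>\<xi>\<in>L. scal (c \<xi>) * S \<xi>)"
proof
  define L where "L = {\<xi>. Word [Path \<xi>] \<in> Poly_Mapping.keys b}"
  define c where "c = (\<lambda>\<xi>. Poly_Mapping.lookup b (Word [Path \<xi>]))"
  have inj: "inj_on (\<lambda>\<xi>. Word [Path \<xi>]) L"
    by (simp add: inj_on_def)
  have keys: "Poly_Mapping.keys b = (\<lambda>\<xi>. Word [Path \<xi>]) ` L"
    using assms by (auto simp: path_combo_def L_def)
  show "finite L"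
    using inj keys finite_imageD by (metis finite_keys)
  show "L \<subseteq> M" "src ` L \<subseteq> {w}"
    using assms by (auto simp: path_combo_def L_def)
  show "c \<xi> \<noteq> 0" if "\<xi> \<in> L" for \<xi>
    using that by (simp add: L_def c_def in_keys_iff)
  have "b = (\<Sum>w\<in>(\<lambda>\<xi>. Word [Path \<xi>]) ` L. Poly_Mapping.single w (Poly_Mapping.lookup b w))"
    using poly_mapping_expand[of b] unfolding keys .
  also have "\<dots> = (\<Sum>\<xi>\<in>L. scal (c \<xi>) * S \<xi>)"
    unfolding scal_gen c_def by (simp add: sum.reindex[OF inj])
  finally show "b = (\<Sum>\<xi>\<in>L. scal (c \<xi>) * S \<xi>)" .
qed

lemma path_combo_sum: "(\<And>i. i \<in> I \<Longrightarrow> path_combo w (f i)) \<Longrightarrow> path_combo w (\<Sum>i\<in>I. f i)"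
  by (induction I rule: infinite_finite_induct) (auto intro: path_combo_zero path_combo_add)

text \<open>Right cancellation makes \<xi> \<mapsto> \<xi>\<nu> injective, so no two coefficients of
  \<open>b\<close> are merged and none is lost.\<close>

lemma path_combo_shift:
  assumes b: "path_combo (rng \<nu>) b" and \<nu>: "\<nu> \<in> M"
  obtains b' where "path_combo (src \<nu>) b'" "b * S \<nu> \<approx> b'" "b' = 0 \<Longrightarrow> b = 0"
proof -
  obtain L c where L: "finite L" "L \<subseteq> M" "src ` L \<subseteq> {rng \<nu>}" "\<And>\<xi>. \<xi> \<in> L \<Longrightarrow> c \<xi> \<noteq> 0"
    "b = (\<Sum>\<xi>\<in>L. scal (c \<xi>) * S \<xi>)"
    by (rule path_combo_expand[OF b]) (rule that; assumption)
  then have LM: "\<xi> \<in> M" "src \<xi> = rng \<nu>" if "\<xi> \<in> L" for \<xi>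
    using that by auto
  define b' where "b' = (\<Sum>\<xi>\<in>L. scal (c \<xi>) * S (\<xi> \<cdot> \<nu>))"
  have "path_combo (src \<nu>) b'"
    unfolding b'_def using LM \<nu> by (intro path_combo_sum path_combo_S) auto
  moreover have "b * S \<nu> \<approx> b'"
    unfolding L(5) b'_def sum_distrib_right mult.assoc
    using LM \<nu> by (intro eqv_sum eqv_mult_left S_S)
  moreover have "b = 0" if "b' = 0"
  proof (rule ccontr)
    assume "b \<noteq> 0"
    then obtain \<xi> where \<xi>: "\<xi> \<in> L"
      using L(5) by fastforce
    have "0 = Poly_Mapping.lookup b' (Word [Path (\<xi> \<cdot> \<nu>)])"
      by (simp add: that)
    also have "\<dots> = (\<Sum>\<mu>\<in>L. if \<mu> = \<xi> then c \<xi> else 0)"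
      unfolding b'_def scal_gen lookup_sum lookup_single when_def
      using LM \<xi> \<nu> cancel_right by (intro sum.cong) auto
    also have "\<dots> = c \<xi>"
      using \<xi> L(1) by simp
    finally show False
      using L(4)[OF \<xi>] by simp
  qed
  ultimately show ?thesis
    using that by blast
qed

text \<open>Once every second index \<open>\<mu>\<close> of \<open>a\<close> is either an initial segment of \<open>\<tau>\<close> or excluded by \<open>N\<close>,
  only path terms are left.\<close>

lemma spanned_resolve:
  assumes "spanned a"
  shows "\<exists>D. finite D \<and> D \<subseteq> M \<and> (\<forall>\<tau>\<in>M. \<forall>N. set N \<subseteq> M \<and> (\<forall>\<mu>\<in>D. \<mu> \<preceq> \<tau> \<or> \<mu> \<in> set N) \<longrightarrow>
    (\<exists>b. path_combo (src \<tau>) b \<and> a * (Qprod N * S \<tau>) \<approx> b * (S' \<tau> * Qprod N * S \<tau>)))"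
  using assms
proof induction
  case zero
  then show ?case
    by (intro exI[of _ "{}"]) (auto intro!: exI[of _ 0] path_combo_zero)
next
  case (mono \<xi> \<mu> c)
  have "\<exists>b. path_combo (src \<tau>) b \<and>
      scal c * (S \<xi> * S' \<mu>) * (Qprod N * S \<tau>) \<approx> b * (S' \<tau> * Qprod N * S \<tau>)"
    if \<tau>: "\<tau> \<in> M" "set N \<subseteq> M" "\<mu> \<preceq> \<tau> \<or> \<mu> \<in> set N" for \<tau> N
  proof (cases "\<mu> \<preceq> \<tau>")
    case True
    then obtain \<gamma> where \<gamma>: "\<gamma> \<in> M" "src \<mu> = rng \<gamma>" "\<tau> = \<mu> \<cdot> \<gamma>"
      by (elim prefixE)
    have "S \<xi> * S' \<mu> * S \<tau> \<approx> S \<xi> * S \<gamma>"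
      unfolding mult.assoc \<gamma>(3) using mono \<gamma> by (intro eqv_mult_left S'_S_prefix)
    also have "\<dots> \<approx> S (\<xi> \<cdot> \<gamma>)"
      using mono \<gamma> by (intro S_S) auto
    finally have *: "S \<xi> * S' \<mu> * S \<tau> \<approx> S (\<xi> \<cdot> \<gamma>)" .
    \<comment> \<open>With \<open>S \<tau>\<close> in front, the ghost \<open>S' \<mu>\<close>
      cancels against it. The compressed projection remains as a right factor that is the same for
      every monomial, so the path terms can be added up.\<close>
    have "scal c * (S \<xi> * S' \<mu>) * (Qprod N * S \<tau>) \<approx>
        scal c * (S \<xi> * S' \<mu>) * (S \<tau> * (S' \<tau> * Qprod N * S \<tau>))"
      using \<tau> by (intro eqv_mult_left Qprod_S)
    also have "\<dots> = scal c * (S \<xi> * S' \<mu> * S \<tau>) * (S' \<tau> * Qprod N * S \<tau>)"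
      by (simp add: mult.assoc)
    also have "\<dots> \<approx> scal c * S (\<xi> \<cdot> \<gamma>) * (S' \<tau> * Qprod N * S \<tau>)"
      using * by (intro eqv_mult_right eqv_mult_left)
    finally show ?thesis
      using mono \<gamma> by (intro exI[of _ "scal c * S (\<xi> \<cdot> \<gamma>)"]) (auto intro!: path_combo_S)
  next
    case False
    then have "\<mu> \<in> set N"
      using \<tau> by simp
    have "scal c * (S \<xi> * S' \<mu>) * (Qprod N * S \<tau>) = scal c * S \<xi> * (S' \<mu> * Qprod N) * S \<tau>"
      by (simp add: mult.assoc)
    also have "\<dots> \<approx> scal c * S \<xi> * 0 * S \<tau>"
      using \<tau> \<open>\<mu> \<in> set N\<close> by (intro eqv_mult_left eqv_mult_right S'_Qprod)
    finally show ?thesis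
      using path_combo_zero by (intro exI[of _ 0]) auto
  qed
  then show ?case
    using mono by (intro exI[of _ "{\<mu>}"]) auto
next
  case (add a a')
  from add.IH(1) obtain D where D: "finite D" "D \<subseteq> M" "\<forall>\<tau>\<in>M. \<forall>N. set N \<subseteq> M \<and>
    (\<forall>\<mu>\<in>D. \<mu> \<preceq> \<tau> \<or> \<mu> \<in> set N) \<longrightarrow>
    (\<exists>b. path_combo (src \<tau>) b \<and> a * (Qprod N * S \<tau>) \<approx> b * (S' \<tau> * Qprod N * S \<tau>))"
    by (elim exE conjE)
  from add.IH(2) obtain D' where D': "finite D'" "D' \<subseteq> M" "\<forall>\<tau>\<in>M. \<forall>N. set N \<subseteq> M \<and>
    (\<forall>\<mu>\<in>D'. \<mu> \<preceq> \<tau> \<or> \<mu> \<in> set N) \<longrightarrow>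
    (\<exists>b. path_combo (src \<tau>) b \<and> a' * (Qprod N * S \<tau>) \<approx> b * (S' \<tau> * Qprod N * S \<tau>))"
    by (elim exE conjE)
  have "\<exists>b. path_combo (src \<tau>) b \<and> (a + a') * (Qprod N * S \<tau>) \<approx> b * (S' \<tau> * Qprod N * S \<tau>)"
    if \<tau>: "\<tau> \<in> M" "set N \<subseteq> M" "\<forall>\<mu>\<in>D \<union> D'. \<mu> \<preceq> \<tau> \<or> \<mu> \<in> set N" for \<tau> N
  proof -
    have "\<exists>b. path_combo (src \<tau>) b \<and> a * (Qprod N * S \<tau>) \<approx> b * (S' \<tau> * Qprod N * S \<tau>)"
      using D(3) \<tau> by simp
    moreover have "\<exists>b. path_combo (src \<tau>) b \<and> a' * (Qprod N * S \<tau>) \<approx> b * (S' \<tau> * Qprod N * S \<tau>)"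
      using D'(3) \<tau> by simp
    ultimately obtain b b' where b: "path_combo (src \<tau>) b"
      "a * (Qprod N * S \<tau>) \<approx> b * (S' \<tau> * Qprod N * S \<tau>)"
      and b': "path_combo (src \<tau>) b'" "a' * (Qprod N * S \<tau>) \<approx> b' * (S' \<tau> * Qprod N * S \<tau>)"
      by (elim exE conjE)
    show ?thesis
      unfolding distrib_right
      by (intro exI[of _ "b + b'"] conjI path_combo_add[OF b(1) b'(1)])
        (simp only: distrib_right eqv_add[OF b(2) b'(2)])
  qed
  then show ?case
    using D D' by (intro exI[of _ "D \<union> D'"]) auto
next
  case (eqv a a')
  have "a' * q \<approx> b" if "a * q \<approx> b" for q b
    by (rule eqv_trans[OF eqv_mult_right[OF eqv_sym[OF eqv.hyps(2)]] that])
  then show ?case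
    using eqv.IH by meson
qed

section \<open>(KP4) and a criterion for membership in the ideal of relations\<close>

lemma list_prod_fix:
  assumes "xs \<noteq> []" "\<And>x. x \<in> set xs \<Longrightarrow> q * x \<approx> q"
  shows "q * list_prod (*) xs \<approx> q"
  using assms
proof (induction xs rule: list_nonempty_induct)
  case (single x)
  then show ?case
    by (simp add: list_prod_def)
next
  case (cons x xs)
  have "q * list_prod (*) (x # xs) = q * x * list_prod (*) xs"
    using cons by (simp add: list_prod_def mult.assoc)
  also have "\<dots> \<approx> q * list_prod (*) xs"
    using cons by (intro eqv_mult_right) simp
  also have "\<dots> \<approx> q"
    using cons by simp
  finally show ?case .
qed

text \<open>Unless some \<open>n\<close> is a segment of \<tau>, the tails
  \<open>ext \<tau> (set N)\<close> are exhaustive. Each factor of their (KP4) product fixes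
  \<open>Qprod N * S \<tau>\<close>, because \<tau>\<rho> extends some \<open>n\<close> and its path
  is killed; yet the product of the factors is zero.\<close>

lemma Qprod_exhaust:
  assumes N: "set N \<subseteq> M" and \<tau>: "\<tau> \<in> M"
    and ex: "\<And>\<nu>. \<nu> \<in> M \<Longrightarrow> src \<tau> = rng \<nu> \<Longrightarrow> \<exists>n\<in>set N. compat (\<tau> \<cdot> \<nu>) n"
  shows "Qprod N * S \<tau> \<approx> 0"
proof (cases "\<exists>n\<in>set N. n \<preceq> \<tau>")
  case True
  then show ?thesis
    using Qprod_kill N by blast
next
  case False
  let ?q = "\<lambda>\<rho>. S (src \<tau>) - pr \<rho>"
  have E: "ext \<tau> (set N) \<in> FE \<Lambda> (src \<tau>)"
    using False ext_FE[OF \<tau> N] ex by blast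
  then obtain xs where xs: "distinct xs" "set xs = ext \<tau> (set N)"
    using finite_distinct_list unfolding FE_def by blast
  have 0: "list_prod (*) (map ?q xs) \<approx> 0"
    using xs E \<tau> by (intro relators_eqv kp_relators.KP4) auto
  have "Qprod N * S \<tau> * ?q \<rho> \<approx> Qprod N * S \<tau>" if "\<rho> \<in> set xs" for \<rho>
  proof -
    have \<rho>: "\<rho> \<in> M" "rng \<rho> = src \<tau>" "\<exists>n\<in>set N. n \<preceq> \<tau> \<cdot> \<rho>"
      using extD[of \<rho> \<tau> "set N"] that xs \<tau> N by auto
    have "Qprod N * S \<tau> * ?q \<rho> = Qprod N * (S \<tau> * S (src \<tau>)) - Qprod N * (S \<tau> * S \<rho>) * S' \<rho>"
      by (simp add: algebra_simps)
    also have "\<dots> \<approx> Qprod N * S \<tau> - Qprod N * S (\<tau> \<cdot> \<rho>) * S' \<rho>"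
      using \<rho> \<tau> by (intro eqv_diff eqv_mult_left eqv_mult_right S_src S_S) auto
    also have "\<dots> \<approx> Qprod N * S \<tau> - 0 * S' \<rho>"
      using Qprod_kill \<rho>(3) N by (intro eqv_diff eqv_refl eqv_mult_right) blast
    finally show ?thesis
      by simp
  qed
  then have "Qprod N * S \<tau> * list_prod (*) (map ?q xs) \<approx> Qprod N * S \<tau>"
    using FE_nonempty[OF _ E] xs \<tau> by (intro list_prod_fix) auto
  from eqv_trans[OF eqv_sym[OF this] eqv_mult_left[OF 0]] show ?thesis
    by simp
qed

text \<open>Read contrapositively, this finds \<tau> such that \<open>a * S \<tau>\<close> is
  congruent to a formally nonzero combination of paths. The second indices of \<open>a\<close> are
  decided one after the other; once all are, either (KP4) gives zero or the hypothesis applies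
  further along \<tau>.\<close>

lemma eqv_0_criterion:
  assumes a: "spanned a"
    and H: "\<And>\<tau> b. \<tau> \<in> M \<Longrightarrow> path_combo (src \<tau>) b \<Longrightarrow> a * S \<tau> \<approx> b \<Longrightarrow> b = 0"
  shows "a \<approx> 0"
proof -
  from spanned_resolve[OF a] obtain D where D: "finite D" "D \<subseteq> M" "\<forall>\<tau>\<in>M. \<forall>N. set N \<subseteq> M \<and>
    (\<forall>\<mu>\<in>D. \<mu> \<preceq> \<tau> \<or> \<mu> \<in> set N) \<longrightarrow>
    (\<exists>b. path_combo (src \<tau>) b \<and> a * (Qprod N * S \<tau>) \<approx> b * (S' \<tau> * Qprod N * S \<tau>))"
    by (elim exE conjE)
  \<comment> \<open>\<open>U\<close> holds the indices that are still undecided; every other one is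
    a segment of \<tau> or excluded by \<open>N\<close>.\<close>
  have "a * Qprod N * S \<tau> \<approx> 0"
    if "finite U" "\<tau> \<in> M" "set N \<subseteq> M" "U \<subseteq> D" "\<forall>\<mu>\<in>D - U. \<mu> \<preceq> \<tau> \<or> \<mu> \<in> set N" for U \<tau> N
    using that
  proof (induction U arbitrary: \<tau> N rule: finite_induct)
    case empty
    then have "\<exists>b. path_combo (src \<tau>) b \<and> a * (Qprod N * S \<tau>) \<approx> b * (S' \<tau> * Qprod N * S \<tau>)"
      using D(3) by simp
    then obtain b where b: "path_combo (src \<tau>) b" "a * (Qprod N * S \<tau>) \<approx> b * (S' \<tau> * Qprod N * S \<tau>)"
      by (elim exE conjE)
    show ?case
    proof (cases "\<forall>\<nu>\<in>M. src \<tau> = rng \<nu> \<longrightarrow> (\<exists>n\<in>set N. compat (\<tau> \<cdot> \<nu>) n)")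
      case True
      then have "Qprod N * S \<tau> \<approx> 0"
        using empty by (intro Qprod_exhaust) auto
      then show ?thesis
        using eqv_mult_left[of "Qprod N * S \<tau>" 0 a] by (simp add: mult.assoc)
    next
      case False
      \<comment> \<open>Beyond \<tau>\<nu> the cylinders of \<open>N\<close> are avoided and
        \<open>Qprod N\<close> acts as the identity. Multiplying by \<open>S \<nu>\<close> therefore
        gives that \<open>a * S (\<tau> \<cdot> \<nu>)\<close> is congruent to
        \<open>b * S \<nu>\<close>, a combination of paths; the hypothesis annuls its coefficients,
        and with them those of \<open>b\<close>.\<close>
      then obtain \<nu> where \<nu>: "\<nu> \<in> M" "src \<tau> = rng \<nu>" "\<And>n. n \<in> set N \<Longrightarrow> \<not> compat n (\<tau> \<cdot> \<nu>)"
        using compat_sym by blast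
      have fixed: "Qprod N * S (\<tau> \<cdot> \<nu>) \<approx> S (\<tau> \<cdot> \<nu>)"
        using \<nu> empty by (intro Qprod_fix) auto
      have SS: "S \<tau> * S \<nu> \<approx> S (\<tau> \<cdot> \<nu>)"
        using \<nu> empty by (intro S_S)
      have QS: "Qprod N * S \<tau> * S \<nu> \<approx> S (\<tau> \<cdot> \<nu>)"
        unfolding mult.assoc by (rule eqv_trans[OF eqv_mult_left[OF SS] fixed])
      obtain b' where b': "path_combo (src \<nu>) b'" "b * S \<nu> \<approx> b'" "b' = 0 \<Longrightarrow> b = 0"
        by (rule path_combo_shift[of \<nu> b]) (use b(1) \<nu> in auto)
      have "a * S (\<tau> \<cdot> \<nu>) \<approx> a * (Qprod N * S \<tau> * S \<nu>)"
        by (rule eqv_mult_left[OF eqv_sym[OF QS]])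
      also have "\<dots> = a * (Qprod N * S \<tau>) * S \<nu>"
        by (simp add: mult.assoc)
      also have "\<dots> \<approx> b * (S' \<tau> * Qprod N * S \<tau>) * S \<nu>"
        by (rule eqv_mult_right[OF b(2)])
      also have "\<dots> = b * S' \<tau> * (Qprod N * S \<tau> * S \<nu>)"
        by (simp add: mult.assoc)
      also have "\<dots> \<approx> b * S' \<tau> * S (\<tau> \<cdot> \<nu>)"
        by (rule eqv_mult_left[OF QS])
      also have "\<dots> = b * (S' \<tau> * S (\<tau> \<cdot> \<nu>))"
        by (simp add: mult.assoc)
      also have "\<dots> \<approx> b * S \<nu>"
        using empty \<nu> by (intro eqv_mult_left S'_S_prefix)
      also have "\<dots> \<approx> b'"
        by (rule b'(2))
      finally have "b' = 0"
        using H[of "\<tau> \<cdot> \<nu>" b'] b'(1) \<nu> empty by simp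
      then show ?thesis
        using b b'(3) by (simp add: mult.assoc)
    qed
  next
    case (insert \<mu> U)
    have \<mu>: "\<mu> \<in> M"
      using insert.prems D by auto
    \<comment> \<open>Deciding \<mu>: either it joins \<open>N\<close>, or \<tau> is lengthened to
      \<tau>\<sigma>, which extends \<mu>. Earlier decisions persist under the lengthening.\<close>
    have "a * Qprod N * S \<tau> \<approx>
        a * Qprod (\<mu> # N) * S \<tau> + (\<Sum>(\<rho>, \<sigma>)\<in>Lmin \<Lambda> \<mu> \<tau>. a * Qprod N * S (\<tau> \<cdot> \<sigma>) * S' \<sigma>)"
      using \<mu> insert.prems by (intro Qprod_step)
    also have "\<dots> \<approx> 0 + 0"
    proof (intro eqv_add eqv_sum_0)
      show "a * Qprod (\<mu> # N) * S \<tau> \<approx> 0"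
        using insert.prems \<mu> by (intro insert.IH) auto
      fix p assume "p \<in> Lmin \<Lambda> \<mu> \<tau>"
      then obtain \<rho> \<sigma> where p: "p = (\<rho>, \<sigma>)" "(\<rho>, \<sigma>) \<in> Lmin \<Lambda> \<mu> \<tau>"
        by (cases p) auto
      then have "\<rho> \<in> M" "\<sigma> \<in> M" "src \<mu> = rng \<rho>" "src \<tau> = rng \<sigma>" "\<mu> \<cdot> \<rho> = \<tau> \<cdot> \<sigma>"
        using \<mu> insert.prems by (auto simp: Lmin_iff)
      then have *: "\<tau> \<preceq> \<tau> \<cdot> \<sigma>" "\<mu> \<preceq> \<tau> \<cdot> \<sigma>" "\<tau> \<cdot> \<sigma> \<in> M"
        using \<mu> insert.prems prefixI[of \<mu> \<rho>] prefixI[of \<tau> \<sigma>] by auto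
      then have "\<forall>\<mu>'\<in>D - U. \<mu>' \<preceq> \<tau> \<cdot> \<sigma> \<or> \<mu>' \<in> set N"
        using insert.prems prefix_trans by blast
      then have "a * Qprod N * S (\<tau> \<cdot> \<sigma>) \<approx> 0"
        using insert.prems * by (intro insert.IH) auto
      then show "(case p of (\<rho>, \<sigma>) \<Rightarrow> a * Qprod N * S (\<tau> \<cdot> \<sigma>) * S' \<sigma>) \<approx> 0"
        using eqv_mult_right[of _ 0 "S' \<sigma>"] p by simp
    qed
    finally show ?case
      by simp
  qed
  \<comment> \<open>With all of \<open>D\<close> undecided and \<open>N\<close> empty the side
    condition is void, and \<open>Qprod []\<close> is 1. Taking vertices for \<tau>, the local units
    give \<open>a\<close> itself.\<close>
  from this[OF D(1), of _ "[]"] have 0: "a * S v \<approx> 0" if "v \<in> vertices \<Lambda>" for v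
    using that vertices_M by simp
  obtain V where V: "finite V" "V \<subseteq> vertices \<Lambda>" "(\<Sum>v\<in>V. a * S v) \<approx> a"
    using spanned_local_unit[OF a] by blast
  have "(\<Sum>v\<in>V. a * S v) \<approx> 0"
    using V(2) 0 by (intro eqv_sum_0) auto
  then show ?thesis
    using V(3) eqv_sym eqv_trans by blast
qed

section \<open>Basic simplicity from separability and cofinality\<close>

lemma list_prod_cong_ideal:
  assumes J: "two_sided J" and "u * u - u \<in> J" "xs \<noteq> []" "\<And>x. x \<in> set xs \<Longrightarrow> x - u \<in> J"
  shows "list_prod (*) xs - u \<in> J"
  using assms(3-)
proof (induction xs rule: list_nonempty_induct)
  case (single x)
  then show ?case
    by (simp add: list_prod_def)
next
  case (cons x xs)
  \<comment> \<open>The sum telescopes to the product of \<open>x\<close> with the product over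
    \<open>xs\<close>, minus \<open>u\<close>.\<close>
  have "(x - u) * list_prod (*) xs + u * (list_prod (*) xs - u) + (u * u - u) \<in> J"
    using cons assms(2) by (intro two_sidedD(2-4)[OF J]) auto
  then show ?case
    using cons by (simp add: list_prod_def algebra_simps)
qed

lemma separable_cofinal_imp_basically_simple:
  assumes sep: separable and cof: "cofinal_kgraph \<Lambda>"
  shows "basically_simple TYPE('r) \<Lambda>"
  unfolding basically_simple_iff
proof (intro allI impI)
  fix J :: "('a gen word \<Rightarrow>\<^sub>0 'r) set" assume J: "basic J"
  define J' where "J' = {f. proj (generators \<Lambda>) f \<in> J}"
  have fJ: "fideal (generators \<Lambda>) J" "kp_ideal \<Lambda> \<subseteq> J"
    using J by (auto simp: basic_def)
  have J': "two_sided J'"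
    unfolding J'_def by (intro two_sided_proj fJ)
  have J'_iff: "f \<in> J' \<longleftrightarrow> f \<in> J" if "f \<in> fc" for f
    using that by (simp add: J'_def proj_fcarrier)
  have J'_diff: "a - b \<in> J'" if "a \<approx> b" for a b
    using that fJ(2) by (auto simp: J'_def eqv_def)
  have J'_eqv: "b \<in> J'" if "a \<in> J'" "a \<approx> b" for a b
    using two_sidedD(2)[OF J' J'_diff[OF eqv_sym[OF that(2)]] that(1)] by simp
  show "J = kp_ideal \<Lambda> \<or> J = fc"
  proof (rule ccontr)
    assume "\<not> ?thesis"
    then obtain a where a: "a \<in> J" "a \<notin> kp_ideal \<Lambda>" and ne: "J \<noteq> fc"
      using fJ(2) by blast
    then have "a \<in> fc"
      using fidealD(1)[OF fJ(1)] by blast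
    then have "\<not> a \<approx> 0"
      using a eqv_0_iff by blast
    then obtain \<tau> b where b: "\<tau> \<in> M" "path_combo (src \<tau>) b" "a * S \<tau> \<approx> b" "b \<noteq> 0"
      using eqv_0_criterion[OF spanned_fc[OF \<open>a \<in> fc\<close>]] by blast
    have "b \<in> J'"
      using J'_eqv[OF _ b(3)] two_sidedD(4)[OF J'] a(1) J'_iff \<open>a \<in> fc\<close> by blast
    obtain L c where L: "finite L" "L \<subseteq> M" "src ` L \<subseteq> {src \<tau>}" "\<And>\<xi>. \<xi> \<in> L \<Longrightarrow> c \<xi> \<noteq> 0"
      "b = (\<Sum>\<xi>\<in>L. scal (c \<xi>) * S \<xi>)"
      by (rule path_combo_expand[OF b(2)]) (rule that; assumption)
    then obtain \<xi> where \<xi>: "\<xi> \<in> L"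
      using b(4) by fastforce
    have LM: "\<mu> \<in> M" "src \<mu> = src \<tau>" if "\<mu> \<in> L" for \<mu>
      using that L by auto
    have "\<exists>\<nu>\<in>M. rng \<nu> = src \<xi> \<and> (\<forall>\<mu>\<in>L - {\<xi>}. \<not> compat (\<xi> \<cdot> \<nu>) (\<mu> \<cdot> \<nu>))"
      by (rule separable_finite[OF sep]) (use L(1) \<xi> LM in auto)
    then obtain \<nu> where \<nu>: "\<nu> \<in> M" "rng \<nu> = src \<tau>" "\<And>\<mu>. \<mu> \<in> L - {\<xi>} \<Longrightarrow> \<not> compat (\<xi> \<cdot> \<nu>) (\<mu> \<cdot> \<nu>)"
      unfolding LM(2)[OF \<xi>] by blast
    let ?w = "src \<nu>"
    \<comment> \<open>The ghost of \<xi>\<nu> annihilates every \<mu>\<nu> with \<mu> \<noteq> \<xi>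
      by the choice of \<nu>, and turns \<xi>\<nu> into its source.\<close>
    have "S' (\<xi> \<cdot> \<nu>) * b * S \<nu> = (\<Sum>\<mu>\<in>L. scal (c \<mu>) * (S' (\<xi> \<cdot> \<nu>) * (S \<mu> * S \<nu>)))"
      unfolding L(5) sum_distrib_left sum_distrib_right
      by (simp only: scal_left_commute mult.assoc)
    also have "\<dots> \<approx> (\<Sum>\<mu>\<in>L. scal (c \<mu>) * (if \<mu> = \<xi> then S ?w else 0))"
    proof (intro eqv_sum eqv_mult_left)
      fix \<mu> assume \<mu>: "\<mu> \<in> L"
      have "S' (\<xi> \<cdot> \<nu>) * (S \<mu> * S \<nu>) \<approx> S' (\<xi> \<cdot> \<nu>) * S (\<mu> \<cdot> \<nu>)"
        using \<nu> LM \<mu> by (intro eqv_mult_left S_S) auto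
      also have "\<dots> \<approx> (if \<mu> = \<xi> then S ?w else 0)"
      proof (cases "\<mu> = \<xi>")
        case True
        then show ?thesis
          using S'_S_same[of "\<xi> \<cdot> \<nu>"] \<nu> LM[OF \<xi>] by simp
      next
        case False
        then show ?thesis
          using S'_S_0[of "\<xi> \<cdot> \<nu>" "\<mu> \<cdot> \<nu>"] \<nu> LM[OF \<xi>] LM[OF \<mu>] \<mu> by simp
      qed
      finally show "S' (\<xi> \<cdot> \<nu>) * (S \<mu> * S \<nu>) \<approx> (if \<mu> = \<xi> then S ?w else 0)" .
    qed
    also have "\<dots> = (\<Sum>\<mu>\<in>L. if \<mu> = \<xi> then scal (c \<xi>) * S ?w else 0)"
      by (intro sum.cong) auto
    also have "\<dots> = scal (c \<xi>) * S ?w"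
      using \<xi> L(1) by simp
    finally have "scal (c \<xi>) * S ?w \<in> J'"
      using J'_eqv two_sidedD(3,4)[OF J'] \<open>b \<in> J'\<close> by blast
    then have "scal (c \<xi>) * S ?w \<in> J"
      using J'_iff \<nu> by (simp add: fcarrier_scal)
    \<comment> \<open>Here the ideal has to be basic: the coefficient is nonzero but need not be
      invertible.\<close>
    then have "S ?w \<in> J"
      using J L(4)[OF \<xi>] \<nu> unfolding basic_def by auto
    then have w: "S ?w \<in> J'"
      using J'_iff \<nu> by simp
    have hereditary: "S (src \<kappa>) \<in> J'" if \<kappa>: "\<kappa> \<in> M" "S (rng \<kappa>) \<in> J'" for \<kappa>
    proof -
      have "S' \<kappa> * (S (rng \<kappa>) * S \<kappa>) \<in> J'"
        using two_sidedD(3,4)[OF J'] \<kappa>(2) by blast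
      moreover have "S' \<kappa> * (S (rng \<kappa>) * S \<kappa>) \<approx> S (src \<kappa>)"
        using eqv_trans[OF eqv_mult_left[OF rng_S] S'_S_same] \<kappa>(1) by blast
      ultimately show ?thesis
        using J'_eqv by blast
    qed
    \<comment> \<open>If all sources of \<open>E\<close> lie in the ideal, so do the projections
      \<open>pr e\<close>. Modulo the ideal every factor of the (KP4) product is then
      \<open>S v\<close>, hence so is the product, which vanishes.\<close>
    have saturated: "S v \<in> J'"
      if v: "v \<in> vertices \<Lambda>" "E \<in> FE \<Lambda> v" "\<And>e. e \<in> E \<Longrightarrow> S (src e) \<in> J'" for v E
    proof -
      let ?q = "\<lambda>e. S v - pr e :: 'a gen word \<Rightarrow>\<^sub>0 'r"
      obtain xs where xs: "distinct xs" "set xs = E"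
        using v(2) finite_distinct_list unfolding FE_def by blast
      have "list_prod (*) (map ?q xs) \<approx> 0"
        using xs v by (intro relators_eqv kp_relators.KP4) auto
      then have "list_prod (*) (map ?q xs) \<in> J'"
        using J'_diff[of "list_prod (*) (map ?q xs)" 0] by simp
      moreover have "list_prod (*) (map ?q xs) - S v \<in> J'"
      proof (rule list_prod_cong_ideal[OF J'])
        show "S v * S v - S v \<in> J'"
          using relators_eqv_diff[OF kp_relators.KP1_idem[OF v(1)]] J'_diff by blast
        show "map ?q xs \<noteq> []"
          using FE_nonempty[OF v(1,2)] xs by auto
        fix x assume "x \<in> set (map ?q xs)"
        then obtain e where e: "e \<in> E" "x = ?q e"
          using xs by auto
        then have "e \<in> M"
          using v by (auto simp: FE_iff)
        have "S e * S (src e) * S' e \<in> J'"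
          using two_sidedD(3,4)[OF J'] v(3)[OF e(1)] by blast
        then have "pr e \<in> J'"
          using J'_eqv[OF _ eqv_mult_right[OF S_src[OF \<open>e \<in> M\<close>]]] by blast
        then show "x - S v \<in> J'"
          using two_sidedD(5)[OF J'] e(2) by simp
      qed
      ultimately have "list_prod (*) (map ?q xs) - (list_prod (*) (map ?q xs) - S v) \<in> J'"
        by (rule two_sidedD(6)[OF J'])
      then show ?thesis
        by simp
    qed
    have all: "S v \<in> J'" if v: "v \<in> vertices \<Lambda>" for v
    proof (rule ccontr)
      assume "S v \<notin> J'"
      \<comment> \<open>The vertices outside the ideal. Saturation is exactly the hypothesis of
        \<open>generic_tight\<close> on \<open>W\<close>; no further dense sets are needed.\<close>
      define W where "W = {u. S u \<notin> J'}"
      have "\<exists>X. tight X \<and> v \<in> X \<and> (\<forall>D\<in>{}. X \<inter> D \<noteq> {}) \<and> (\<forall>\<alpha>\<in>X. \<exists>\<beta>. \<alpha> \<preceq> \<beta> \<and> src \<beta> \<in> W)"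
      proof (rule generic_tight)
        show "v \<in> W" "v \<in> vertices \<Lambda>"
          using v \<open>S v \<notin> J'\<close> by (auto simp: W_def)
        show "\<exists>e\<in>E. src e \<in> W" if "u \<in> W" "u \<in> vertices \<Lambda>" "E \<in> FE \<Lambda> u" for u E
          using that saturated[of u E] by (auto simp: W_def)
      qed auto
      then obtain X where X: "tight X" "\<And>\<alpha>. \<alpha> \<in> X \<Longrightarrow> \<exists>\<beta>. \<alpha> \<preceq> \<beta> \<and> src \<beta> \<in> W"
        by blast
      \<comment> \<open>By cofinality the vertex \<open>?w\<close> of the ideal reaches the source
        of some \<alpha> in the filter. Heredity along \<kappa> and then along the tail from
        \<alpha> to \<beta> puts \<open>src \<beta>\<close> into the ideal, though it lies in
        \<open>W\<close>.\<close>
      obtain \<alpha> \<kappa> where \<alpha>: "\<alpha> \<in> X" "\<kappa> \<in> M" "rng \<kappa> = ?w" "src \<kappa> = src \<alpha>"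
        using cof \<nu>(1) X(1) unfolding cofinal_iff by (metis src_in_vertices)
      obtain \<beta> where \<beta>: "\<alpha> \<preceq> \<beta>" "src \<beta> \<in> W"
        using X(2) \<alpha> by blast
      then obtain \<gamma> where "\<alpha> \<in> M" "\<gamma> \<in> M" "src \<alpha> = rng \<gamma>" "\<beta> = \<alpha> \<cdot> \<gamma>"
        by (elim prefixE)
      then have "S (src \<beta>) \<in> J'"
        using hereditary[of \<kappa>] hereditary[of \<gamma>] \<alpha> w by simp
      then show False
        using \<beta>(2) by (simp add: W_def)
    qed
    have "f \<in> J'" if "spanned f" for f
      using that
    proof induction
      case zero
      then show ?case
        using two_sidedD(1)[OF J'] .
    next
      case (mono \<xi> \<mu> c)
      have "S (rng \<xi>) * S \<xi> \<in> J'"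
        using all[of "rng \<xi>"] mono two_sidedD(4)[OF J'] by simp
      then have "S \<xi> \<in> J'"
        using J'_eqv rng_S mono by blast
      then show ?case
        using two_sidedD(3,4)[OF J'] by blast
    next
      case (add a b)
      then show ?case
        using two_sidedD(2)[OF J'] by blast
    next
      case (eqv a b)
      then show ?case
        using J'_eqv by blast
    qed
    then have "fc \<subseteq> J"
      using J'_iff spanned_fc by blast
    then show False
      using ne fidealD(1)[OF fJ(1)] by blast
  qed
qed

end

end

theorem theorem9p3:
  fixes \<Lambda> :: "('a, 'k::finite) kgraph"
  assumes "k_graph \<Lambda>" and "finitely_aligned \<Lambda>"
  shows "basically_simple TYPE('r::comm_ring_1) \<Lambda> \<longleftrightarrow> aperiodic_kgraph \<Lambda> \<and> cofinal_kgraph \<Lambda>"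
proof -
  interpret fa_kgraph \<Lambda>
    using assms by (simp add: fa_kgraph_def fa_kgraph_axioms_def)
  show ?thesis
    unfolding aperiodic_iff_separable
    using separable_cofinal_imp_basically_simple basically_simple_imp_separable
      basically_simple_imp_cofinal by blast
qed

end
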